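(* (a) Let $\mathbf{p}\in\Bbbk^{\mathtt{I}}$ be such that, for all $i\in\mathtt{I}$, $p_i\in\mathbb{Z}$ implies $p_i\in\{0,1,2,\dots\}$. Then $B(\mathbf{p})$ and $B(\mathbf{p})^{\star}$ are the injective envelope and the projective cover of $L(\mathbf{p})$ in $\mathfrak{W}$, respectively. (b) Let $\mathbf{p}\in\Bbbk^{\mathtt{I}}$ be such that, for all $i\in\mathtt{I}$, $p_i\in\mathbb{Z}$ implies $p_i\in\{-1,-2,\dots\}$. Then $B(\mathbf{p})$ and $B(\mathbf{p})^{\star}$ are the projective cover and the injective envelope of $L(\mathbf{p})$ in $\mathfrak{W}$, respectively.
   Context: Let $\Bbbk$ be an algebraically closed field of characteristic zero and $\mathtt{I}$ an infinite set with $|\mathtt{I}|<|\Bbbk|$. Let $B$ be the polynomial $\Bbbk$-algebra in the variables $x_i$, $i\in\mathtt{I}$. The infinite Weyl algebra $A$ is the subalgebra of $\mathrm{End}_{\Bbbk}(B)$ generated by all $X_i$ (multiplication by $x_i$) and all $Y_i$ (partial derivative $\partial_i$ with respect to $x_i$), $i\in\mathtt{I}$. Put $t_i:=X_iY_i$ and let $A_0\subset A$ be the (commutative) subalgebra generated by all $t_i$. Let $\Bbbk^{\mathtt{I}}$ be the additive group of all vectors $(v_i)_{i\in\mathtt{I}}$ with coefficients in $\Bbbk$, and $\mathbb{Z}_f^{\mathtt{I}}\subset\Bbbk^{\mathtt{I}}$ the subgroup of integral vectors with at most finitely many nonzero coefficients. For $\mathbf{p}\in\Bbbk^{\mathtt{I}}$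 let $\mathfrak{m}_{\mathbf{p}}$ be the maximal ideal of $A_0$ generated by $t_i-p_i$, $i\in\mathtt{I}$. Modules are left modules. An $A$-module $M$ is a weight module if $M=\bigoplus_{\mathbf{p}\in\Bbbk^{\mathtt{I}}}M_{\mathbf{p}}$, where $M_{\mathbf{p}}=\{x\in M: t_i\cdot x=p_i x\ \forall i\in\mathtt{I}\}$. $\mathfrak{W}$ is the full subcategory of the category of all $A$-modules consisting of all weight modules. Put $P(\mathbf{p}):=A/A\mathfrak{m}_{\mathbf{p}}\in\mathfrak{W}$; it has a unique maximal submodule, and $L(\mathbf{p})$ denotes its unique simple quotient. $B(\mathbf{p})$ is the $\Bbbk$-vector space with basis the formal monomials $\mathbf{x}^{\mathbf{m}}=\prod_{i\in\mathtt{I}}x_i^{m_i}$, $\mathbf{m}\in\mathbf{p}+\mathbb{Z}_f^{\mathtt{I}}$, on which $X_i$ acts by multiplication with $x_i$ and $Y_i$ acts by partial derivative with respect to $x_i$; that is, $X_i\mathbf{x}^{\mathbf{m}}=\mathbf{x}^{\mathbf{m}+\mathbf{e}_i}$ and $Y_i\mathbf{x}^{\mathbf{m}}=m_i\mathbf{x}^{\mathbf{m}-\mathbf{e}_i}$, where $\mathbf{e}_i$ is the $i$-th standard unit vector. This is a weight $A$-module with one-dimensional nonzero weight spaces. Let $\diamond$ be the involutive anti-automorphism of $A$ with $X_i^{\diamond}=Y_i$, $Y_i^{\diamond}=X_i$. For a weight module $M$ with finite dimensional weight spaces, $M^{\star}:=\bigoplus_{\mathbf{p}\in\Bbbk^{\mathtt{I}}}\mathrm{Hom}_{\Bbbk}(M_{\mathbf{p}},\Bbbk)$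 with left $A$-action $(a\cdot f)(x)=f(a^{\diamond}x)$ (each $\mathrm{Hom}_{\Bbbk}(M_{\mathbf{p}},\Bbbk)$ being viewed as the functionals on $M$ vanishing on the other weight spaces). *)

theory Defs
  imports
    "HOL-Algebra.Generated_Rings"
    "HOL-Algebra.Generated_Groups"
    "HOL-Algebra.QuotRing"
    "HOL-Algebra.Module"
    "HOL-Library.Poly_Mapping"
    "HOL-Library.Equipollence"
    "HOL-Computational_Algebra.Polynomial"
begin

section \<open>Linear operators on a vector space with a chosen basis\<close>

text \<open>The type \<open>'b \<Rightarrow>\<^sub>0 'k\<close> is the vector space with basis \<open>'b\<close>; the basis vector
  belonging to \<open>m\<close> is \<open>Poly_Mapping.single m 1\<close>.\<close>

definition scal :: "'k::field \<Rightarrow> ('b \<Rightarrow>\<^sub>0 'k) \<Rightarrow> ('b \<Rightarrow>\<^sub>0 'k)"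
  where "scal c f = Poly_Mapping.map ((*) c) f"

definition lin_ext :: "('b \<Rightarrow> ('c \<Rightarrow>\<^sub>0 'k::field)) \<Rightarrow> ('b \<Rightarrow>\<^sub>0 'k) \<Rightarrow> ('c \<Rightarrow>\<^sub>0 'k)"
  where "lin_ext g f = (\<Sum>m\<in>Poly_Mapping.keys f. scal (Poly_Mapping.lookup f m) (g m))"

definition End_ring :: "(('b \<Rightarrow>\<^sub>0 'k::field) \<Rightarrow> ('b \<Rightarrow>\<^sub>0 'k)) ring"
  where "End_ring = \<lparr>carrier = {T. Vector_Spaces.linear scal scal T},
    monoid.mult = (\<circ>), one = id, zero = (\<lambda>_. 0), add = (\<lambda>S T f. S f + T f)\<rparr>"

section \<open>The infinite Weyl algebra\<close>

type_synonym ('i, 'k) polys = "('i \<Rightarrow>\<^sub>0 nat) \<Rightarrow>\<^sub>0 'k"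
type_synonym ('i, 'k) opr = "('i, 'k) polys \<Rightarrow> ('i, 'k) polys"

definition X_op :: "'i \<Rightarrow> ('i, 'k::field) opr"
  where "X_op i f = Poly_Mapping.single (Poly_Mapping.single i 1) 1 * f"

text \<open>The truncated subtraction of exponents is harmless: the coefficient is \<open>0\<close> when
  \<open>x\<^sub>i\<close> does not occur.\<close>

definition Y_op :: "'i \<Rightarrow> ('i, 'k::field) opr"
  where "Y_op i = lin_ext (\<lambda>m. Poly_Mapping.single (m - Poly_Mapping.single i 1)
    (of_nat (Poly_Mapping.lookup m i)))"

definition t_op :: "'i \<Rightarrow> ('i, 'k::field) opr"
  where "t_op i = X_op i \<circ> Y_op i"

text \<open>A subalgebra generated by a set is the subring generated by this set and the scalars.\<close>

definition weyl :: "('i, 'k::field) opr ring"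
  where "weyl = End_ring\<lparr>carrier := generate_ring End_ring
    (range scal \<union> range X_op \<union> range Y_op)\<rparr>"

definition weyl0 :: "('i, 'k::field) opr ring"
  where "weyl0 = End_ring\<lparr>carrier := generate_ring End_ring (range scal \<union> range t_op)\<rparr>"

definition max_ideal :: "('i \<Rightarrow> 'k::field) \<Rightarrow> ('i, 'k) opr set"
  where "max_ideal p = Idl\<^bsub>weyl0\<^esub> (range (\<lambda>i. t_op i \<ominus>\<^bsub>weyl0\<^esub> scal (p i)))"

definition opposite_ring :: "('a, 'z) ring_scheme \<Rightarrow> 'a ring"
  where "opposite_ring R = \<lparr>carrier = carrier R, monoid.mult = (\<lambda>a b. b \<otimes>\<^bsub>R\<^esub> a), one = \<one>\<^bsub>R\<^esub>,
    zero = \<zero>\<^bsub>R\<^esub>, add = (\<oplus>\<^bsub>R\<^esub>)\<rparr>"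

definition diamond :: "('i, 'k::field) opr \<Rightarrow> ('i, 'k) opr"
  where "diamond = (THE \<phi>. \<phi> \<in> extensional (carrier weyl)
    \<and> \<phi> \<in> ring_iso weyl (opposite_ring weyl)
    \<and> (\<forall>a\<in>carrier weyl. \<phi> (\<phi> a) = a)
    \<and> (\<forall>c. \<phi> (scal c) = scal c)
    \<and> (\<forall>i. \<phi> (X_op i) = Y_op i) \<and> (\<forall>i. \<phi> (Y_op i) = X_op i))"

section \<open>Left modules over a ring that need not be commutative\<close>

text \<open>The axioms are those of the library locale \<open>module\<close>, which requires a commutative ring.
  As there, a module is a record extending a ring record, whose multiplicative part is
  irrelevant.\<close>

locale left_module = R?: ring R + M?: abelian_group M
  for R :: "('a, 'y) ring_scheme" (structure) and M :: "('a, 'b, 'z) module_scheme" (structure) +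
  assumes smult_closed [simp, intro]:
      "\<lbrakk>a \<in> carrier R; x \<in> carrier M\<rbrakk> \<Longrightarrow> a \<odot>\<^bsub>M\<^esub> x \<in> carrier M"
    and smult_l_distr:
      "\<lbrakk>a \<in> carrier R; b \<in> carrier R; x \<in> carrier M\<rbrakk> \<Longrightarrow>
      (a \<oplus>\<^bsub>R\<^esub> b) \<odot>\<^bsub>M\<^esub> x = a \<odot>\<^bsub>M\<^esub> x \<oplus>\<^bsub>M\<^esub> b \<odot>\<^bsub>M\<^esub> x"
    and smult_r_distr:
      "\<lbrakk>a \<in> carrier R; x \<in> carrier M; y \<in> carrier M\<rbrakk> \<Longrightarrow>
      a \<odot>\<^bsub>M\<^esub> (x \<oplus>\<^bsub>M\<^esub> y) = a \<odot>\<^bsub>M\<^esub> x \<oplus>\<^bsub>M\<^esub> a \<odot>\<^bsub>M\<^esub> y"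
    and smult_assoc1:
      "\<lbrakk>a \<in> carrier R; b \<in> carrier R; x \<in> carrier M\<rbrakk> \<Longrightarrow>
      (a \<otimes>\<^bsub>R\<^esub> b) \<odot>\<^bsub>M\<^esub> x = a \<odot>\<^bsub>M\<^esub> (b \<odot>\<^bsub>M\<^esub> x)"
    and smult_one [simp]:
      "x \<in> carrier M \<Longrightarrow> \<one>\<^bsub>R\<^esub> \<odot>\<^bsub>M\<^esub> x = x"

definition mod_hom ::
  "('a, 'y) ring_scheme \<Rightarrow> ('a, 'b) module \<Rightarrow> ('a, 'c) module \<Rightarrow> ('b \<Rightarrow> 'c) set"
  where "mod_hom R M N = {f \<in> hom (add_monoid M) (add_monoid N).
    \<forall>a\<in>carrier R. \<forall>x\<in>carrier M. f (a \<odot>\<^bsub>M\<^esub> x) = a \<odot>\<^bsub>N\<^esub> f x}"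

definition regular_module :: "('a, 'y) ring_scheme \<Rightarrow> ('a, 'a) module"
  where "regular_module R = \<lparr>carrier = carrier R, monoid.mult = undefined, one = undefined,
    zero = \<zero>\<^bsub>R\<^esub>, add = (\<oplus>\<^bsub>R\<^esub>), module.smult = (\<otimes>\<^bsub>R\<^esub>)\<rparr>"

definition quotient_module :: "('a, 'b) module \<Rightarrow> 'b set \<Rightarrow> ('a, 'b set) module"
  where "quotient_module M N = \<lparr>carrier = a_rcosets\<^bsub>M\<^esub> N, monoid.mult = undefined, one = undefined,
    zero = N, add = (<+>\<^bsub>M\<^esub>), module.smult = (\<lambda>a C. \<Union>x\<in>C. N +>\<^bsub>M\<^esub> (a \<odot>\<^bsub>M\<^esub> x))\<rparr>"

definition maximal_submodule :: "'b set \<Rightarrow> ('a, 'y) ring_scheme \<Rightarrow> ('a, 'b) module \<Rightarrow> bool"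
  where "maximal_submodule N R M \<longleftrightarrow> submodule N R M \<and> N \<noteq> carrier M \<and>
    (\<forall>N'. submodule N' R M \<and> N \<subseteq> N' \<longrightarrow> N' = N \<or> N' = carrier M)"

section \<open>Weight modules\<close>

type_synonym ('i, 'k, 'm) weyl_module = "(('i, 'k) opr, 'm) module"

text \<open>The scalar \<open>c\<close> acts on an \<open>A\<close>-module through the element \<open>scal c\<close> of \<open>A\<close>.\<close>

definition weight_space :: "('i, 'k::field, 'm) weyl_module \<Rightarrow> ('i \<Rightarrow> 'k) \<Rightarrow> 'm set"
  where "weight_space M p =
    {x \<in> carrier M. \<forall>i. t_op i \<odot>\<^bsub>M\<^esub> x = scal (p i) \<odot>\<^bsub>M\<^esub> x}"

definition weight_module :: "('i, 'k::field, 'm) weyl_module \<Rightarrow> bool"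
  where "weight_module M \<longleftrightarrow> left_module weyl M \<and>
    (\<forall>x\<in>carrier M. \<exists>!v. (\<forall>p. v p \<in> weight_space M p) \<and> finite {p. v p \<noteq> \<zero>\<^bsub>M\<^esub>} \<and>
      x = finsum M v {p. v p \<noteq> \<zero>\<^bsub>M\<^esub>})"

definition P_module :: "('i \<Rightarrow> 'k::field) \<Rightarrow> ('i, 'k, ('i, 'k) opr set) weyl_module"
  where "P_module p = quotient_module (regular_module weyl)
    (generate (add_monoid weyl) (carrier weyl <#>\<^bsub>weyl\<^esub> max_ideal p))"

definition L_module :: "('i \<Rightarrow> 'k::field) \<Rightarrow> ('i, 'k, ('i, 'k) opr set set) weyl_module"
  where "L_module p =
    quotient_module (P_module p) (THE N. maximal_submodule N weyl (P_module p))"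

section \<open>The modules \<open>B(p)\<close>\<close>

text \<open>Formal monomials with arbitrary exponent vectors in \<open>'i \<Rightarrow> 'k\<close> span the space
  \<open>('i \<Rightarrow> 'k) \<Rightarrow>\<^sub>0 'k\<close>; the module \<open>B(p)\<close> lives on the subspace spanned by the monomials with
  exponents in \<open>p + \<int>\<^sub>f\<close>. The action of \<open>A\<close> is the unique algebra homomorphism with the
  prescribed values on the generators.\<close>

type_synonym ('i, 'k) gpolys = "('i \<Rightarrow> 'k) \<Rightarrow>\<^sub>0 'k"

definition X_gen :: "'i \<Rightarrow> ('i, 'k::field) gpolys \<Rightarrow> ('i, 'k) gpolys"
  where "X_gen i = lin_ext (\<lambda>m. Poly_Mapping.single (m(i := m i + 1)) 1)"

definition Y_gen :: "'i \<Rightarrow> ('i, 'k::field) gpolys \<Rightarrow> ('i, 'k) gpolys"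
  where "Y_gen i = lin_ext (\<lambda>m. Poly_Mapping.single (m(i := m i - 1)) (m i))"

definition weyl_action :: "('i, 'k::field) opr \<Rightarrow> ('i, 'k) gpolys \<Rightarrow> ('i, 'k) gpolys"
  where "weyl_action = (THE \<phi>. \<phi> \<in> extensional (carrier weyl) \<and> \<phi> \<in> ring_hom weyl End_ring
    \<and> (\<forall>c. \<phi> (scal c) = scal c)
    \<and> (\<forall>i. \<phi> (X_op i) = X_gen i) \<and> (\<forall>i. \<phi> (Y_op i) = Y_gen i))"

definition Z_fin :: "('i \<Rightarrow> 'k::field) set"
  where "Z_fin = {z. range z \<subseteq> \<int> \<and> finite {i. z i \<noteq> 0}}"

definition B_module :: "('i \<Rightarrow> 'k::field) \<Rightarrow> ('i, 'k, ('i, 'k) gpolys) weyl_module"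
  where "B_module p =
    \<lparr>carrier = {f. Poly_Mapping.keys f \<subseteq> {\<lambda>i. p i + z i | z. z \<in> Z_fin}},
     monoid.mult = undefined, one = undefined, zero = 0, add = (+), module.smult = weyl_action\<rparr>"

section \<open>Duality\<close>

text \<open>Elements of the direct sum of the spaces \<open>Hom(M\<^sub>p, k)\<close>, viewed as functionals on \<open>M\<close>, are
  the linear functionals that vanish on all but finitely many weight spaces.\<close>

definition star_module :: "('i, 'k::field, 'm) weyl_module \<Rightarrow> ('i, 'k, 'm \<Rightarrow> 'k) weyl_module"
  where "star_module M =
    \<lparr>carrier = {f \<in> extensional (carrier M).
       (\<forall>x\<in>carrier M. \<forall>y\<in>carrier M. f (x \<oplus>\<^bsub>M\<^esub> y) = f x + f y) \<and>
       (\<forall>c. \<forall>x\<in>carrier M. f (scal c \<odot>\<^bsub>M\<^esub> x) = c * f x) \<and>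
       finite {p. \<exists>x\<in>weight_space M p. f x \<noteq> 0}},
     monoid.mult = undefined, one = undefined,
     zero = (\<lambda>x\<in>carrier M. 0),
     add = (\<lambda>f g. \<lambda>x\<in>carrier M. f x + g x),
     module.smult = (\<lambda>a f. \<lambda>x\<in>carrier M. f (diamond a \<odot>\<^bsub>M\<^esub> x))\<rparr>"

section \<open>Injective envelopes and projective covers among weight modules\<close>

text \<open>Submodules and quotients of weight modules are weight modules, so the monomorphisms and
  epimorphisms of this category are the injective and the surjective homomorphisms. The lifting
  properties are tested against weight modules whose underlying sets are contained in \<open>'m\<close> and
  \<open>'n\<close>; leaving these types arbitrary covers all weight modules.\<close>

definition injective_object ::
  "'m itself \<Rightarrow> 'n itself \<Rightarrow> ('i, 'k::field, 'e) weyl_module \<Rightarrow> bool"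
  where "injective_object _ _ E \<longleftrightarrow> weight_module E \<and>
    (\<forall>(M :: ('i, 'k, 'm) weyl_module) (N :: ('i, 'k, 'n) weyl_module) f g.
      weight_module M \<and> weight_module N \<and>
      f \<in> mod_hom weyl M N \<and> inj_on f (carrier M) \<and> g \<in> mod_hom weyl M E \<longrightarrow>
      (\<exists>h \<in> mod_hom weyl N E. \<forall>x\<in>carrier M. h (f x) = g x))"

definition projective_object ::
  "'m itself \<Rightarrow> 'n itself \<Rightarrow> ('i, 'k::field, 'e) weyl_module \<Rightarrow> bool"
  where "projective_object _ _ P \<longleftrightarrow> weight_module P \<and>
    (\<forall>(M :: ('i, 'k, 'm) weyl_module) (N :: ('i, 'k, 'n) weyl_module) f g.
      weight_module M \<and> weight_module N \<and>
      f \<in> mod_hom weyl M N \<and> f ` carrier M = carrier N \<and> g \<in> mod_hom weyl P N \<longrightarrow>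
      (\<exists>h \<in> mod_hom weyl P M. \<forall>x\<in>carrier P. f (h x) = g x))"

definition injective_envelope :: "'m itself \<Rightarrow> 'n itself \<Rightarrow>
    ('i, 'k::field, 'e) weyl_module \<Rightarrow> ('i, 'k, 'l) weyl_module \<Rightarrow> bool"
  where "injective_envelope S T E L \<longleftrightarrow> weight_module L \<and> injective_object S T E \<and>
    (\<exists>f \<in> mod_hom weyl L E. inj_on f (carrier L) \<and>
      (\<forall>N. submodule N weyl E \<and> N \<inter> f ` carrier L = {\<zero>\<^bsub>E\<^esub>} \<longrightarrow> N = {\<zero>\<^bsub>E\<^esub>}))"

definition projective_cover :: "'m itself \<Rightarrow> 'n itself \<Rightarrow>
    ('i, 'k::field, 'e) weyl_module \<Rightarrow> ('i, 'k, 'l) weyl_module \<Rightarrow> bool"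
  where "projective_cover S T P L \<longleftrightarrow> weight_module L \<and> projective_object S T P \<and>
    (\<exists>f \<in> mod_hom weyl P L. f ` carrier P = carrier L \<and>
      (\<forall>N. submodule N weyl P \<and> N <+>\<^bsub>P\<^esub> a_kernel P L f = carrier P \<longrightarrow> N = carrier P))"

end

theory Submission
  imports Defs
begin

text \<open>Call a word in the generators outgoing if no variable occurs both as an \<open>X\<close> and as a \<open>Y\<close>.
  Since \<open>X\<^sub>i Y\<^sub>i\<close> and \<open>Y\<^sub>i X\<^sub>i\<close> act on weight vectors by scalars, a weight vector \<open>v\<close> generates
  a module spanned by the vectors \<open>a v\<close> with \<open>a\<close> outgoing, and outgoing words of equal degree
  coincide. So the weight spaces of \<open>P(p)\<close> are at most one-dimensional, \<open>P(p)\<close> represents the exact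
  functor taking a weight module \<open>M\<close> to its weight space at \<open>p\<close>, and its unique maximal submodule
  consists of the vectors whose orbit has no component at \<open>p\<close>.

  Let \<open>E\<close> have one-dimensional weight spaces at \<open>p + \<int>\<^sub>f\<close> and no others. If no step away from \<open>p\<close>
  vanishes on \<open>E\<close>, then \<open>E\<close> is isomorphic to \<open>P(p)\<close>, hence the projective cover of \<open>L(p)\<close>. If no step
  towards \<open>p\<close> vanishes, then \<open>E\<close> is coinduced: homomorphisms from \<open>N\<close> to \<open>E\<close> correspond to linear
  functionals on the weight space of \<open>N\<close> at \<open>p\<close>, and these extend along injections; so \<open>E\<close> is the
  injective envelope of \<open>L(p)\<close>. On \<open>B(p)\<close> the variable \<open>x\<^sub>i\<close> never annihilates a monomial, and \<open>\<partial>\<^sub>i\<close>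
  annihilates those with exponent \<open>0\<close>; on the dual basis \<open>\<partial>\<^sub>i\<close> never vanishes and \<open>x\<^sub>i\<close> vanishes at the
  exponent \<open>-1\<close>. The hypotheses on \<open>p\<close> say on which side of \<open>p\<close> these exponents can lie.\<close>

section \<open>Linear operators and the Weyl algebra\<close>

text \<open>\<open>weyl\<close> consists of concrete operators and is not given by generators and
  relations, so neither the action on generalised monomials nor \<open>diamond\<close> may simply be
  prescribed on generators. Both are obtained as graphs of relations that survive sums and
  composites and in which the first operator determines the second: having entries polynomial in the
  exponents and extending the given operator, respectively being its transpose for a nondegenerate
  form. Characteristic zero enters in both: natural exponents detect a polynomial, and factorials
  are invertible. On the module side arguments are reduced to a single weight component. On any
  given vector the projection to a weight is the action of some element of \<open>weyl\<close>, so
  submodules are stable under it; homomorphisms preserve weights and so commute with it. That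
  \<open>P(p)\<close> is nonzero is read off from a homomorphism that sends its generator to a
  nonzero vector of \<open>E\<close>.\<close>

abbreviation "lookup \<equiv> Poly_Mapping.lookup"
abbreviation "single \<equiv> Poly_Mapping.single"
abbreviation "keys \<equiv> Poly_Mapping.keys"

section \<open>Scalars, linear maps and linear extension\<close>

lemma lookup_scal [simp]: "lookup (scal c f) m = c * lookup f m"
  by (simp add: scal_def Poly_Mapping.map.rep_eq when_def)

lemma vector_space_scal: "vector_space scal"
  by unfold_locales (auto intro!: poly_mapping_eqI simp: lookup_add algebra_simps)

lemma linear_scal_iff:
  "Vector_Spaces.linear scal scal T \<longleftrightarrow>
    (\<forall>f g. T (f + g) = T f + T g) \<and> (\<forall>c f. T (scal c f) = scal c (T f))"
  by (simp add: Vector_Spaces.linear_def module_hom_def module_hom_axioms_def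
      module_iff_vector_space vector_space_scal)

lemma scal_simps [simp]:
  "scal c (f + g) = scal c f + scal c g" "scal c 0 = 0" "scal 0 f = 0" "scal 1 = id"
  "scal c (scal d f) = scal (c * d) f" "scal c (single m d) = single m (c * d)"
  "scal c (- f) = - scal c f"
  by (auto intro!: poly_mapping_eqI simp: lookup_add lookup_single when_def algebra_simps)

lemma scal_add_left: "scal (c + d) f = scal c f + scal d f"
  by (auto intro!: poly_mapping_eqI simp: lookup_add algebra_simps)

lemma scal_minus_one: "scal (-1) f = - f"
  by (auto intro!: poly_mapping_eqI)

lemma scal_sum: "scal c (sum f A) = (\<Sum>x\<in>A. scal c (f x))"
  by (induction A rule: infinite_finite_induct) auto

lemma linear_zero: "Vector_Spaces.linear scal scal T \<Longrightarrow> T 0 = 0"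
  by (metis add_cancel_right_right linear_scal_iff)

lemma linear_sum: "Vector_Spaces.linear scal scal T \<Longrightarrow> T (sum f A) = (\<Sum>x\<in>A. T (f x))"
  by (induction A rule: infinite_finite_induct) (auto simp: linear_zero linear_scal_iff)

lemma lookup_notin_keys: "m \<notin> keys f \<Longrightarrow> lookup f m = 0"
  by (metis in_keys_iff)

lemma poly_mapping_eq_sum_single:
  "f = (\<Sum>m\<in>keys f. single m (lookup f m))"
  by (rule poly_mapping_eqI)
    (auto simp: lookup_sum lookup_single when_def dest: lookup_notin_keys)

lemma linear_eq_sum:
  fixes T :: "('b \<Rightarrow>\<^sub>0 'k::field) \<Rightarrow> ('c \<Rightarrow>\<^sub>0 'k)"
  assumes "Vector_Spaces.linear scal scal T"
  shows "T f = (\<Sum>m\<in>keys f. scal (lookup f m) (T (single m 1)))"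
proof -
  have "T (single m c) = scal c (T (single m 1))" for m c
    using assms by (metis linear_scal_iff mult.right_neutral scal_simps(6))
  then have "(\<Sum>m\<in>keys f. T (single m (lookup f m))) =
      (\<Sum>m\<in>keys f. scal (lookup f m) (T (single m 1)))"
    by (intro sum.cong refl)
  then show ?thesis
    using arg_cong[OF poly_mapping_eq_sum_single[of f], of T] by (simp add: linear_sum[OF assms])
qed

lemma linear_eqI:
  assumes "Vector_Spaces.linear scal scal S" "Vector_Spaces.linear scal scal T"
    and "\<And>m. S (single m 1) = T (single m 1)"
  shows "S = T"
proof
  fix f show "S f = T f"
    using linear_eq_sum[OF assms(1), of f] linear_eq_sum[OF assms(2), of f] assms(3) by simp
qed

text \<open>The support of a sum can be smaller than the union of the supports. Summing over any
  finite superset lets both vectors share one index set in the proof of linearity.\<close>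

lemma lin_ext_eq_sum:
  assumes "finite A" "keys f \<subseteq> A"
  shows "lin_ext g f = (\<Sum>m\<in>A. scal (lookup f m) (g m))"
  unfolding lin_ext_def using assms
  by (intro sum.mono_neutral_left) (auto dest!: lookup_notin_keys)

lemma linear_lin_ext:
  fixes g :: "'b \<Rightarrow> ('c \<Rightarrow>\<^sub>0 'k::field)"
  shows "Vector_Spaces.linear scal scal (lin_ext g)"
  unfolding linear_scal_iff
proof safe
  fix f h :: "'b \<Rightarrow>\<^sub>0 'k"
  let ?A = "keys f \<union> keys h"
  have "keys (f + h) \<subseteq> ?A" by (rule keys_add)
  then show "lin_ext g (f + h) = lin_ext g f + lin_ext g h"
    by (simp add: lin_ext_eq_sum[of ?A] lookup_add scal_add_left sum.distrib)
next
  fix c and f :: "'b \<Rightarrow>\<^sub>0 'k"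
  have "keys (scal c f) \<subseteq> keys f"
    by (metis keys_mult lookup_scal in_keys_iff mult_zero_right subsetI)
  then show "lin_ext g (scal c f) = scal c (lin_ext g f)"
    by (simp add: lin_ext_eq_sum[of "keys f"] scal_sum)
qed

lemma lin_ext_single [simp]: "lin_ext g (single m c) = scal c (g m)"
  by (subst lin_ext_eq_sum[of "{m}"]) auto

lemma linear_scal: "Vector_Spaces.linear scal scal (scal c)"
  by (auto simp: linear_scal_iff mult.commute)

lemma linear_comp:
  "Vector_Spaces.linear scal scal S \<Longrightarrow> Vector_Spaces.linear scal scal T \<Longrightarrow>
    Vector_Spaces.linear scal scal (S \<circ> T)"
  by (auto simp: linear_scal_iff)

lemma linear_add:
  "Vector_Spaces.linear scal scal S \<Longrightarrow> Vector_Spaces.linear scal scal T \<Longrightarrow>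
    Vector_Spaces.linear scal scal (\<lambda>f. S f + T f)"
  by (auto simp: linear_scal_iff)

section \<open>The endomorphism ring and the generators inside it\<close>

lemma End_ring_sel [simp]:
  "carrier End_ring = {T. Vector_Spaces.linear scal scal T}"
  "S \<otimes>\<^bsub>End_ring\<^esub> T = S \<circ> T" "\<one>\<^bsub>End_ring\<^esub> = id" "\<zero>\<^bsub>End_ring\<^esub> = (\<lambda>_. 0)"
  "S \<oplus>\<^bsub>End_ring\<^esub> T = (\<lambda>f. S f + T f)"
  by (simp_all add: End_ring_def)

lemma ring_End_ring: "ring (End_ring :: (('b \<Rightarrow>\<^sub>0 'k::field) \<Rightarrow> _) ring)"
proof (rule ringI)
  show "abelian_group (End_ring :: (('b \<Rightarrow>\<^sub>0 'k::field) \<Rightarrow> _) ring)"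
  proof (rule abelian_groupI)
    fix S :: "('b \<Rightarrow>\<^sub>0 'k) \<Rightarrow> ('b \<Rightarrow>\<^sub>0 'k)" assume "S \<in> carrier End_ring"
    then show "\<exists>T\<in>carrier End_ring. T \<oplus>\<^bsub>End_ring\<^esub> S = \<zero>\<^bsub>End_ring\<^esub>"
      by (intro bexI[of _ "\<lambda>f. - S f"]) (auto simp: linear_scal_iff)
  qed (auto simp: linear_scal_iff algebra_simps)
  show "monoid (End_ring :: (('b \<Rightarrow>\<^sub>0 'k::field) \<Rightarrow> _) ring)"
    by (rule monoidI) (auto simp: linear_comp linear_scal_iff)
qed (auto simp: linear_scal_iff)

text \<open>Multiplication by a monomial is put into the form in which \<open>Y_op\<close> is
  defined, so that both generators can be compared with other maps on monomials only.\<close>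

lemma X_op_lin_ext:
  "X_op i = lin_ext (\<lambda>m. single (m + single i 1) (1::'k::field))"
proof (rule linear_eqI)
  show "Vector_Spaces.linear scal scal (X_op i :: ('a, 'k) opr)"
    unfolding linear_scal_iff
    by (auto simp: X_op_def algebra_simps scal_def mult_map_scale_conv_mult mult.left_commute)
qed (auto simp: X_op_def mult_single linear_lin_ext add.commute)

lemma linear_X_op: "Vector_Spaces.linear scal scal (X_op i)"
  by (simp add: X_op_lin_ext linear_lin_ext)

lemma linear_Y_op: "Vector_Spaces.linear scal scal (Y_op i)"
  by (simp add: Y_op_def linear_lin_ext)

lemma X_op_single [simp]:
  "X_op i (single m c) = single (m + single i 1) c"
  by (simp add: X_op_lin_ext)

lemma Y_op_single [simp]:
  "Y_op i (single m c) =
    single (m - single i 1) (c * of_nat (lookup m i))"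
  by (simp add: Y_op_def)

lemma weyl_sel [simp]:
  "S \<otimes>\<^bsub>weyl\<^esub> T = S \<circ> T" "\<one>\<^bsub>weyl\<^esub> = id" "\<zero>\<^bsub>weyl\<^esub> = (\<lambda>_. 0)"
  "S \<oplus>\<^bsub>weyl\<^esub> T = (\<lambda>f. S f + T f)"
  by (simp_all add: weyl_def)

lemma weyl_gens: "range scal \<union> range X_op \<union> range Y_op \<subseteq> carrier End_ring"
  by (auto simp: linear_scal linear_X_op linear_Y_op)

lemma ring_weyl: "ring weyl"
  unfolding weyl_def by (rule ring.generate_ring_is_ring[OF ring_End_ring weyl_gens])

lemma weyl_carrier: "carrier weyl = generate_ring End_ring (range scal \<union> range X_op \<union> range Y_op)"
  by (simp add: weyl_def)

lemma weyl_linear: "a \<in> carrier weyl \<Longrightarrow> Vector_Spaces.linear scal scal a"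
  using ring.generate_ring_in_carrier[OF ring_End_ring weyl_gens, of a]
  by (simp add: weyl_carrier)

lemma weyl_intros [simp]:
  "scal c \<in> carrier weyl" "X_op i \<in> carrier weyl" "Y_op i \<in> carrier weyl"
  "id \<in> carrier weyl"
  by (auto simp: weyl_carrier intro: generate_ring.incl generate_ring.one[of End_ring, simplified])

lemma weyl_comp [simp]: "a \<in> carrier weyl \<Longrightarrow> b \<in> carrier weyl \<Longrightarrow> a \<circ> b \<in> carrier weyl"
  using monoid.m_closed[OF ring.is_monoid[OF ring_weyl], of a b] by simp

lemma weyl_add [simp]:
  "a \<in> carrier weyl \<Longrightarrow> b \<in> carrier weyl \<Longrightarrow> (\<lambda>f. a f + b f) \<in> carrier weyl"
  using ring.ring_simprules(1)[OF ring_weyl, of a b] by simp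

lemma End_ring_uminus:
  assumes "Vector_Spaces.linear scal scal S"
  shows "\<ominus>\<^bsub>End_ring\<^esub> S = scal (-1) \<circ> S"
proof -
  interpret ring End_ring by (rule ring_End_ring)
  show ?thesis
    by (rule minus_equality) (use assms in \<open>auto simp: scal_minus_one fun_eq_iff linear_comp linear_scal\<close>)
qed

text \<open>The unit is a scalar and a negative is a composite with the scalar -1, so these two
  closure rules of \<open>generate_ring\<close> are absorbed by the other cases.\<close>

lemma weyl_induct [consumes 1, case_names scal X Y add mult]:
  assumes "a \<in> carrier weyl"
    and "\<And>c. Q (scal c)" "\<And>i. Q (X_op i)" "\<And>i. Q (Y_op i)"
    and "\<And>a b. a \<in> carrier weyl \<Longrightarrow> b \<in> carrier weyl \<Longrightarrow> Q a \<Longrightarrow> Q b \<Longrightarrow> Q (\<lambda>f. a f + b f)"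
    and mult: "\<And>a b. a \<in> carrier weyl \<Longrightarrow> b \<in> carrier weyl \<Longrightarrow> Q a \<Longrightarrow> Q b \<Longrightarrow> Q (a \<circ> b)"
  shows "Q a"
  using assms(1) unfolding weyl_carrier
proof (induction rule: generate_ring.induct)
  case one
  then show ?case using assms(2)[of 1] by (metis End_ring_sel(3) scal_simps(4))
next
  case (a_inv h)
  then have "h \<in> carrier weyl" by (simp add: weyl_carrier)
  then show ?case
    using End_ring_uminus[OF weyl_linear] mult[OF weyl_intros(1) _ assms(2) a_inv(2)] by metis
next
  case (eng_mult h1 h2)
  then show ?case using mult[of h1 h2] by (simp only: End_ring_sel weyl_carrier)
qed (use assms(2-5) in \<open>auto simp: weyl_carrier\<close>)

text \<open>A multiplicative, additive and functional relation that is total on the generators is the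
  graph of a homomorphism.\<close>

lemma weyl_hom_of_relation:
  fixes R :: "('r, 'z) ring_scheme" and s :: "'k::field \<Rightarrow> 'r" and x y :: "'i \<Rightarrow> 'r"
  assumes R: "ring R"
    and carr: "\<And>c. s c \<in> carrier R" "\<And>i. x i \<in> carrier R" "\<And>i. y i \<in> carrier R"
    and one: "s 1 = \<one>\<^bsub>R\<^esub>"
    and Q: "\<And>c. Q (scal c) (s c)" "\<And>i. Q (X_op i) (x i)" "\<And>i. Q (Y_op i) (y i)"
    and add: "\<And>S T S' T'. S \<in> carrier weyl \<Longrightarrow> T \<in> carrier weyl \<Longrightarrow> S' \<in> carrier R \<Longrightarrow>
      T' \<in> carrier R \<Longrightarrow> Q S S' \<Longrightarrow> Q T T' \<Longrightarrow> Q (\<lambda>f. S f + T f) (S' \<oplus>\<^bsub>R\<^esub> T')"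
    and mult: "\<And>S T S' T'. S \<in> carrier weyl \<Longrightarrow> T \<in> carrier weyl \<Longrightarrow> S' \<in> carrier R \<Longrightarrow>
      T' \<in> carrier R \<Longrightarrow> Q S S' \<Longrightarrow> Q T T' \<Longrightarrow> Q (S \<circ> T) (S' \<otimes>\<^bsub>R\<^esub> T')"
    and functional: "\<And>S T T'. S \<in> carrier weyl \<Longrightarrow> T \<in> carrier R \<Longrightarrow>
      T' \<in> carrier R \<Longrightarrow> Q S T \<Longrightarrow> Q S T' \<Longrightarrow> T = T'"
  shows "\<exists>\<phi>. \<phi> \<in> extensional (carrier weyl) \<and> \<phi> \<in> ring_hom (weyl :: ('i, 'k) opr ring) R \<and>
    (\<forall>c. \<phi> (scal c) = s c) \<and> (\<forall>i. \<phi> (X_op i) = x i) \<and> (\<forall>i. \<phi> (Y_op i) = y i) \<and>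
    (\<forall>a\<in>carrier weyl. Q a (\<phi> a))"
proof -
  interpret R: ring R by (rule R)
  have ex: "\<exists>T\<in>carrier R. Q S T" if "S \<in> carrier weyl" for S
    using that by (induction rule: weyl_induct) (blast intro: carr Q add mult R.m_closed R.a_closed)+
  \<comment> \<open>The choice is harmless: by \<open>functional\<close> the related element is
    unique, which is what turns \<open>add\<close> and \<open>mult\<close> into the homomorphism
    laws.\<close>
  define \<phi> where "\<phi> = (\<lambda>S\<in>carrier weyl. SOME T. T \<in> carrier R \<and> Q S T)"
  have \<phi>: "\<phi> S \<in> carrier R" "Q S (\<phi> S)" if "S \<in> carrier weyl" for S
    using someI_ex[of "\<lambda>T. T \<in> carrier R \<and> Q S T"] ex[OF that] that unfolding \<phi>_def by auto
  have eq: "\<phi> S = T" if "S \<in> carrier weyl" "T \<in> carrier R" "Q S T" for S T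
    using functional \<phi> that by blast
  have "\<phi> \<in> ring_hom weyl R"
    by (rule ring_hom_memI)
      (auto simp: \<phi> intro!: eq add mult, metis Q(1) carr(1) eq one scal_simps(4) weyl_intros(4))
  moreover have "\<phi> \<in> extensional (carrier weyl)" by (simp add: \<phi>_def)
  ultimately show ?thesis using \<phi> carr Q eq by (intro exI[of _ \<phi>]) auto
qed

text \<open>Supplies uniqueness for the definite descriptions behind \<open>weyl_action\<close> and
  \<open>diamond\<close>; extensionality fixes the values outside the carrier, on which the
  generators have no influence.\<close>

lemma weyl_hom_unique:
  fixes \<phi> \<psi> :: "('i, 'k::field) opr \<Rightarrow> 'r"
  assumes "\<phi> \<in> ring_hom weyl R" "\<psi> \<in> ring_hom weyl R"
    and "\<phi> \<in> extensional (carrier weyl)" "\<psi> \<in> extensional (carrier weyl)"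
    and gens: "\<And>c. \<phi> (scal c) = \<psi> (scal c)" "\<And>i. \<phi> (X_op i) = \<psi> (X_op i)"
      "\<And>i. \<phi> (Y_op i) = \<psi> (Y_op i)"
  shows "\<phi> = \<psi>"
proof (rule extensionalityI[OF assms(3,4)])
  fix a :: "('i, 'k) opr" assume "a \<in> carrier weyl"
  then show "\<phi> a = \<psi> a"
  proof (induction rule: weyl_induct)
    case (add a b)
    then show ?case using ring_hom_add[OF assms(1)] ring_hom_add[OF assms(2)] by simp
  next
    case (mult a b)
    then show ?case
      using ring_hom_mult[OF assms(1), of a b] ring_hom_mult[OF assms(2), of a b]
      by (simp only: weyl_sel)
  qed (use gens in auto)
qed

section \<open>The action on generalised monomials\<close>

text \<open>Polynomials in infinitely many variables are kept as functions, since only their values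
  at exponent vectors matter; closure under the ring operations serves as the induction
  principle.\<close>

inductive polyfun :: "(('i \<Rightarrow> 'k::field) \<Rightarrow> 'k) \<Rightarrow> bool" where
  const: "polyfun (\<lambda>_. c)"
| coord: "polyfun (\<lambda>m. m i)"
| add: "polyfun F \<Longrightarrow> polyfun G \<Longrightarrow> polyfun (\<lambda>m. F m + G m)"
| mult: "polyfun F \<Longrightarrow> polyfun G \<Longrightarrow> polyfun (\<lambda>m. F m * G m)"

lemma polyfun_sum: "(\<And>x. x \<in> A \<Longrightarrow> polyfun (F x)) \<Longrightarrow> polyfun (\<lambda>m. \<Sum>x\<in>A. F x m)"
  by (induction A rule: infinite_finite_induct) (auto intro: polyfun.intros)

lemma polyfun_diff: "polyfun F \<Longrightarrow> polyfun G \<Longrightarrow> polyfun (\<lambda>m. F m - G m)"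
  using polyfun.add[OF _ polyfun.mult[OF polyfun.const[of "-1"]], of F G] by simp

lemma polyfun_shift: "polyfun F \<Longrightarrow> polyfun (\<lambda>m. F (\<lambda>i. m i + w i))"
proof (induction rule: polyfun.induct)
  case (coord i)
  show ?case by (intro polyfun.add polyfun.coord polyfun.const)
qed (auto intro: polyfun.intros)

text \<open>Each construction step involves finitely many variables. This reduces statements about
  the infinite index set to finitely many coordinates.\<close>

lemma polyfun_finite_dep:
  "polyfun F \<Longrightarrow> \<exists>S. finite S \<and> (\<forall>m m'. (\<forall>i\<in>S. m i = m' i) \<longrightarrow> F m = F m')"
proof (induction rule: polyfun.induct)
  case (const c)
  show ?case by (intro exI[of _ "{}"]) auto
next
  case (coord i)
  show ?case by (intro exI[of _ "{i}"]) auto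
next
  case (add F G)
  then obtain S T where "finite S" "\<And>m m'. (\<forall>i\<in>S. m i = m' i) \<Longrightarrow> F m = F m'"
    and "finite T" "\<And>m m'. (\<forall>i\<in>T. m i = m' i) \<Longrightarrow> G m = G m'"
    by metis
  then show ?case by (intro exI[of _ "S \<union> T"]) (metis UnI1 UnI2 finite_UnI)
next
  case (mult F G)
  then obtain S T where "finite S" "\<And>m m'. (\<forall>i\<in>S. m i = m' i) \<Longrightarrow> F m = F m'"
    and "finite T" "\<And>m m'. (\<forall>i\<in>T. m i = m' i) \<Longrightarrow> G m = G m'"
    by metis
  then show ?case by (intro exI[of _ "S \<union> T"]) (metis UnI1 UnI2 finite_UnI)
qed

lemma polyfun_univariate: "polyfun F \<Longrightarrow> \<exists>P. \<forall>c. F (m(i := c)) = poly P c"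
proof (induction rule: polyfun.induct)
  case (const c)
  show ?case by (intro exI[of _ "[:c:]"]) auto
next
  case (coord j)
  show ?case by (intro exI[of _ "if j = i then [:0, 1:] else [:m j:]"]) auto
next
  case (add F G)
  then show ?case by (metis poly_add)
next
  case (mult F G)
  then show ?case by (metis poly_mult)
qed

text \<open>Finitely supported vectors of naturals are dense for polynomial functions in
  characteristic zero: coordinates are freed one at a time, since a nonzero polynomial in one
  variable has only finitely many roots and cannot vanish at all naturals.\<close>

lemma polyfun_eq_zero:
  fixes F :: "('i \<Rightarrow> 'k::field_char_0) \<Rightarrow> 'k"
  assumes F: "polyfun F"
    and zero: "\<And>m. range m \<subseteq> \<nat> \<Longrightarrow> finite {i. m i \<noteq> 0} \<Longrightarrow> F m = 0"
  shows "F m = 0"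
proof -
  obtain S where S: "finite S" "\<And>m m'. (\<forall>i\<in>S. m i = m' i) \<Longrightarrow> F m = F m'"
    using polyfun_finite_dep[OF F] by metis
  \<comment> \<open>\<open>G\<close> collects the coordinates whose values are already arbitrary;
    all others are still natural numbers.\<close>
  have "F m = 0" if "finite G" "\<And>i. i \<notin> G \<Longrightarrow> m i \<in> \<nat>" "finite {i. m i \<noteq> 0}" for G m
    using that
  proof (induction G arbitrary: m rule: finite_induct)
    case empty
    then show ?case by (intro zero) auto
  next
    case (insert i G)
    obtain P where P: "\<And>c. F (m(i := c)) = poly P c"
      using polyfun_univariate[OF F] by metis
    have "poly P (of_nat n) = 0" for n
    proof -
      have "finite {j. (m(i := of_nat n)) j \<noteq> 0}"
        by (rule finite_subset[of _ "insert i {j. m j \<noteq> 0}"]) (use insert.prems in auto)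
      then have "F (m(i := of_nat n)) = 0"
        using insert.prems by (intro insert.IH) auto
      then show ?thesis by (simp add: P)
    qed
    then have "range of_nat \<subseteq> {c. poly P c = 0}" by auto
    moreover have "infinite (range (of_nat :: nat \<Rightarrow> 'k))"
      by (simp add: infinite_UNIV_char_0 range_inj_infinite inj_of_nat)
    ultimately have "P = 0"
      using poly_roots_finite finite_subset by blast
    then show ?case using P[of "m i"] by simp
  qed
  \<comment> \<open>Cutting off outside \<open>S\<close> yields the finite support required above
    and does not change the value of \<open>F\<close>.\<close>
  from this[OF S(1), of "\<lambda>i. if i \<in> S then m i else 0"] S
  have "F (\<lambda>i. if i \<in> S then m i else 0) = 0" by (simp add: Collect_conj_eq)
  moreover have "F m = F (\<lambda>i. if i \<in> S then m i else 0)" by (rule S(2)) simp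
  ultimately show ?thesis by simp
qed

text \<open>The matrix entries of such an operator are polynomials in the exponents, so it is determined
  by its values on monomials with natural exponents. This makes the action of the Weyl algebra on
  generalised monomials well defined.\<close>

definition poly_operator :: "(('i, 'k::field) gpolys \<Rightarrow> ('i, 'k) gpolys) \<Rightarrow> bool" where
  "poly_operator T \<longleftrightarrow> Vector_Spaces.linear scal scal T \<and>
    (\<exists>Z. finite Z \<and> (\<forall>m. keys (T (single m 1)) \<subseteq> (\<lambda>z i. m i + z i) ` Z)) \<and>
    (\<forall>z. polyfun (\<lambda>m. lookup (T (single m 1)) (\<lambda>i. m i + z i)))"

text \<open>Covers scalars, \<open>X_gen\<close> and \<open>Y_gen\<close> at once: each is a fixed
  translation of exponents with a coefficient polynomial in the exponents.\<close>

lemma poly_operator_lin_ext: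
  assumes "polyfun F"
  shows "poly_operator (lin_ext (\<lambda>m. single (\<lambda>i. m i + z i) (F m)))"
  unfolding poly_operator_def
proof (intro conjI allI exI[of _ "{z}"])
  fix w
  have "(\<lambda>m. lookup (lin_ext (\<lambda>m. single (\<lambda>i. m i + z i) (F m))
        (single m 1)) (\<lambda>i. m i + w i)) = (if w = z then F else (\<lambda>m. 0))"
    by (auto simp: fun_eq_iff lookup_single when_def)
  then show "polyfun (\<lambda>m. lookup (lin_ext (\<lambda>m. single (\<lambda>i. m i + z i) (F m))
        (single m 1)) (\<lambda>i. m i + w i))"
    using assms by (auto intro: polyfun.const)
qed (auto simp: linear_lin_ext)

lemma poly_operator_add:
  assumes "poly_operator S" "poly_operator T"
  shows "poly_operator (\<lambda>f. S f + T f)"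
proof -
  obtain Z W where Z: "finite Z"
      "\<And>m. keys (S (single m 1)) \<subseteq> (\<lambda>z i. m i + z i) ` Z"
    and W: "finite W"
      "\<And>m. keys (T (single m 1)) \<subseteq> (\<lambda>z i. m i + z i) ` W"
    using assms unfolding poly_operator_def by auto
  have "keys (S (single m 1) + T (single m 1))
      \<subseteq> (\<lambda>z i. m i + z i) ` (Z \<union> W)" for m
    unfolding image_Un by (rule order_trans[OF keys_add Un_mono[OF Z(2) W(2)]])
  then have "\<exists>Z. finite Z \<and> (\<forall>m. keys (S (single m 1) +
      T (single m 1)) \<subseteq> (\<lambda>z i. m i + z i) ` Z)"
    using Z(1) W(1) by (intro exI[of _ "Z \<union> W"]) blast
  then show ?thesis
    using assms unfolding poly_operator_def by (simp add: linear_add lookup_add polyfun.add)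
qed

text \<open>Matrix multiplication: the entry of the composite at shift \<open>z\<close> is a sum
  over the intermediate shifts \<open>w\<close> of \<open>T\<close>. It is polynomial because one
  finite set \<open>W\<close> serves all exponents \<open>m\<close> simultaneously, so the index set
  of the sum does not depend on \<open>m\<close>.\<close>

lemma poly_operator_comp:
  fixes S T :: "('i, 'k::field) gpolys \<Rightarrow> ('i, 'k) gpolys"
  assumes S: "poly_operator S" and T: "poly_operator T"
  shows "poly_operator (S \<circ> T)"
proof -
  have lin: "Vector_Spaces.linear scal scal S" "Vector_Spaces.linear scal scal T"
    using S T by (auto simp: poly_operator_def)
  obtain Z W where Z: "finite Z" and W: "finite W" and
    ZS: "\<And>m. keys (S (single m 1)) \<subseteq> (\<lambda>z i. m i + z i) ` Z" and
    WT: "\<And>m. keys (T (single m 1)) \<subseteq> (\<lambda>z i. m i + z i) ` W"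
    using S T unfolding poly_operator_def by auto
  define c where "c = (\<lambda>w m. lookup (T (single m 1)) (\<lambda>i. m i + w i))"
  have c: "polyfun (c w)" for w using T by (simp add: c_def poly_operator_def)
  define d where "d = (\<lambda>z m. lookup (S (single m 1)) (\<lambda>i. m i + z i))"
  have d: "polyfun (d z)" for z using S by (simp add: d_def poly_operator_def)
  have comp: "(S \<circ> T) (single m 1) =
      (\<Sum>w\<in>W. scal (c w m) (S (single (\<lambda>i. m i + w i) 1)))" for m
  proof -
    have "inj_on (\<lambda>z i. m i + z i) W" by (auto simp: inj_on_def fun_eq_iff)
    moreover have "S (T (single m 1)) = (\<Sum>n\<in>(\<lambda>z i. m i + z i) ` W.
        scal (lookup (T (single m 1)) n) (S (single n 1)))"
      by (subst linear_eq_sum[OF lin(1)], rule sum.mono_neutral_left)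
        (use W WT in \<open>auto dest!: lookup_notin_keys\<close>)
    ultimately show ?thesis by (simp add: sum.reindex c_def)
  qed
  have "keys ((S \<circ> T) (single m 1)) \<subseteq>
      (\<lambda>z i. m i + z i) ` ((\<lambda>(z, w) i. w i + z i) ` (Z \<times> W))" for m
  proof
    fix n assume "n \<in> keys ((S \<circ> T) (single m 1))"
    then have "(\<Sum>w\<in>W. c w m * lookup (S (single (\<lambda>i. m i + w i) 1)) n) \<noteq> 0"
      unfolding comp by (simp add: in_keys_iff lookup_sum del: lookup_not_eq_zero_eq_in_keys)
    then obtain w where "w \<in> W"
      and "lookup (S (single (\<lambda>i. m i + w i) 1)) n \<noteq> 0"
      by (metis (no_types, lifting) mult_eq_0_iff sum.neutral)
    then obtain z where "z \<in> Z" "n = (\<lambda>i. (m i + w i) + z i)"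
      using ZS[of "\<lambda>i. m i + w i"] by (metis (no_types, lifting) imageE in_keys_iff subsetD)
    then show "n \<in> (\<lambda>z i. m i + z i) ` ((\<lambda>(z, w) i. w i + z i) ` (Z \<times> W))"
      using \<open>w \<in> W\<close> by (auto simp: image_iff add.assoc intro!: bexI[of _ "(z, w)"])
  qed
  moreover have "polyfun (\<lambda>m. lookup ((S \<circ> T) (single m 1)) (\<lambda>i. m i + z i))"
    for z
  proof -
    \<comment> \<open>After the shift \<open>w\<close> the remaining shift is \<open>z - w\<close>,
      measured from the exponent \<open>m + w\<close>; hence the translated argument of
      \<open>d\<close>.\<close>
    have "lookup ((S \<circ> T) (single m 1)) (\<lambda>i. m i + z i) =
        (\<Sum>w\<in>W. c w m * d (\<lambda>i. z i - w i) (\<lambda>i. m i + w i))" for m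
      unfolding comp by (simp add: lookup_sum d_def add.assoc)
    then show ?thesis by (auto intro!: polyfun_sum polyfun.mult c polyfun_shift d)
  qed
  moreover have "finite ((\<lambda>(z, w) i. w i + z i) ` (Z \<times> W))" using Z W by simp
  ultimately show ?thesis
    unfolding poly_operator_def using linear_comp[OF lin] by blast
qed

section \<open>Generators on generalised monomials and their comparison with polynomials\<close>

lemma X_gen_alt: "X_gen i = lin_ext (\<lambda>m. single (\<lambda>j. m j + (if j = i then 1 else 0)) 1)"
  unfolding X_gen_def by (intro arg_cong[of _ _ lin_ext] ext arg_cong2[of _ _ _ _ single]) auto

lemma Y_gen_alt: "Y_gen i = lin_ext (\<lambda>m. single (\<lambda>j. m j + (if j = i then -1 else 0)) (m i))"
  unfolding Y_gen_def by (intro arg_cong[of _ _ lin_ext] ext arg_cong2[of _ _ _ _ single]) auto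

lemma scal_alt: "(scal c :: ('i, 'k::field) gpolys \<Rightarrow> _) = lin_ext (\<lambda>m. single (\<lambda>j. m j + 0) c)"
  by (rule linear_eqI) (auto simp: linear_scal linear_lin_ext)

lemma linear_X_gen: "Vector_Spaces.linear scal scal (X_gen i)"
  and linear_Y_gen: "Vector_Spaces.linear scal scal (Y_gen i)"
  by (simp_all add: X_gen_def Y_gen_def linear_lin_ext)

lemma X_gen_single [simp]:
  "X_gen i (single m c) = single (m(i := m i + 1)) c"
  by (simp add: X_gen_def)

lemma Y_gen_single [simp]:
  "Y_gen i (single m c) = single (m(i := m i - 1)) (c * m i)"
  by (simp add: Y_gen_def)

text \<open>The inclusion of the polynomials into the span of generalised monomials. It serves to
  compare an element of \<open>weyl\<close> with its candidate action.\<close>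

definition embed :: "('i, 'k::field) polys \<Rightarrow> ('i, 'k) gpolys" where
  "embed = lin_ext (\<lambda>m. single (\<lambda>i. of_nat (lookup m i)) 1)"

lemma linear_embed: "Vector_Spaces.linear scal scal embed"
  by (simp add: embed_def linear_lin_ext)

lemma embed_add [simp]: "embed (f + g) = embed f + embed g"
  and embed_scal [simp]: "embed (scal c f) = scal c (embed f)"
  using linear_embed unfolding linear_scal_iff by blast+

lemma embed_single [simp]:
  "embed (single m c) = single (\<lambda>i. of_nat (lookup m i)) c"
  by (simp add: embed_def)

lemma embed_X_op: "embed \<circ> X_op i = X_gen i \<circ> embed"
  by (rule linear_eqI)
    (auto simp: linear_comp linear_embed linear_X_op linear_X_gen lookup_add fun_eq_iff
      lookup_single when_def intro!: arg_cong2[of _ _ _ _ single])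

lemma embed_Y_op: "embed \<circ> Y_op i = Y_gen i \<circ> embed"
proof (rule linear_eqI)
  fix m :: "'a \<Rightarrow>\<^sub>0 nat"
  show "(embed \<circ> Y_op i) (single m 1) = (Y_gen i \<circ> embed) (single m (1::'b))"
    \<comment> \<open>At exponent 0 the truncated and the true subtraction differ, but both sides
      carry the coefficient 0.\<close>
    by (cases "lookup m i")
      (auto simp: linear_zero[OF linear_embed] lookup_minus fun_eq_iff lookup_single when_def
      intro!: arg_cong2[of _ _ _ _ single])
qed (auto simp: linear_comp linear_embed linear_Y_op linear_Y_gen)

lemma poly_operator_eqI:
  fixes S T :: "('i, 'k::field_char_0) gpolys \<Rightarrow> ('i, 'k) gpolys"
  assumes S: "poly_operator S" and T: "poly_operator T" and eq: "S \<circ> embed = T \<circ> embed"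
  shows "S = T"
proof (rule linear_eqI)
  show lin: "Vector_Spaces.linear scal scal S" "Vector_Spaces.linear scal scal T"
    using S T by (auto simp: poly_operator_def)
  fix m :: "'i \<Rightarrow> 'k"
  have "lookup (S (single m 1)) (\<lambda>i. m i + z i) -
      lookup (T (single m 1)) (\<lambda>i. m i + z i) = 0" for z
  proof (rule polyfun_eq_zero[of "\<lambda>m. lookup (S (single m 1)) (\<lambda>i. m i + z i) -
      lookup (T (single m 1)) (\<lambda>i. m i + z i)"])
    show "polyfun (\<lambda>m. lookup (S (single m 1)) (\<lambda>i. m i + z i) -
      lookup (T (single m 1)) (\<lambda>i. m i + z i))"
      using S T by (auto simp: poly_operator_def intro: polyfun_diff)
    fix n :: "'i \<Rightarrow> 'k" assume n: "range n \<subseteq> \<nat>" "finite {i. n i \<noteq> 0}"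
    then obtain g where g: "\<And>i. n i = of_nat (g i)"
      by (metis Nats_cases rangeI subsetD)
    then have "finite {i. g i \<noteq> 0}" using n by simp
    then have "embed (single (Abs_poly_mapping g) 1) = (single n 1 :: ('i, 'k) gpolys)"
      using g by (auto simp: fun_eq_iff intro!: arg_cong2[of _ _ _ _ single])
    then show "lookup (S (single n 1)) (\<lambda>i. n i + z i) -
      lookup (T (single n 1)) (\<lambda>i. n i + z i) = 0"
      using fun_cong[OF eq, of "single (Abs_poly_mapping g) 1"] by simp
  qed
  \<comment> \<open>Any exponent \<open>n\<close> is \<open>m\<close> shifted by
    \<open>n - m\<close>, so the shifts reach every coefficient.\<close>
  from this[of "\<lambda>i. n i - m i" for n] show "S (single m 1) = T (single m 1)"
    by (intro poly_mapping_eqI) simp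
qed

text \<open>Well-definedness comes from extension: the action of \<open>S\<close> is the only
  operator with polynomial entries that restricts to \<open>S\<close> along \<open>embed\<close>, so
  any two expressions of \<open>S\<close> in the generators give the same result.\<close>

lemma weyl_action_props:
  "(weyl_action :: ('i, 'k::field_char_0) opr \<Rightarrow> _) \<in> extensional (carrier weyl)"
  "(weyl_action :: ('i, 'k) opr \<Rightarrow> _) \<in> ring_hom weyl End_ring"
  "weyl_action (scal c) = (scal c :: ('i, 'k) gpolys \<Rightarrow> _)"
  "weyl_action (X_op i) = (X_gen i :: ('i, 'k) gpolys \<Rightarrow> _)"
  "weyl_action (Y_op i) = (Y_gen i :: ('i, 'k) gpolys \<Rightarrow> _)"
proof -
  define Q where "Q = (\<lambda>(S :: ('i, 'k) opr) T. poly_operator T \<and> T \<circ> embed = embed \<circ> S)"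
  define R where "R = (\<lambda>\<phi> :: ('i, 'k) opr \<Rightarrow> ('i, 'k) gpolys \<Rightarrow> ('i, 'k) gpolys.
    \<phi> \<in> extensional (carrier weyl) \<and> \<phi> \<in> ring_hom weyl End_ring
    \<and> (\<forall>c. \<phi> (scal c) = scal c) \<and> (\<forall>i. \<phi> (X_op i) = X_gen i) \<and> (\<forall>i. \<phi> (Y_op i) = Y_gen i))"
  have "\<exists>\<phi>. \<phi> \<in> extensional (carrier weyl) \<and> \<phi> \<in> ring_hom (weyl :: ('i, 'k) opr ring) End_ring
    \<and> (\<forall>c. \<phi> (scal c) = scal c) \<and> (\<forall>i. \<phi> (X_op i) = X_gen i) \<and> (\<forall>i. \<phi> (Y_op i) = Y_gen i)
    \<and> (\<forall>a\<in>carrier weyl. Q a (\<phi> a))"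
  proof (rule weyl_hom_of_relation[OF ring_End_ring])
    show "Q (X_op i) (X_gen i)" for i
      unfolding Q_def embed_X_op by (simp add: X_gen_alt poly_operator_lin_ext polyfun.const)
    show "Q (Y_op i) (Y_gen i)" for i
      unfolding Q_def embed_Y_op by (simp add: Y_gen_alt poly_operator_lin_ext polyfun.coord)
    show "Q (scal c) (scal c)" for c
    proof -
      have "poly_operator (scal c :: ('i, 'k) gpolys \<Rightarrow> _)"
        by (subst scal_alt) (rule poly_operator_lin_ext[OF polyfun.const])
      then show ?thesis
        by (simp add: Q_def fun_eq_iff)
    qed
    show "Q (\<lambda>f. S f + T f) (S' \<oplus>\<^bsub>End_ring\<^esub> T')" if "Q S S'" "Q T T'" for S T S' T'
      using that by (simp add: Q_def poly_operator_add fun_eq_iff)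
    show "Q (S \<circ> T) (S' \<otimes>\<^bsub>End_ring\<^esub> T')" if "Q S S'" "Q T T'" for S T S' T'
    proof -
      have "S' (embed f) = embed (S f)" "T' (embed f) = embed (T f)" for f
        using that unfolding Q_def by (metis comp_apply)+
      then have "(S' \<circ> T') \<circ> embed = embed \<circ> (S \<circ> T)" by (simp add: fun_eq_iff)
      then show ?thesis
        using that poly_operator_comp[of S' T'] unfolding Q_def End_ring_sel by blast
    qed
    show "T = T'" if "Q S T" "Q S T'" for S T T'
      using that poly_operator_eqI[of T T'] unfolding Q_def by metis
  qed (auto simp: linear_scal linear_X_gen linear_Y_gen)
  then have "\<exists>\<phi>. R \<phi>" unfolding R_def by blast
  moreover have "\<phi> = \<psi>" if "R \<phi>" "R \<psi>" for \<phi> \<psi>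
    using that by (intro weyl_hom_unique) (auto simp: R_def)
  ultimately have "R (THE \<phi>. R \<phi>)" by (metis theI)
  moreover have "weyl_action = (THE \<phi>. R \<phi>)" by (simp add: weyl_action_def R_def)
  ultimately have "R weyl_action" by simp
  then show
    "(weyl_action :: ('i, 'k::field_char_0) opr \<Rightarrow> _) \<in> extensional (carrier weyl)"
    "(weyl_action :: ('i, 'k) opr \<Rightarrow> _) \<in> ring_hom weyl End_ring"
  "weyl_action (scal c) = (scal c :: ('i, 'k) gpolys \<Rightarrow> _)"
  "weyl_action (X_op i) = (X_gen i :: ('i, 'k) gpolys \<Rightarrow> _)"
  "weyl_action (Y_op i) = (Y_gen i :: ('i, 'k) gpolys \<Rightarrow> _)"
    by (auto simp: R_def)
qed

section \<open>The anti-automorphism\<close>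

definition mfact :: "('i \<Rightarrow>\<^sub>0 nat) \<Rightarrow> 'k::field_char_0" where
  "mfact m = (\<Prod>i\<in>keys m. fact (lookup m i))"

lemma mfact_nonzero: "mfact m \<noteq> (0::'k::field_char_0)"
  by (simp add: mfact_def)

text \<open>The recursion of the factorial in the variable \<open>i\<close>. It is exactly what
  balances the coefficient produced by \<open>Y_op\<close> against the form.\<close>

lemma mfact_add_single:
  "mfact (m + single i 1) = of_nat (lookup m i + 1) * (mfact m :: 'k::field_char_0)"
proof -
  let ?K = "insert i (keys m)" and ?m = "m + single i 1"
  have 1: "mfact ?m = (\<Prod>j\<in>?K. fact (lookup ?m j) :: 'k)"
    unfolding mfact_def using keys_add[of m "single i 1"]
    by (intro prod.mono_neutral_left) (auto dest!: lookup_notin_keys)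
  have 2: "mfact m = (\<Prod>j\<in>?K. fact (lookup m j) :: 'k)"
    unfolding mfact_def by (intro prod.mono_neutral_left) (auto dest!: lookup_notin_keys)
  have "(\<Prod>j\<in>?K - {i}. fact (lookup ?m j) :: 'k) = (\<Prod>j\<in>?K - {i}. fact (lookup m j))"
    by (intro prod.cong) (auto simp: lookup_add lookup_single when_def)
  then show ?thesis
    unfolding 1 2 by (simp add: prod.remove[of ?K i] lookup_add del: Diff_insert0 insert_Diff_single)
qed

text \<open>For the form \<open>\<langle>x\<^sup>m, x\<^sup>n\<rangle> = m! \<delta>\<^sub>m\<^sub>n\<close>, multiplication by \<open>x\<^sub>i\<close> and \<open>\<partial>\<^sub>i\<close> are adjoint.\<close>

definition fact_form :: "('i, 'k::field_char_0) polys \<Rightarrow> ('i, 'k) polys \<Rightarrow> 'k" where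
  "fact_form f g =
    (\<Sum>m\<in>keys f. lookup f m * lookup g m * mfact m)"

lemma fact_form_eq_sum:
  assumes "finite A" "keys f \<subseteq> A"
  shows "fact_form f g = (\<Sum>m\<in>A. lookup f m * lookup g m * mfact m)"
  unfolding fact_form_def using assms
  by (intro sum.mono_neutral_left) (auto dest!: lookup_notin_keys)

lemma fact_form_commute: "fact_form f g = fact_form g f"
proof -
  let ?A = "keys f \<union> keys g"
  show ?thesis
    by (subst (1 2) fact_form_eq_sum[of ?A]) (auto intro!: sum.cong)
qed

lemma fact_form_single_left [simp]:
  "fact_form (single m c) g = c * lookup g m * mfact m"
  by (subst fact_form_eq_sum[of "{m}"]) auto

lemma fact_form_add_right: "fact_form f (g + h) = fact_form f g + fact_form f h"
  by (simp add: fact_form_def lookup_add algebra_simps sum.distrib)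

lemma fact_form_scal_right: "fact_form f (scal c g) = c * fact_form f g"
  by (simp add: fact_form_def sum_distrib_left algebra_simps)

lemma fact_form_add_left: "fact_form (f + g) h = fact_form f h + fact_form g h"
  by (metis fact_form_add_right fact_form_commute)

lemma fact_form_scal_left: "fact_form (scal c f) g = c * fact_form f g"
  by (metis fact_form_scal_right fact_form_commute)

lemma fact_form_zero_left: "fact_form 0 g = 0"
  by (simp add: fact_form_def)

lemma fact_form_sum_left: "fact_form (sum f A) g = (\<Sum>x\<in>A. fact_form (f x) g)"
  by (induction A rule: infinite_finite_induct) (auto simp: fact_form_zero_left fact_form_add_left)

lemma fact_form_sum_right: "fact_form g (sum f A) = (\<Sum>x\<in>A. fact_form g (f x))"
  by (metis (no_types, lifting) fact_form_commute fact_form_sum_left sum.cong)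

definition adjoint :: "('i, 'k::field_char_0) opr \<Rightarrow> ('i, 'k) opr \<Rightarrow> bool" where
  "adjoint S T \<longleftrightarrow> (\<forall>f g. fact_form (S f) g = fact_form f (T g))"

text \<open>The form is nondegenerate: pairing with a monomial recovers a coefficient up to a
  factorial, and factorials are nonzero in characteristic zero.\<close>

lemma adjoint_unique:
  fixes S T T' :: "('i, 'k::field_char_0) opr"
  assumes "adjoint S T" "adjoint S T'"
  shows "T = T'"
proof
  fix g
  have "fact_form f (T g) = fact_form f (T' g)" for f
    using assms unfolding adjoint_def by metis
  from this[of "single m 1" for m] show "T g = T' g"
    by (intro poly_mapping_eqI) (simp add: mfact_nonzero)
qed

lemma adjoint_basis:
  fixes S T :: "('i, 'k::field_char_0) opr"
  assumes S: "Vector_Spaces.linear scal scal S" and T: "Vector_Spaces.linear scal scal T"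
    and eq: "\<And>m n. fact_form (S (single m 1)) (single n 1) =
      fact_form (single m 1) (T (single n 1))"
  shows "adjoint S T"
  unfolding adjoint_def
proof (intro allI)
  fix f g
  \<comment> \<open>Applied to the identity map, this is the expansion of a vector into monomials,
    to be substituted for the argument to which no operator is applied.\<close>
  note id = linear_eq_sum[OF linear_scal[of 1, unfolded scal_simps id_def]]
  have "fact_form (S f) g = (\<Sum>n\<in>keys g. \<Sum>m\<in>keys f.
      lookup g n * (lookup f m *
      fact_form (S (single m 1)) (single n 1)))"
    by (subst linear_eq_sum[OF S], subst id[of g])
      (simp only: fact_form_sum_left fact_form_sum_right fact_form_scal_left fact_form_scal_right sum_distrib_left)
  moreover have "fact_form f (T g) = (\<Sum>n\<in>keys g. \<Sum>m\<in>keys f.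
      lookup g n * (lookup f m *
      fact_form (single m 1) (T (single n 1))))"
    by (subst linear_eq_sum[OF T], subst id[of f])
      (simp only: fact_form_sum_left fact_form_sum_right fact_form_scal_left fact_form_scal_right sum_distrib_left)
  ultimately show "fact_form (S f) g = fact_form f (T g)" by (simp add: eq)
qed

lemma adjoint_sym: "adjoint S T \<Longrightarrow> adjoint T S"
  unfolding adjoint_def by (metis fact_form_commute)

lemma adjoint_X_Y: "adjoint (X_op i) (Y_op i :: ('i, 'k::field_char_0) opr)"
proof (rule adjoint_basis)
  fix m n :: "'i \<Rightarrow>\<^sub>0 nat"
  \<comment> \<open>Both pairings vanish unless \<open>n\<close> is the exponent of
    \<open>X_op i\<close> applied to \<open>m\<close>. The second condition on the right excludes
    the coincidence caused by truncated subtraction at exponent 0, where \<open>Y_op i\<close> gives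
    0.\<close>
  have iff: "m + single i 1 = n \<longleftrightarrow>
      m = n - single i 1 \<and> lookup n i \<noteq> 0"
  proof
    assume "m = n - single i 1 \<and> lookup n i \<noteq> 0"
    then show "m + single i 1 = n"
      by (intro poly_mapping_eqI) (auto simp: lookup_add lookup_minus lookup_single when_def)
  qed (auto simp: lookup_add)
  show "fact_form (X_op i (single m 1)) (single n 1) =
      fact_form (single m 1) (Y_op i (single n (1::'k)))"
  proof (cases "m + single i 1 = n")
    case True
    then show ?thesis
      using mfact_add_single[of m i, where 'k = 'k] by (auto simp: lookup_add)
  next
    case False
    then show ?thesis using iff by (auto simp: lookup_single when_def)
  qed
qed (auto simp: linear_X_op linear_Y_op)


section \<open>The opposite ring and the anti-automorphism\<close>

lemma opposite_ring_sel [simp]: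
  "carrier (opposite_ring R) = carrier R" "a \<otimes>\<^bsub>opposite_ring R\<^esub> b = b \<otimes>\<^bsub>R\<^esub> a"
  "\<one>\<^bsub>opposite_ring R\<^esub> = \<one>\<^bsub>R\<^esub>" "\<zero>\<^bsub>opposite_ring R\<^esub> = \<zero>\<^bsub>R\<^esub>"
  "a \<oplus>\<^bsub>opposite_ring R\<^esub> b = a \<oplus>\<^bsub>R\<^esub> b"
  by (simp_all add: opposite_ring_def)

lemma ring_opposite_ring:
  assumes "ring R"
  shows "ring (opposite_ring R)"
proof -
  interpret ring R by (rule assms)
  show ?thesis
  proof (rule ringI)
    show "abelian_group (opposite_ring R)"
      by (rule abelian_groupI) (auto simp: a_ac intro: l_neg)
    show "monoid (opposite_ring R)"
      by (rule monoidI) (auto simp: m_assoc)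
  qed (auto simp: l_distr r_distr)
qed

text \<open>\<open>diamond\<close> is transposition for the factorial form. Transposes reverse
  composites, and symmetry of the form makes transposition an involution, hence bijective on
  \<open>weyl\<close>.\<close>

lemma diamond_props:
  "(diamond :: ('i, 'k::field_char_0) opr \<Rightarrow> _) \<in> ring_hom weyl (opposite_ring weyl)"
  "diamond (scal c) = (scal c :: ('i, 'k) opr)"
  "diamond (X_op i) = (Y_op i :: ('i, 'k) opr)"
  "diamond (Y_op i) = (X_op i :: ('i, 'k) opr)"
proof -
  define R where "R = (\<lambda>\<phi> :: ('i, 'k) opr \<Rightarrow> ('i, 'k) opr.
    \<phi> \<in> extensional (carrier weyl) \<and> \<phi> \<in> ring_iso weyl (opposite_ring weyl)
    \<and> (\<forall>a\<in>carrier weyl. \<phi> (\<phi> a) = a) \<and> (\<forall>c. \<phi> (scal c) = scal c)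
    \<and> (\<forall>i. \<phi> (X_op i) = Y_op i) \<and> (\<forall>i. \<phi> (Y_op i) = X_op i))"
  have "\<exists>\<phi>. \<phi> \<in> extensional (carrier weyl) \<and> \<phi> \<in> ring_hom (weyl :: ('i, 'k) opr ring) (opposite_ring weyl)
    \<and> (\<forall>c. \<phi> (scal c) = scal c) \<and> (\<forall>i. \<phi> (X_op i) = Y_op i) \<and> (\<forall>i. \<phi> (Y_op i) = X_op i)
    \<and> (\<forall>a\<in>carrier weyl. adjoint a (\<phi> a))"
  proof (rule weyl_hom_of_relation[OF ring_opposite_ring[OF ring_weyl]])
    show "adjoint (scal c) (scal c :: ('i, 'k) opr)" for c
      by (simp add: adjoint_def fact_form_scal_left fact_form_scal_right)
    show "adjoint (X_op i) (Y_op i :: ('i, 'k) opr)" "adjoint (Y_op i) (X_op i :: ('i, 'k) opr)" for i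
      by (simp_all add: adjoint_X_Y adjoint_sym)
    show "adjoint (\<lambda>f. S f + T f) (S' \<oplus>\<^bsub>opposite_ring weyl\<^esub> T')"
      if "adjoint S S'" "adjoint T T'" for S T S' T' :: "('i, 'k) opr"
      using that by (simp add: adjoint_def fact_form_add_left fact_form_add_right)
    show "adjoint (S \<circ> T) (S' \<otimes>\<^bsub>opposite_ring weyl\<^esub> T')"
      if "adjoint S S'" "adjoint T T'" for S T S' T' :: "('i, 'k) opr"
      using that by (simp add: adjoint_def)
  qed (auto intro: adjoint_unique)
  then obtain \<phi> where \<phi>: "\<phi> \<in> extensional (carrier weyl)"
      "\<phi> \<in> ring_hom (weyl :: ('i, 'k) opr ring) (opposite_ring weyl)"
      "\<And>c. \<phi> (scal c) = scal c" "\<And>i. \<phi> (X_op i) = Y_op i" "\<And>i. \<phi> (Y_op i) = X_op i"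
    and adj: "\<And>a. a \<in> carrier weyl \<Longrightarrow> adjoint a (\<phi> a)"
    by blast
  have carr: "\<phi> a \<in> carrier weyl" if "a \<in> carrier weyl" for a
    using ring_hom_closed[OF \<phi>(2) that] by simp
  have inv: "\<phi> (\<phi> a) = a" if "a \<in> carrier weyl" for a
    using adjoint_unique[OF adj[OF carr[OF that]] adjoint_sym[OF adj[OF that]]] .
  have "bij_betw \<phi> (carrier weyl) (carrier weyl)"
    by (rule bij_betw_byWitness[of _ \<phi>]) (auto simp: inv carr)
  then have "R \<phi>" using \<phi> inv by (auto simp: R_def ring_iso_def)
  moreover have "\<psi> = \<phi>" if "R \<psi>" for \<psi>
    using that \<phi> by (intro weyl_hom_unique) (auto simp: R_def ring_iso_def)
  ultimately have "R (THE \<phi>. R \<phi>)" by (metis theI)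
  moreover have "diamond = (THE \<phi>. R \<phi>)" by (simp add: diamond_def R_def)
  ultimately have "R diamond" by simp
  then show
    "(diamond :: ('i, 'k::field_char_0) opr \<Rightarrow> _) \<in> ring_hom weyl (opposite_ring weyl)"
    "diamond (scal c) = (scal c :: ('i, 'k) opr)"
    "diamond (X_op i) = (Y_op i :: ('i, 'k) opr)"
    "diamond (Y_op i) = (X_op i :: ('i, 'k) opr)"
    by (auto simp: R_def ring_iso_def)
qed

section \<open>Left modules, homomorphisms and quotients\<close>

context left_module
begin

lemma smult_zero_left [simp]: "x \<in> carrier M \<Longrightarrow> \<zero>\<^bsub>R\<^esub> \<odot>\<^bsub>M\<^esub> x = \<zero>\<^bsub>M\<^esub>"
  by (metis M.add.l_cancel_one M.r_zero R.r_zero R.zero_closed smult_closed smult_l_distr)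

lemma smult_zero_right [simp]: "a \<in> carrier R \<Longrightarrow> a \<odot>\<^bsub>M\<^esub> \<zero>\<^bsub>M\<^esub> = \<zero>\<^bsub>M\<^esub>"
  by (metis M.add.l_cancel_one M.l_zero M.zero_closed smult_closed smult_r_distr)

lemma smult_minus_right: "a \<in> carrier R \<Longrightarrow> x \<in> carrier M \<Longrightarrow> a \<odot>\<^bsub>M\<^esub> (\<ominus>\<^bsub>M\<^esub> x) = \<ominus>\<^bsub>M\<^esub> (a \<odot>\<^bsub>M\<^esub> x)"
  by (metis M.a_inv_closed M.l_neg M.minus_equality smult_closed smult_r_distr smult_zero_right)

lemma smult_diff_right:
  "a \<in> carrier R \<Longrightarrow> x \<in> carrier M \<Longrightarrow> y \<in> carrier M \<Longrightarrow>
    a \<odot>\<^bsub>M\<^esub> (x \<ominus>\<^bsub>M\<^esub> y) = a \<odot>\<^bsub>M\<^esub> x \<ominus>\<^bsub>M\<^esub> a \<odot>\<^bsub>M\<^esub> y"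
  by (simp add: M.minus_eq smult_r_distr smult_minus_right)

lemma diff_eq_zero_iff:
  "x \<in> carrier M \<Longrightarrow> y \<in> carrier M \<Longrightarrow> x \<ominus>\<^bsub>M\<^esub> y = \<zero>\<^bsub>M\<^esub> \<longleftrightarrow> x = y"
  by (metis M.a_inv_closed M.minus_eq M.minus_equality M.minus_minus M.r_neg)

lemma smult_minus_left: "a \<in> carrier R \<Longrightarrow> x \<in> carrier M \<Longrightarrow> (\<ominus>\<^bsub>R\<^esub> a) \<odot>\<^bsub>M\<^esub> x = \<ominus>\<^bsub>M\<^esub> (a \<odot>\<^bsub>M\<^esub> x)"
  by (metis M.minus_equality R.a_inv_closed R.l_neg smult_closed smult_l_distr smult_zero_left)

text \<open>Negatives are values of the action of the scalar -1, so closure under the action covers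
  them.\<close>

lemma submoduleI:
  assumes "N \<subseteq> carrier M" "\<zero>\<^bsub>M\<^esub> \<in> N"
    and "\<And>x y. x \<in> N \<Longrightarrow> y \<in> N \<Longrightarrow> x \<oplus>\<^bsub>M\<^esub> y \<in> N"
    and smult: "\<And>a x. a \<in> carrier R \<Longrightarrow> x \<in> N \<Longrightarrow> a \<odot>\<^bsub>M\<^esub> x \<in> N"
  shows "submodule N R M"
proof -
  have "\<ominus>\<^bsub>M\<^esub> x \<in> N" if "x \<in> N" for x
    using smult[of "\<ominus>\<^bsub>R\<^esub> \<one>\<^bsub>R\<^esub>" x] smult_minus_left[of "\<one>\<^bsub>R\<^esub>" x] that assms(1) by auto
  then show ?thesis
    using assms by (intro submodule.intro subgroup.intro submodule_axioms.intro) (auto simp: a_inv_def)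
qed

context
  fixes N assumes N: "submodule N R M"
begin

lemma submodule_subset: "N \<subseteq> carrier M"
  using subgroup.subset[OF submodule.axioms(1)[OF N]] by simp

lemma submodule_memD: "x \<in> N \<Longrightarrow> x \<in> carrier M"
  using submodule_subset by auto

lemma submodule_zero: "\<zero>\<^bsub>M\<^esub> \<in> N"
  using subgroup.one_closed[OF submodule.axioms(1)[OF N]] by simp

lemma submodule_add: "x \<in> N \<Longrightarrow> y \<in> N \<Longrightarrow> x \<oplus>\<^bsub>M\<^esub> y \<in> N"
  using subgroup.m_closed[OF submodule.axioms(1)[OF N]] by simp

lemma submodule_smult: "a \<in> carrier R \<Longrightarrow> x \<in> N \<Longrightarrow> a \<odot>\<^bsub>M\<^esub> x \<in> N"
  by (rule submodule.smult_closed[OF N])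

lemma submodule_uminus: "x \<in> N \<Longrightarrow> \<ominus>\<^bsub>M\<^esub> x \<in> N"
  using subgroup.m_inv_closed[OF submodule.axioms(1)[OF N]] by (simp add: a_inv_def)

lemma submodule_abelian_subgroup: "abelian_subgroup N M"
  by (intro abelian_subgroupI3 additive_subgroupI submodule.axioms(1)[OF N] M.abelian_group_axioms)

lemma coset_eq_iff:
  "x \<in> carrier M \<Longrightarrow> y \<in> carrier M \<Longrightarrow> N +>\<^bsub>M\<^esub> x = N +>\<^bsub>M\<^esub> y \<longleftrightarrow> x \<ominus>\<^bsub>M\<^esub> y \<in> N"
proof -
  interpret abelian_subgroup N M by (rule submodule_abelian_subgroup)
  show "x \<in> carrier M \<Longrightarrow> y \<in> carrier M \<Longrightarrow> N +>\<^bsub>M\<^esub> x = N +>\<^bsub>M\<^esub> y \<longleftrightarrow> x \<ominus>\<^bsub>M\<^esub> y \<in> N"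
    by (metis M.minus_eq a_rcos_module a_repr_independence' a_rcos_self)
qed

lemma coset_mem_iff:
  "x \<in> carrier M \<Longrightarrow> y \<in> N +>\<^bsub>M\<^esub> x \<longleftrightarrow> y \<in> carrier M \<and> N +>\<^bsub>M\<^esub> y = N +>\<^bsub>M\<^esub> x"
proof -
  interpret abelian_subgroup N M by (rule submodule_abelian_subgroup)
  show "x \<in> carrier M \<Longrightarrow> y \<in> N +>\<^bsub>M\<^esub> x \<longleftrightarrow> y \<in> carrier M \<and> N +>\<^bsub>M\<^esub> y = N +>\<^bsub>M\<^esub> x"
    by (metis a_elemrcos_carrier a_repr_independence' a_rcos_self)
qed

lemma coset_add:
  "x \<in> carrier M \<Longrightarrow> y \<in> carrier M \<Longrightarrow> (N +>\<^bsub>M\<^esub> x) <+>\<^bsub>M\<^esub> (N +>\<^bsub>M\<^esub> y) = N +>\<^bsub>M\<^esub> (x \<oplus>\<^bsub>M\<^esub> y)"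
  by (rule abelian_subgroup.a_rcos_sum[OF submodule_abelian_subgroup])

lemma coset_zero: "N +>\<^bsub>M\<^esub> \<zero>\<^bsub>M\<^esub> = N"
  using submodule_subset by (rule M.a_coset_add_zero)

end

end

section \<open>Quotient modules and homomorphisms\<close>

lemma quotient_module_sel [simp]:
  "carrier (quotient_module M N) = (\<lambda>x. N +>\<^bsub>M\<^esub> x) ` carrier M"
  "\<zero>\<^bsub>quotient_module M N\<^esub> = N"
  "C \<oplus>\<^bsub>quotient_module M N\<^esub> D = C <+>\<^bsub>M\<^esub> D"
  by (auto simp: quotient_module_def A_RCOSETS_def')

text \<open>The record takes the union of the cosets of \<open>a\<close> times \<open>y\<close> over
  all \<open>y\<close> in the coset; the submodule is stable under \<open>a\<close>, so these cosets
  all coincide.\<close>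

lemma quotient_module_smult:
  assumes "left_module R M" "submodule N R M" "a \<in> carrier R" "x \<in> carrier M"
  shows "a \<odot>\<^bsub>quotient_module M N\<^esub> (N +>\<^bsub>M\<^esub> x) = N +>\<^bsub>M\<^esub> (a \<odot>\<^bsub>M\<^esub> x)"
proof -
  interpret left_module R M by (rule assms)
  have "N +>\<^bsub>M\<^esub> (a \<odot>\<^bsub>M\<^esub> y) = N +>\<^bsub>M\<^esub> (a \<odot>\<^bsub>M\<^esub> x)" if "y \<in> N +>\<^bsub>M\<^esub> x" for y
  proof -
    have y: "y \<in> carrier M" "N +>\<^bsub>M\<^esub> y = N +>\<^bsub>M\<^esub> x"
      using that unfolding coset_mem_iff[OF assms(2,4)] by auto
    then have "y \<ominus>\<^bsub>M\<^esub> x \<in> N"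
      using coset_eq_iff[OF assms(2)] assms(4) by simp
    then show ?thesis
      using assms y(1) by (simp add: coset_eq_iff submodule_smult flip: smult_diff_right)
  qed
  then have "(\<Union>y\<in>N +>\<^bsub>M\<^esub> x. N +>\<^bsub>M\<^esub> (a \<odot>\<^bsub>M\<^esub> y)) = (\<Union>y\<in>N +>\<^bsub>M\<^esub> x. N +>\<^bsub>M\<^esub> (a \<odot>\<^bsub>M\<^esub> x))"
    by (rule SUP_cong[OF refl])
  moreover have "x \<in> N +>\<^bsub>M\<^esub> x"
    using coset_mem_iff[OF assms(2,4)] assms(4) by simp
  ultimately show ?thesis
    by (auto simp: quotient_module_def)
qed

lemma left_module_quotient:
  fixes M :: "('a, 'b) module"
  assumes "left_module R M" "submodule N R M"
  shows "left_module R (quotient_module M N)"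
proof -
  interpret left_module R M by (rule assms)
  note N = assms(2)
  note smult = quotient_module_smult[OF assms]
  show ?thesis
  proof (rule left_module.intro)
    show "ring R" ..
    show "abelian_group (quotient_module M N)"
    proof (rule abelian_groupI)
      show "\<zero>\<^bsub>quotient_module M N\<^esub> \<in> carrier (quotient_module M N)"
        using coset_zero[OF N] by force
      show "\<exists>y\<in>carrier (quotient_module M N). y \<oplus>\<^bsub>quotient_module M N\<^esub> x = \<zero>\<^bsub>quotient_module M N\<^esub>"
        if x: "x \<in> carrier (quotient_module M N)" for x
      proof -
        obtain y where "y \<in> carrier M" "x = N +>\<^bsub>M\<^esub> y" using x by auto
        then show ?thesis
          by (intro bexI[of _ "N +>\<^bsub>M\<^esub> (\<ominus>\<^bsub>M\<^esub> y)"]) (auto simp: coset_add[OF N] coset_zero[OF N] M.l_neg)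
      qed
      show "\<zero>\<^bsub>quotient_module M N\<^esub> \<oplus>\<^bsub>quotient_module M N\<^esub> x = x"
        if "x \<in> carrier (quotient_module M N)" for x
        using that coset_add[OF N, of "\<zero>\<^bsub>M\<^esub>"] coset_zero[OF N] by auto
    qed (auto simp: coset_add[OF N] M.a_ac)
    show "left_module_axioms R (quotient_module M N)"
      by (rule left_module_axioms.intro)
        (auto simp: smult coset_add[OF N] smult_l_distr smult_r_distr smult_assoc1)
  qed
qed

lemma mod_homI:
  assumes "\<And>x. x \<in> carrier M \<Longrightarrow> f x \<in> carrier N"
    and "\<And>x y. x \<in> carrier M \<Longrightarrow> y \<in> carrier M \<Longrightarrow> f (x \<oplus>\<^bsub>M\<^esub> y) = f x \<oplus>\<^bsub>N\<^esub> f y"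
    and "\<And>a x. a \<in> carrier R \<Longrightarrow> x \<in> carrier M \<Longrightarrow> f (a \<odot>\<^bsub>M\<^esub> x) = a \<odot>\<^bsub>N\<^esub> f x"
  shows "f \<in> mod_hom R M N"
  using assms by (auto simp: mod_hom_def hom_def)

lemma mod_homD:
  assumes "f \<in> mod_hom R M N"
  shows mod_hom_closed: "x \<in> carrier M \<Longrightarrow> f x \<in> carrier N"
    and mod_hom_add: "x \<in> carrier M \<Longrightarrow> y \<in> carrier M \<Longrightarrow> f (x \<oplus>\<^bsub>M\<^esub> y) = f x \<oplus>\<^bsub>N\<^esub> f y"
    and mod_hom_smult: "a \<in> carrier R \<Longrightarrow> x \<in> carrier M \<Longrightarrow> f (a \<odot>\<^bsub>M\<^esub> x) = a \<odot>\<^bsub>N\<^esub> f x"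
  using assms by (auto simp: mod_hom_def hom_def)

lemma mod_hom_zero:
  assumes "left_module R M" "left_module R N" "f \<in> mod_hom R M N"
  shows "f \<zero>\<^bsub>M\<^esub> = \<zero>\<^bsub>N\<^esub>"
proof -
  interpret M: left_module R M by (rule assms)
  interpret N: left_module R N by (rule assms)
  have "f (\<zero>\<^bsub>R\<^esub> \<odot>\<^bsub>M\<^esub> \<zero>\<^bsub>M\<^esub>) = \<zero>\<^bsub>R\<^esub> \<odot>\<^bsub>N\<^esub> f \<zero>\<^bsub>M\<^esub>"
    using assms(3) by (intro mod_hom_smult) auto
  then show ?thesis using mod_hom_closed[OF assms(3)] by simp
qed

lemma mod_hom_diff:
  assumes "left_module R M" "left_module R N" "f \<in> mod_hom R M N" "x \<in> carrier M" "y \<in> carrier M"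
  shows "f (x \<ominus>\<^bsub>M\<^esub> y) = f x \<ominus>\<^bsub>N\<^esub> f y"
proof -
  interpret M: left_module R M by (rule assms)
  interpret N: left_module R N by (rule assms)
  have "f (\<ominus>\<^bsub>M\<^esub> y) = \<ominus>\<^bsub>N\<^esub> f y"
    using assms M.smult_minus_left[of "\<one>\<^bsub>R\<^esub>" y] N.smult_minus_left[of "\<one>\<^bsub>R\<^esub>" "f y"]
      mod_hom_smult[OF assms(3), of "\<ominus>\<^bsub>R\<^esub> \<one>\<^bsub>R\<^esub>" y] by (simp add: mod_hom_closed[OF assms(3)])
  then show ?thesis
    using assms by (simp add: M.M.minus_eq N.M.minus_eq mod_hom_add[OF assms(3)])
qed

lemma mod_hom_comp:
  "f \<in> mod_hom R M N \<Longrightarrow> g \<in> mod_hom R N K \<Longrightarrow> g \<circ> f \<in> mod_hom R M K"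
  by (auto simp: mod_hom_def hom_def Pi_iff)

lemma mod_hom_inv_into:
  assumes "left_module R M" "f \<in> mod_hom R M N" "bij_betw f (carrier M) (carrier N)"
  shows "inv_into (carrier M) f \<in> mod_hom R N M"
proof -
  interpret M: left_module R M by (rule assms)
  let ?g = "inv_into (carrier M) f"
  have g [simp]: "?g y \<in> carrier M" "f (?g y) = y" if "y \<in> carrier N" for y
    using that assms(3) by (simp_all add: bij_betw_inv_into_right bij_betw_imp_surj_on inv_into_into)
  have eq: "?g (f x) = x" if "x \<in> carrier M" for x
    using that bij_betw_inv_into_left[OF assms(3)] by simp
  show ?thesis
  proof (rule mod_homI)
    fix x y assume *: "x \<in> carrier N" "y \<in> carrier N"
    then show "?g (x \<oplus>\<^bsub>N\<^esub> y) = ?g x \<oplus>\<^bsub>M\<^esub> ?g y"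
      using eq[of "?g x \<oplus>\<^bsub>M\<^esub> ?g y"] mod_hom_add[OF assms(2), of "?g x" "?g y"] by simp
  next
    fix a x assume *: "a \<in> carrier R" "x \<in> carrier N"
    then show "?g (a \<odot>\<^bsub>N\<^esub> x) = a \<odot>\<^bsub>M\<^esub> ?g x"
      using eq[of "a \<odot>\<^bsub>M\<^esub> ?g x"] mod_hom_smult[OF assms(2), of a "?g x"] by simp
  qed (simp add: g)
qed

lemma coset_mod_hom:
  assumes "left_module R M" "submodule N R M"
  shows "(\<lambda>x. N +>\<^bsub>M\<^esub> x) \<in> mod_hom R M (quotient_module M N)"
  using left_module.coset_add[OF assms] quotient_module_smult[OF assms] by (intro mod_homI) auto

lemma mod_hom_factor:
  assumes M: "left_module R M" and N: "submodule N R M" and K: "left_module R K"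
    and f: "f \<in> mod_hom R M K" "\<And>x. x \<in> N \<Longrightarrow> f x = \<zero>\<^bsub>K\<^esub>"
  shows "\<exists>g\<in>mod_hom R (quotient_module M N) K. \<forall>x\<in>carrier M. g (N +>\<^bsub>M\<^esub> x) = f x"
proof -
  interpret M: left_module R M by (rule M)
  interpret K: left_module R K by (rule K)
  \<comment> \<open>An arbitrary representative of the coset is taken; the difference of two
    representatives lies in \<open>N\<close>, where \<open>f\<close> vanishes.\<close>
  define g where "g = (\<lambda>C. f (SOME x. x \<in> carrier M \<and> C = N +>\<^bsub>M\<^esub> x))"
  have g: "g (N +>\<^bsub>M\<^esub> x) = f x" if x: "x \<in> carrier M" for x
  proof -
    define y where "y = (SOME y. y \<in> carrier M \<and> N +>\<^bsub>M\<^esub> x = N +>\<^bsub>M\<^esub> y)"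
    have y: "y \<in> carrier M \<and> N +>\<^bsub>M\<^esub> x = N +>\<^bsub>M\<^esub> y"
      unfolding y_def by (rule someI[of _ x]) (simp add: x)
    then have "f (x \<ominus>\<^bsub>M\<^esub> y) = \<zero>\<^bsub>K\<^esub>"
      using f(2) M.coset_eq_iff[OF N] x by blast
    then have "f x \<ominus>\<^bsub>K\<^esub> f y = \<zero>\<^bsub>K\<^esub>"
      using mod_hom_diff[OF M K f(1)] x y by simp
    then have "f x = f y"
      using x y mod_hom_closed[OF f(1)] K.diff_eq_zero_iff by blast
    then show ?thesis unfolding g_def y_def by simp
  qed
  have "g \<in> mod_hom R (quotient_module M N) K"
    by (rule mod_homI) (auto simp: M.coset_add[OF N] quotient_module_smult[OF M N] g
      mod_hom_closed[OF f(1)] mod_hom_add[OF f(1)] mod_hom_smult[OF f(1)])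
  then show ?thesis using g by blast
qed

lemma regular_module_sel [simp]:
  "carrier (regular_module R) = carrier R" "\<zero>\<^bsub>regular_module R\<^esub> = \<zero>\<^bsub>R\<^esub>"
  "a \<oplus>\<^bsub>regular_module R\<^esub> b = a \<oplus>\<^bsub>R\<^esub> b" "a \<odot>\<^bsub>regular_module R\<^esub> b = a \<otimes>\<^bsub>R\<^esub> b"
  by (simp_all add: regular_module_def)

lemma left_module_regular:
  assumes "ring R"
  shows "left_module R (regular_module R)"
proof -
  interpret ring R by (rule assms)
  have "abelian_group (regular_module R)"
    by (rule abelian_groupI) (auto simp: a_ac intro: l_neg)
  then show ?thesis
    by (intro left_module.intro left_module_axioms.intro assms) (auto simp: l_distr r_distr m_assoc)
qed

lemma orbit_mod_hom:
  assumes "left_module R M" "x \<in> carrier M"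
  shows "(\<lambda>a. a \<odot>\<^bsub>M\<^esub> x) \<in> mod_hom R (regular_module R) M"
proof -
  interpret left_module R M by (rule assms)
  show ?thesis using assms(2) by (intro mod_homI) (auto simp: smult_l_distr smult_assoc1)
qed

section \<open>Relations in the Weyl algebra\<close>

lemma X_X_op: "X_op i \<circ> X_op j = X_op j \<circ> (X_op i :: ('i, 'k::field) opr)"
  by (rule linear_eqI) (auto simp: linear_comp linear_X_op ac_simps)

lemma Y_X_op_distinct:
  assumes "i \<noteq> j"
  shows "Y_op i \<circ> X_op j = X_op j \<circ> (Y_op i :: ('i, 'k::field) opr)"
proof (rule linear_eqI)
  fix m :: "'i \<Rightarrow>\<^sub>0 nat"
  have "m + single j 1 - single i 1 =
      m - single i 1 + single j 1" if "lookup m i \<noteq> 0"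
    by (rule poly_mapping_eqI) (use that assms in \<open>auto simp: lookup_add lookup_minus lookup_single when_def\<close>)
  then show "(Y_op i \<circ> X_op j) (single m 1) = (X_op j \<circ> Y_op i) (single m (1::'k))"
    using assms by (cases "lookup m i = 0")
      (auto simp: lookup_add lookup_single linear_zero[OF linear_X_op])
qed (auto simp: linear_comp linear_X_op linear_Y_op)

lemma Y_Y_op: "Y_op i \<circ> Y_op j = Y_op j \<circ> (Y_op i :: ('i, 'k::field) opr)"
proof (cases "i = j")
  case False
  then show ?thesis
    by (intro linear_eqI)
      (auto simp: linear_comp linear_Y_op lookup_minus lookup_single when_def mult.commute
        intro!: arg_cong2[of _ _ _ _ single] poly_mapping_eqI)
qed simp

text \<open>The Weyl relation [Y,X] = 1, with the product in the other order named
  \<open>t_op\<close>, because that is the operator diagonal on weight vectors.\<close>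

lemma Y_X_op: "Y_op i \<circ> X_op i = (\<lambda>f. t_op i f + (f :: ('i, 'k::field) polys))"
proof (rule linear_eqI)
  show "Vector_Spaces.linear scal scal (\<lambda>f. t_op i f + (f :: ('i, 'k) polys))"
    using linear_add[OF linear_comp[OF linear_X_op linear_Y_op] linear_scal[of 1], of i i]
    by (simp add: t_op_def comp_def)
  fix m :: "'i \<Rightarrow>\<^sub>0 nat"
  have "m - single i 1 + single i 1 = m" if "lookup m i \<noteq> 0"
    by (rule poly_mapping_eqI) (use that in \<open>auto simp: lookup_add lookup_minus lookup_single when_def\<close>)
  then show "(Y_op i \<circ> X_op i) (single m 1) =
      t_op i (single m 1) + single m (1 :: 'k)"
    by (cases "lookup m i = 0")
      (auto simp: t_op_def lookup_add single_add algebra_simps linear_zero[OF linear_X_op])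
qed (simp add: linear_comp linear_X_op linear_Y_op)

lemma t_op_weyl [simp]: "t_op i \<in> carrier weyl"
  by (simp add: t_op_def)

lemma scal_central: "a \<in> carrier weyl \<Longrightarrow> a \<circ> scal c = scal c \<circ> a"
  using weyl_linear[of a] by (auto simp: linear_scal_iff)

text \<open>In \<open>outgoing z a\<close> the word \<open>a\<close> shifts weights by \<open>z\<close>, and each of its letters moves away
  from the starting point.\<close>

inductive outgoing :: "('i \<Rightarrow> int) \<Rightarrow> ('i, 'k::field) opr \<Rightarrow> bool" where
  id: "outgoing (\<lambda>_. 0) id"
| X: "outgoing z a \<Longrightarrow> z i \<ge> 0 \<Longrightarrow> outgoing (z(i := z i + 1)) (X_op i \<circ> a)"
| Y: "outgoing z a \<Longrightarrow> z i \<le> 0 \<Longrightarrow> outgoing (z(i := z i - 1)) (Y_op i \<circ> a)"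

lemma outgoing_carrier: "outgoing z a \<Longrightarrow> a \<in> carrier weyl"
  by (induction rule: outgoing.induct) (simp_all only: weyl_intros weyl_comp)

lemma outgoing_finite: "outgoing z a \<Longrightarrow> finite {i. z i \<noteq> 0}"
proof (induction rule: outgoing.induct)
  case (X z a i)
  show ?case by (rule finite_subset[of _ "insert i {i. z i \<noteq> 0}"]) (use X in auto)
next
  case (Y z a i)
  show ?case by (rule finite_subset[of _ "insert i {i. z i \<noteq> 0}"]) (use Y in auto)
qed simp

text \<open>A word with positive shift at \<open>i\<close> contains no letter \<open>Y_op i\<close>,
  and \<open>X_op i\<close> commutes with every other letter, so one copy of it can be brought to
  the front.\<close>

lemma outgoing_exchange_X:
  "outgoing z a \<Longrightarrow> z i > 0 \<Longrightarrow> \<exists>b. outgoing (z(i := z i - 1)) b \<and> a = X_op i \<circ> b"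
proof (induction rule: outgoing.induct)
  case (X z a j)
  show ?case
  proof (cases "j = i")
    case True
    have "outgoing ((z(j := z j + 1))(i := (z(j := z j + 1)) i - 1)) a"
      using True X.hyps(1) by simp
    then show ?thesis using True by blast
  next
    case False
    then have "z i > 0" using X.prems by simp
    then obtain b where b: "outgoing (z(i := z i - 1)) b" "a = X_op i \<circ> b"
      using X.IH by blast
    have "outgoing (z(i := z i - 1, j := z j + 1)) (X_op j \<circ> b)"
      using outgoing.X[OF b(1), of j] False X.hyps by simp
    moreover have "X_op j \<circ> a = X_op i \<circ> (X_op j \<circ> b)"
      unfolding b(2) comp_assoc[symmetric] by (simp only: X_X_op)
    ultimately show ?thesis using False by (metis fun_upd_other fun_upd_twist)
  qed
next
  case (Y z a j)
  show ?case
  proof (cases "j = i")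
    case True
    \<comment> \<open>An outermost letter \<open>Y_op i\<close> would leave a negative shift at
      \<open>i\<close>, contrary to the assumption.\<close>
    then show ?thesis using Y by simp
  next
    case False
    then have "z i > 0" using Y.prems by simp
    then obtain b where b: "outgoing (z(i := z i - 1)) b" "a = X_op i \<circ> b"
      using Y.IH by blast
    have "outgoing (z(i := z i - 1, j := z j - 1)) (Y_op j \<circ> b)"
      using outgoing.Y[OF b(1), of j] False Y.hyps by simp
    moreover have "Y_op j \<circ> a = X_op i \<circ> (Y_op j \<circ> b)"
      unfolding b(2) comp_assoc[symmetric] by (simp only: Y_X_op_distinct[OF False])
    ultimately show ?thesis using False by (metis fun_upd_other fun_upd_twist)
  qed
qed simp

lemma outgoing_exchange_Y:
  "outgoing z a \<Longrightarrow> z i < 0 \<Longrightarrow> \<exists>b. outgoing (z(i := z i + 1)) b \<and> a = Y_op i \<circ> b"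
proof (induction rule: outgoing.induct)
  case (Y z a j)
  show ?case
  proof (cases "j = i")
    case True
    have "outgoing ((z(j := z j - 1))(i := (z(j := z j - 1)) i + 1)) a"
      using True Y.hyps(1) by simp
    then show ?thesis using True by blast
  next
    case False
    then have "z i < 0" using Y.prems by simp
    then obtain b where b: "outgoing (z(i := z i + 1)) b" "a = Y_op i \<circ> b"
      using Y.IH by blast
    have "outgoing (z(i := z i + 1, j := z j - 1)) (Y_op j \<circ> b)"
      using outgoing.Y[OF b(1), of j] False Y.hyps by simp
    moreover have "Y_op j \<circ> a = Y_op i \<circ> (Y_op j \<circ> b)"
      unfolding b(2) comp_assoc[symmetric] by (simp only: Y_Y_op)
    ultimately show ?thesis using False by (metis fun_upd_other fun_upd_twist)
  qed
next
  case (X z a j)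
  show ?case
  proof (cases "j = i")
    case True
    then show ?thesis using X by simp
  next
    case False
    then have "z i < 0" using X.prems by simp
    then obtain b where b: "outgoing (z(i := z i + 1)) b" "a = Y_op i \<circ> b"
      using X.IH by blast
    have "outgoing (z(i := z i + 1, j := z j + 1)) (X_op j \<circ> b)"
      using outgoing.X[OF b(1), of j] False X.hyps by simp
    moreover have "X_op j \<circ> a = Y_op i \<circ> (X_op j \<circ> b)"
      unfolding b(2) comp_assoc[symmetric] by (simp only: Y_X_op_distinct[OF False[symmetric]])
    ultimately show ?thesis using False by (metis fun_upd_other fun_upd_twist)
  qed
qed simp

text \<open>Induction on one word: the exchange lemmas bring its outermost letter to the front of
  the other word, and stripping it leaves two words of equal shift.\<close>

lemma outgoing_unique: "outgoing z a \<Longrightarrow> outgoing z b \<Longrightarrow> a = b"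
proof (induction arbitrary: b rule: outgoing.induct)
  case id
  then show ?case
  proof (cases rule: outgoing.cases)
    case (X z a i)
    \<comment> \<open>A last letter moves away from 0, so afterwards the shift cannot be 0
      everywhere.\<close>
    then have "z i + 1 = 0" by (metis fun_upd_same)
    then show ?thesis using X by simp
  next
    case (Y z a i)
    then have "z i - 1 = 0" by (metis fun_upd_same)
    then show ?thesis using Y by simp
  qed simp
next
  case (X z a i)
  have "(z(i := z i + 1)) i > 0" using X.hyps(2) by simp
  from outgoing_exchange_X[OF X.prems this] obtain c
    where c: "outgoing (z(i := z i + 1, i := (z(i := z i + 1)) i - 1)) c" "b = X_op i \<circ> c"
    by blast
  have "outgoing z c" using c(1) by simp
  from X.IH[OF this] show ?case unfolding c(2) by (simp only:)
next
  case (Y z a i)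
  have "(z(i := z i - 1)) i < 0" using Y.hyps(2) by simp
  from outgoing_exchange_Y[OF Y.prems this] obtain c
    where c: "outgoing (z(i := z i - 1, i := (z(i := z i - 1)) i + 1)) c" "b = Y_op i \<circ> c"
    by blast
  have "outgoing z c" using c(1) by simp
  from Y.IH[OF this] show ?case unfolding c(2) by (simp only:)
qed

text \<open>The word is built one coordinate at a time, by repeating \<open>X_op i\<close> or
  \<open>Y_op i\<close> according to the sign of the shift.\<close>

lemma outgoing_exists:
  assumes "finite {i. z i \<noteq> 0}"
  shows "\<exists>a :: ('i, 'k::field) opr. outgoing z a"
proof -
  have up: "\<exists>b :: ('i, 'k) opr. outgoing (z(i := int n)) b" "\<exists>b :: ('i, 'k) opr. outgoing (z(i := - int n)) b"
    if "outgoing z a" "z i = 0" for z i n and a :: "('i, 'k) opr"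
  proof -
    show "\<exists>b :: ('i, 'k) opr. outgoing (z(i := int n)) b"
    proof (induction n)
      case 0
      then show ?case using that by (metis fun_upd_triv of_nat_0)
    next
      case (Suc n)
      then obtain b :: "('i, 'k) opr" where "outgoing (z(i := int n)) b" by blast
      then have "outgoing (z(i := int (Suc n))) (X_op i \<circ> b)"
        using outgoing.X[of "z(i := int n)" b i] by (simp add: add.commute)
      then show ?case by blast
    qed
    show "\<exists>b :: ('i, 'k) opr. outgoing (z(i := - int n)) b"
    proof (induction n)
      case 0
      then show ?case using that by (metis fun_upd_triv of_nat_0 neg_0_equal_iff_equal)
    next
      case (Suc n)
      then obtain b :: "('i, 'k) opr" where "outgoing (z(i := - int n)) b" by blast
      moreover have "- int (Suc n) = - int n - 1" by simp
      ultimately have "outgoing (z(i := - int (Suc n))) (Y_op i \<circ> b)"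
        using outgoing.Y[of "z(i := - int n)" b i] by (simp only: fun_upd_upd fun_upd_same)
      then show ?case by blast
    qed
  qed
  have "\<exists>a :: ('i, 'k) opr. outgoing z a" if "finite S" "{i. z i \<noteq> 0} \<subseteq> S" for S
    using that
  proof (induction S arbitrary: z rule: finite_induct)
    case empty
    then have "z = (\<lambda>_. 0)" by auto
    then show ?case using outgoing.id by blast
  next
    case (insert i S)
    then have "{j. (z(i := 0)) j \<noteq> 0} \<subseteq> S" by auto
    from insert.IH[OF this] obtain a :: "('i, 'k) opr" where "outgoing (z(i := 0)) a" by blast
    from up[OF this, of i "nat \<bar>z i\<bar>"]
    have "\<exists>b :: ('i, 'k) opr. outgoing (z(i := \<bar>z i\<bar>)) b" "\<exists>b :: ('i, 'k) opr. outgoing (z(i := - \<bar>z i\<bar>)) b"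
      by (simp_all only: fun_upd_upd fun_upd_same int_nat_eq abs_ge_zero if_True)
    \<comment> \<open>Words for both signs of the absolute value are available; one of the two
      values is \<open>z i\<close> itself.\<close>
    then show ?case
      by (metis abs_of_neg abs_of_nonneg add.inverse_inverse fun_upd_triv linorder_not_le)
  qed
  from this[OF assms] show ?thesis by auto
qed

section \<open>Weight spaces\<close>

locale weyl_mod = left_module weyl M
  for M :: "('i, 'k::field_char_0, 'm) weyl_module" (structure)
begin

lemma act_comp:
  "a \<in> carrier weyl \<Longrightarrow> b \<in> carrier weyl \<Longrightarrow> x \<in> carrier M \<Longrightarrow> (a \<circ> b) \<odot> x = a \<odot> (b \<odot> x)"
  using smult_assoc1[of a b x] by (simp only: weyl_sel)

lemma act_add:
  "a \<in> carrier weyl \<Longrightarrow> b \<in> carrier weyl \<Longrightarrow> x \<in> carrier M \<Longrightarrow>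
    (\<lambda>f. a f + b f) \<odot> x = a \<odot> x \<oplus> b \<odot> x"
  using smult_l_distr[of a b x] by (simp only: weyl_sel)

lemma act_id [simp]: "x \<in> carrier M \<Longrightarrow> id \<odot> x = x"
  using smult_one[of x] by (simp only: weyl_sel)

lemma scal_comm:
  "a \<in> carrier weyl \<Longrightarrow> x \<in> carrier M \<Longrightarrow> a \<odot> (scal c \<odot> x) = scal c \<odot> (a \<odot> x)"
  by (metis act_comp scal_central weyl_intros(1))

lemma scal_scal: "x \<in> carrier M \<Longrightarrow> scal c \<odot> (scal d \<odot> x) = scal (c * d) \<odot> x"
  using act_comp[of "scal c" "scal d" x] by (simp add: comp_def)

lemma scal_one [simp]: "x \<in> carrier M \<Longrightarrow> scal 1 \<odot> x = x"
  using act_id[of x] by (simp only: scal_simps(4))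

lemma scal_plus: "x \<in> carrier M \<Longrightarrow> scal (c + d) \<odot> x = scal c \<odot> x \<oplus> scal d \<odot> x"
  using act_add[of "scal c" "scal d" x] by (simp add: scal_add_left[abs_def])

lemma scal_zero [simp]: "x \<in> carrier M \<Longrightarrow> scal 0 \<odot> x = \<zero>"
  using smult_zero_left[of x] by (simp add: scal_simps(3)[abs_def])

lemma scal_uminus: "x \<in> carrier M \<Longrightarrow> scal (- c) \<odot> x = \<ominus> (scal c \<odot> x)"
  using scal_plus[of x "- c" c] by (intro M.minus_equality[symmetric]) auto

lemma scal_diff: "x \<in> carrier M \<Longrightarrow> scal (c - d) \<odot> x = scal c \<odot> x \<ominus> scal d \<odot> x"
  using scal_plus[of x c "- d"] by (simp add: scal_uminus M.minus_eq)

lemma scal_cancel: "x \<in> carrier M \<Longrightarrow> scal c \<odot> x = \<zero> \<Longrightarrow> c \<noteq> 0 \<Longrightarrow> x = \<zero>"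
  using scal_scal[of x "inverse c" c] by simp

lemma t_act: "x \<in> carrier M \<Longrightarrow> t_op i \<odot> x = X_op i \<odot> (Y_op i \<odot> x)"
  by (metis act_comp t_op_def weyl_intros(2,3))

lemma Y_X_act: "x \<in> carrier M \<Longrightarrow> Y_op i \<odot> (X_op i \<odot> x) = t_op i \<odot> x \<oplus> x"
  using act_comp[OF weyl_intros(3,2), of x i i] act_add[OF t_op_weyl weyl_intros(4), of x i]
  by (simp only: Y_X_op id_apply act_id)

lemma X_X_act: "x \<in> carrier M \<Longrightarrow> X_op i \<odot> (X_op j \<odot> x) = X_op j \<odot> (X_op i \<odot> x)"
  by (metis act_comp X_X_op weyl_intros(2))

lemma Y_Y_act: "x \<in> carrier M \<Longrightarrow> Y_op i \<odot> (Y_op j \<odot> x) = Y_op j \<odot> (Y_op i \<odot> x)"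
  by (metis act_comp Y_Y_op weyl_intros(3))

lemma Y_X_act_distinct:
  "i \<noteq> j \<Longrightarrow> x \<in> carrier M \<Longrightarrow> Y_op i \<odot> (X_op j \<odot> x) = X_op j \<odot> (Y_op i \<odot> x)"
  by (metis act_comp Y_X_op_distinct weyl_intros(2,3))

abbreviation W where "W \<equiv> weight_space M"

lemma W_carrier [intro]: "x \<in> W q \<Longrightarrow> x \<in> carrier M"
  by (simp add: weight_space_def)

lemma W_t: "x \<in> W q \<Longrightarrow> t_op i \<odot> x = scal (q i) \<odot> x"
  by (simp add: weight_space_def)

lemma W_zero [simp]: "\<zero> \<in> W q"
  by (simp add: weight_space_def)

lemma W_add: "x \<in> W q \<Longrightarrow> y \<in> W q \<Longrightarrow> x \<oplus> y \<in> W q"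
  by (auto simp: weight_space_def smult_r_distr)

lemma W_scal: "x \<in> W q \<Longrightarrow> scal c \<odot> x \<in> W q"
  by (auto simp: weight_space_def scal_comm[of "t_op _"] scal_scal mult.commute)

lemma W_uminus: "x \<in> W q \<Longrightarrow> \<ominus> x \<in> W q"
  using W_scal[of x q "-1"] by (simp add: scal_uminus W_carrier)

lemma W_diff: "x \<in> W q \<Longrightarrow> y \<in> W q \<Longrightarrow> x \<ominus> y \<in> W q"
  by (simp add: M.minus_eq W_add W_uminus)

lemma Y_X_weight: "x \<in> W q \<Longrightarrow> Y_op i \<odot> (X_op i \<odot> x) = scal (q i + 1) \<odot> x"
  by (simp add: Y_X_act W_t W_carrier scal_plus)

lemma X_Y_weight: "x \<in> W q \<Longrightarrow> X_op i \<odot> (Y_op i \<odot> x) = scal (q i) \<odot> x"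
  using W_t[of x q i] by (simp add: t_act W_carrier)

lemma X_weight:
  assumes x: "x \<in> W q"
  shows "X_op i \<odot> x \<in> W (q(i := q i + 1))"
proof -
  have c: "x \<in> carrier M" using x by auto
  have "t_op j \<odot> (X_op i \<odot> x) = scal ((q(i := q i + 1)) j) \<odot> (X_op i \<odot> x)" for j
  proof (cases "j = i")
    case True
    then show ?thesis
      using x c by (simp add: t_act Y_X_weight scal_comm[of "X_op _"])
  next
    case False
    then show ?thesis
      using x c by (simp add: t_act Y_X_act_distinct X_X_act[of _ j i] X_Y_weight scal_comm[of "X_op _"])
  qed
  then show ?thesis using c by (auto simp: weight_space_def)
qed

lemma Y_weight:
  assumes x: "x \<in> W q"
  shows "Y_op i \<odot> x \<in> W (q(i := q i - 1))"
proof -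
  have c: "x \<in> carrier M" using x by auto
  have "t_op j \<odot> (Y_op i \<odot> x) = scal ((q(i := q i - 1)) j) \<odot> (Y_op i \<odot> x)" for j
  proof (cases "j = i")
    case True
    \<comment> \<open>The Weyl relation applied to \<open>Y_op i \<odot> x\<close> evaluates the
      product YXY on \<open>x\<close> in two ways; cancelling one copy lowers the eigenvalue by
      1.\<close>
    have "t_op i \<odot> (Y_op i \<odot> x) \<oplus> Y_op i \<odot> x = scal (q i) \<odot> (Y_op i \<odot> x)"
      using Y_X_act[of "Y_op i \<odot> x" i] X_Y_weight[OF x, of i] c by (simp add: scal_comm[of "Y_op _"])
    also have "\<dots> = scal (q i - 1) \<odot> (Y_op i \<odot> x) \<oplus> Y_op i \<odot> x"
      using scal_plus[of "Y_op i \<odot> x" "q i - 1" 1] c by simp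
    finally show ?thesis using True c by simp
  next
    case False
    then show ?thesis
      using x c by (simp add: t_act Y_Y_act[of _ j i] X_Y_weight scal_comm[of "Y_op _"] flip: Y_X_act_distinct)
  qed
  then show ?thesis using c by (auto simp: weight_space_def)
qed

lemma outgoing_weight:
  "outgoing z a \<Longrightarrow> x \<in> W q \<Longrightarrow> a \<odot> x \<in> W (\<lambda>i. q i + of_int (z i))"
proof (induction rule: outgoing.induct)
  case id
  then show ?case by (simp only: act_id[OF W_carrier[OF id]] of_int_0 add_0_right)
next
  case (X z a i)
  have "(\<lambda>j. q j + of_int (z j))(i := q i + of_int (z i) + 1) = (\<lambda>j. q j + of_int ((z(i := z i + 1)) j))"
    by auto
  then show ?case
    using X_weight[OF X.IH[OF X.prems], of i]
    by (simp only: act_comp[OF weyl_intros(2) outgoing_carrier[OF X.hyps(1)] W_carrier[OF X.prems]])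
next
  case (Y z a i)
  have "(\<lambda>j. q j + of_int (z j))(i := q i + of_int (z i) - 1) = (\<lambda>j. q j + of_int ((z(i := z i - 1)) j))"
    by auto
  then show ?case
    using Y_weight[OF Y.IH[OF Y.prems], of i]
    by (simp only: act_comp[OF weyl_intros(3) outgoing_carrier[OF Y.hyps(1)] W_carrier[OF Y.prems]])
qed

end

section \<open>Weight decompositions\<close>

text \<open>Finite sums of weight vectors are generated inductively, so that additive statements can
  be proved without index sets; \<open>Q\<close> restricts the weights in order to speak of all
  weights but one.\<close>

inductive_set wspan :: "('i, 'k::field, 'm) weyl_module \<Rightarrow> (('i \<Rightarrow> 'k) \<Rightarrow> bool) \<Rightarrow> 'm set"
  for M Q where
  zero: "\<zero>\<^bsub>M\<^esub> \<in> wspan M Q"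
| add: "x \<in> wspan M Q \<Longrightarrow> w \<in> weight_space M q \<Longrightarrow> Q q \<Longrightarrow> x \<oplus>\<^bsub>M\<^esub> w \<in> wspan M Q"

text \<open>The component of weight \<open>q\<close> is singled out modulo the span of the other
  weights. This makes sense for every vector of the span, also in a module that is not assumed to be
  a weight module.\<close>

definition wproj :: "('i, 'k::field, 'm) weyl_module \<Rightarrow> ('i \<Rightarrow> 'k) \<Rightarrow> 'm \<Rightarrow> 'm" where
  "wproj M q x = (THE y. y \<in> weight_space M q \<and> x \<ominus>\<^bsub>M\<^esub> y \<in> wspan M (\<lambda>r. r \<noteq> q))"

context weyl_mod
begin

lemma uminus_zero [simp]: "\<ominus> \<zero> = \<zero>"
  by (rule M.minus_equality) simp_all

lemma wspan_carrier: "x \<in> wspan M Q \<Longrightarrow> x \<in> carrier M"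
  by (induction rule: wspan.induct) auto

lemma wspan_weight: "w \<in> W q \<Longrightarrow> Q q \<Longrightarrow> w \<in> wspan M Q"
  using wspan.add[OF wspan.zero, of w M q Q] by (simp add: W_carrier)

lemma wspan_add:
  assumes x: "x \<in> wspan M Q" and y: "y \<in> wspan M Q"
  shows "x \<oplus> y \<in> wspan M Q"
  using y
proof (induction rule: wspan.induct)
  case zero
  then show ?case using x by (simp add: wspan_carrier)
next
  case (add y w q)
  have "x \<oplus> y \<oplus> w \<in> wspan M Q" by (rule wspan.add[OF add.IH add.hyps(2,3)])
  then show ?case using x add by (simp add: wspan_carrier W_carrier M.a_assoc)
qed

lemma wspan_uminus: "x \<in> wspan M Q \<Longrightarrow> \<ominus> x \<in> wspan M Q"
proof (induction rule: wspan.induct)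
  case zero
  then show ?case by (simp add: wspan.zero)
next
  case (add x w q)
  have "\<ominus> x \<oplus> \<ominus> w \<in> wspan M Q" by (rule wspan.add[OF add.IH W_uminus[OF add.hyps(2)] add.hyps(3)])
  then show ?case using add by (simp add: wspan_carrier W_carrier M.minus_add)
qed

lemma wspan_diff: "x \<in> wspan M Q \<Longrightarrow> y \<in> wspan M Q \<Longrightarrow> x \<ominus> y \<in> wspan M Q"
  by (simp add: M.minus_eq wspan_add wspan_uminus)

lemma wspan_act:
  assumes "x \<in> wspan M Q" and a: "a \<in> carrier weyl"
    and W: "\<And>q w. Q q \<Longrightarrow> w \<in> W q \<Longrightarrow> a \<odot> w \<in> wspan M Q'"
  shows "a \<odot> x \<in> wspan M Q'"
  using assms(1)
proof (induction rule: wspan.induct)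
  case zero
  then show ?case using a by (simp add: wspan.zero)
next
  case (add x w q)
  then show ?case
    using W[of q w] a by (simp add: smult_r_distr wspan_carrier W_carrier wspan_add)
qed

lemma wspan_mono: "x \<in> wspan M Q \<Longrightarrow> (\<And>q. Q q \<Longrightarrow> Q' q) \<Longrightarrow> x \<in> wspan M Q'"
proof (induction rule: wspan.induct)
  case (add x w q)
  show ?case by (rule wspan.add[OF add.IH add.hyps(2)]) (use add in auto)
qed (rule wspan.zero)

lemma wspan_all: "x \<in> wspan M Q \<Longrightarrow> x \<in> wspan M (\<lambda>_. True)"
  by (erule wspan_mono) simp

lemma wspan_closed:
  assumes "x \<in> wspan M (\<lambda>_. True)" "a \<in> carrier weyl"
  shows "a \<odot> x \<in> wspan M (\<lambda>_. True)"
  using assms(2,1)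
proof (induction arbitrary: x rule: weyl_induct)
  case (scal c)
  then show ?case by (intro wspan_act[OF scal]) (auto intro: wspan_weight W_scal)
next
  case (X i)
  then show ?case by (intro wspan_act[OF X]) (auto intro: wspan_weight X_weight)
next
  case (Y i)
  then show ?case by (intro wspan_act[OF Y]) (auto intro: wspan_weight Y_weight)
next
  case (add a b)
  show ?case unfolding act_add[OF add.hyps wspan_carrier[OF add.prems]]
    by (rule wspan_add[OF add.IH[OF add.prems]])
next
  case (mult a b)
  show ?case unfolding act_comp[OF mult.hyps wspan_carrier[OF mult.prems]]
    by (rule mult.IH(1)[OF mult.IH(2)[OF mult.prems]])
qed

text \<open>A polynomial in the \<open>t\<^sub>i\<close> separates a weight from finitely many others.\<close>

lemma weight_separator:
  assumes "x \<in> wspan M (\<lambda>r. r \<noteq> q)"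
  shows "\<exists>a\<in>carrier weyl. a \<odot> x = \<zero> \<and> (\<forall>y\<in>W q. a \<odot> y = y) \<and> (\<forall>r. \<forall>y\<in>W r. a \<odot> y \<in> W r)"
  using assms
proof (induction rule: wspan.induct)
  case zero
  show ?case by (intro bexI[of _ id]) (auto simp only: weyl_intros act_id[OF W_carrier] M.zero_closed act_id)
next
  case (add x w r)
  then obtain a where a: "a \<in> carrier weyl" "a \<odot> x = \<zero>" "\<And>y. y \<in> W q \<Longrightarrow> a \<odot> y = y"
    "\<And>r y. y \<in> W r \<Longrightarrow> a \<odot> y \<in> W r"
    by blast
  from \<open>r \<noteq> q\<close> obtain i where i: "r i \<noteq> q i" by (meson ext)
  \<comment> \<open>A Lagrange factor: on weight \<open>s\<close> it acts by
    \<open>(s i - r i) / (q i - r i)\<close>, which is 0 for the new weight \<open>r\<close> and 1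
    for \<open>q\<close>.\<close>
  define b where "b = scal (inverse (q i - r i)) \<circ> (\<lambda>f. t_op i f + scal (- r i) f)"
  have bc: "b \<in> carrier weyl" unfolding b_def by (intro weyl_comp weyl_intros weyl_add t_op_weyl)
  have b: "b \<odot> y = scal ((s i - r i) * inverse (q i - r i)) \<odot> y" if y: "y \<in> W s" for s y
  proof -
    have "b \<odot> y = scal (inverse (q i - r i)) \<odot> ((\<lambda>f. t_op i f + scal (- r i) f) \<odot> y)"
      unfolding b_def by (intro act_comp weyl_intros weyl_add t_op_weyl W_carrier[OF y])
    also have "(\<lambda>f. t_op i f + scal (- r i) f) \<odot> y = scal (s i - r i) \<odot> y"
      using act_add[OF t_op_weyl weyl_intros(1) W_carrier[OF y], of i "- r i"]
        scal_plus[OF W_carrier[OF y], of "s i" "- r i"] W_t[OF y, of i] by simp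
    finally show ?thesis using y by (simp add: scal_scal W_carrier mult.commute)
  qed
  show ?case
  proof (intro bexI[of _ "b \<circ> a"] conjI allI ballI)
    have x: "x \<in> carrier M" and w: "w \<in> carrier M"
      using add by (auto intro: wspan_carrier)
    have "(b \<circ> a) \<odot> (x \<oplus> w) = b \<odot> (a \<odot> w)"
      using a bc x w by (simp only: act_comp M.a_closed smult_r_distr M.l_zero smult_closed)
    also have "\<dots> = \<zero>"
      using b[OF a(4)[OF add.hyps(2)]] W_carrier[OF a(4)[OF add.hyps(2)]] by simp
    finally show "(b \<circ> a) \<odot> (x \<oplus> w) = \<zero>" .
    show "(b \<circ> a) \<odot> y = y" if y: "y \<in> W q" for y
      using b[OF y] a i y by (simp only: act_comp[OF bc a(1) W_carrier[OF y]] a(3)) (simp add: W_carrier)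
    show "(b \<circ> a) \<odot> y \<in> W s" if y: "y \<in> W s" for y s
      using b[OF a(4)[OF y]] W_scal[OF a(4)[OF y]] by (simp only: act_comp[OF bc a(1) W_carrier[OF y]])
    show "b \<circ> a \<in> carrier weyl" using a bc by (rule_tac weyl_comp)
  qed
qed

text \<open>The separator of \<open>x\<close> both kills it and fixes it.\<close>

lemma W_inter_wspan:
  assumes "x \<in> W q" "x \<in> wspan M (\<lambda>r. r \<noteq> q)"
  shows "x = \<zero>"
  using weight_separator[OF assms(2)] assms(1) by auto

section \<open>The projection to a weight component\<close>

lemma wproj_eqI:
  assumes y: "y \<in> W q" and x: "x \<ominus> y \<in> wspan M (\<lambda>r. r \<noteq> q)" and c: "x \<in> carrier M"
  shows "wproj M q x = y"
  unfolding wproj_def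
proof (rule the_equality)
  fix y' assume y': "y' \<in> W q \<and> x \<ominus> y' \<in> wspan M (\<lambda>r. r \<noteq> q)"
  have "(x \<ominus> y') \<ominus> (x \<ominus> y) \<in> wspan M (\<lambda>r. r \<noteq> q)"
    by (rule wspan_diff) (use y' x in auto)
  moreover have "(x \<ominus> y') \<ominus> (x \<ominus> y) = y \<ominus> y'"
  proof -
    have "y \<in> carrier M" "y' \<in> carrier M" using y y' by auto
    moreover from this have "x \<oplus> \<ominus> y' \<oplus> (\<ominus> x \<oplus> y) = (x \<oplus> \<ominus> x) \<oplus> (y \<oplus> \<ominus> y')"
      using c by (simp add: M.a_ac)
    ultimately show ?thesis
      using c by (simp add: M.minus_eq M.minus_add M.r_neg)
  qed
  ultimately have "y \<ominus> y' = \<zero>"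
    using W_inter_wspan[of "y \<ominus> y'" q] W_diff[of y q y'] y y' by simp
  then show "y' = y" using y y' diff_eq_zero_iff[of y y'] by (auto intro: W_carrier)
qed (use assms in auto)

lemma wproj_same: "x \<in> W q \<Longrightarrow> wproj M q x = x"
  by (rule wproj_eqI) (auto simp: M.minus_eq M.r_neg W_carrier intro: wspan.zero)

lemma wproj_other: "x \<in> W r \<Longrightarrow> r \<noteq> q \<Longrightarrow> wproj M q x = \<zero>"
  by (rule wproj_eqI) (auto simp: M.minus_eq W_carrier intro: wspan_weight)

lemma wproj_exists:
  assumes "x \<in> wspan M (\<lambda>_. True)"
  shows "wproj M q x \<in> W q \<and> x \<ominus> wproj M q x \<in> wspan M (\<lambda>r. r \<noteq> q)"
proof -
  have "\<exists>y\<in>W q. x \<ominus> y \<in> wspan M (\<lambda>r. r \<noteq> q)"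
    using assms
  proof (induction rule: wspan.induct)
    case zero
    show ?case by (intro bexI[of _ \<zero>]) (auto simp: M.minus_eq intro: wspan.zero)
  next
    case (add x w r)
    then obtain y where y: "y \<in> W q" "x \<ominus> y \<in> wspan M (\<lambda>r. r \<noteq> q)" by blast
    have c: "x \<in> carrier M" "y \<in> carrier M" "w \<in> carrier M"
      using add y by (auto intro: wspan_carrier)
    show ?case
    proof (cases "r = q")
      case True
      have "x \<oplus> w \<ominus> (y \<oplus> w) = (x \<oplus> \<ominus> y) \<oplus> (w \<oplus> \<ominus> w)"
        using c by (simp add: M.minus_eq M.minus_add M.a_ac)
      then show ?thesis
        using True add.hyps y c by (intro bexI[of _ "y \<oplus> w"]) (auto simp: M.r_neg M.minus_eq W_add)
    next
      case False
      have "x \<oplus> w \<ominus> y = (x \<ominus> y) \<oplus> w"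
        using c by (simp add: M.minus_eq M.a_ac)
      then show ?thesis
        using y(1) wspan.add[OF y(2) add.hyps(2) False] by (intro bexI[of _ y]) simp_all
    qed
  qed
  then show ?thesis
    using wproj_eqI[of _ q x] wspan_carrier[OF assms] by auto
qed

lemmas wproj_weight = wproj_exists[THEN conjunct1]

lemma wproj_add:
  assumes "x \<in> wspan M (\<lambda>_. True)" "y \<in> wspan M (\<lambda>_. True)"
  shows "wproj M q (x \<oplus> y) = wproj M q x \<oplus> wproj M q y"
proof (rule wproj_eqI)
  let ?x = "wproj M q x" and ?y = "wproj M q y"
  have c: "x \<in> carrier M" "y \<in> carrier M" "?x \<in> carrier M" "?y \<in> carrier M"
    using assms wproj_weight by (auto intro: wspan_carrier)
  have "x \<oplus> y \<ominus> (?x \<oplus> ?y) = (x \<ominus> ?x) \<oplus> (y \<ominus> ?y)"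
    using c by (simp add: M.minus_eq M.minus_add M.a_ac)
  then show "x \<oplus> y \<ominus> (?x \<oplus> ?y) \<in> wspan M (\<lambda>r. r \<noteq> q)"
    using wproj_exists[OF assms(1), of q] wproj_exists[OF assms(2), of q] by (simp add: wspan_add)
qed (use assms wproj_weight in \<open>auto intro: W_add wspan_carrier\<close>)

lemma wproj_zero [simp]: "wproj M q \<zero> = \<zero>"
  by (rule wproj_same) simp

text \<open>Injectivity of \<open>\<sigma>\<close> is the point: components of weight other than
  \<open>q\<close> must not land in weight \<open>\<sigma> q\<close>. Generators and outgoing words
  qualify, since they translate weights by a fixed vector.\<close>

lemma wproj_equivariant:
  assumes x: "x \<in> wspan M (\<lambda>_. True)" and a: "a \<in> carrier weyl" and inj: "inj \<sigma>"
    and W: "\<And>r y. y \<in> W r \<Longrightarrow> a \<odot> y \<in> W (\<sigma> r)"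
  shows "wproj M (\<sigma> q) (a \<odot> x) = a \<odot> wproj M q x"
  using x
proof (induction rule: wspan.induct)
  case zero
  then show ?case using a by simp
next
  case (add x w r)
  have c: "x \<in> carrier M" "w \<in> carrier M" using add by (auto intro: wspan_carrier)
  have w: "wproj M (\<sigma> q) (a \<odot> w) = a \<odot> wproj M q w"
  proof (cases "r = q")
    case True
    then show ?thesis using add.hyps(2) by (simp add: wproj_same W)
  next
    case False
    then have "\<sigma> r \<noteq> \<sigma> q" using inj by (simp add: inj_eq)
    then show ?thesis
      using False wproj_other[OF add.hyps(2)] wproj_other[OF W[OF add.hyps(2)]] a by simp
  qed
  have "wproj M (\<sigma> q) (a \<odot> (x \<oplus> w)) = wproj M (\<sigma> q) (a \<odot> x) \<oplus> wproj M (\<sigma> q) (a \<odot> w)"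
    unfolding smult_r_distr[OF a c]
    by (intro wproj_add wspan_closed a add.hyps wspan_weight[OF add.hyps(2)] TrueI)
  also have "\<dots> = a \<odot> (wproj M q x \<oplus> wproj M q w)"
    unfolding add.IH w using a wproj_weight[OF add.hyps(1)] wproj_weight[OF wspan_weight[OF add.hyps(2) TrueI]]
    by (intro smult_r_distr[symmetric]) (auto intro: W_carrier)
  also have "wproj M q x \<oplus> wproj M q w = wproj M q (x \<oplus> w)"
    by (intro wproj_add[symmetric] add.hyps wspan_weight[OF add.hyps(2)] TrueI)
  finally show ?case .
qed

lemma wproj_scal:
  "x \<in> wspan M (\<lambda>_. True) \<Longrightarrow> wproj M q (scal c \<odot> x) = scal c \<odot> wproj M q x"
  using wproj_equivariant[of x "scal c" "\<lambda>q. q" q] W_scal by simp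

lemma shift_inj: "inj (\<lambda>q :: 'i \<Rightarrow> 'k. q(i := q i + c))"
  by (rule injI) (metis add_right_cancel ext fun_upd_apply)

lemma wproj_X:
  "x \<in> wspan M (\<lambda>_. True) \<Longrightarrow> wproj M (q(i := q i + 1)) (X_op i \<odot> x) = X_op i \<odot> wproj M q x"
  using wproj_equivariant[of x "X_op i" "\<lambda>q. q(i := q i + 1)" q] X_weight shift_inj by simp

lemma wproj_Y:
  "x \<in> wspan M (\<lambda>_. True) \<Longrightarrow> wproj M (q(i := q i - 1)) (Y_op i \<odot> x) = Y_op i \<odot> wproj M q x"
  using wproj_equivariant[of x "Y_op i" "\<lambda>q. q(i := q i - 1)" q] Y_weight shift_inj[of i "-1"] by simp

lemma wproj_outgoing:
  assumes "outgoing z a" "x \<in> wspan M (\<lambda>_. True)"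
  shows "wproj M (\<lambda>i. q i + of_int (z i)) (a \<odot> x) = a \<odot> wproj M q x"
proof (rule wproj_equivariant[OF assms(2) outgoing_carrier[OF assms(1)], where \<sigma> = "\<lambda>q i. q i + of_int (z i)"])
  show "inj (\<lambda>(q :: 'i \<Rightarrow> 'k) i. q i + of_int (z i))" by (rule injI) (simp add: fun_eq_iff)
qed (use outgoing_weight[OF assms(1)] in blast)

text \<open>On the given vector the projection is the action of an algebra element: the separator
  kills the remainder and fixes the component.\<close>

lemma wproj_in_submodule:
  assumes N: "submodule N weyl M" and "x \<in> N" "x \<in> wspan M (\<lambda>_. True)"
  shows "wproj M q x \<in> N"
proof -
  let ?y = "wproj M q x"
  obtain a where a: "a \<in> carrier weyl" "a \<odot> (x \<ominus> ?y) = \<zero>" "\<forall>y\<in>W q. a \<odot> y = y"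
    using weight_separator wproj_exists[OF assms(3)] by meson
  have c: "x \<in> carrier M" "?y \<in> W q" "?y \<in> carrier M"
    using assms wproj_weight by (auto intro: wspan_carrier)
  then have "a \<odot> x = ?y"
    using a smult_diff_right[of a x ?y] diff_eq_zero_iff[of "a \<odot> x" ?y] by simp
  then show ?thesis using submodule_smult[OF N a(1) assms(2)] by simp
qed

text \<open>The sum is claimed over every finite superset of the support, since adding a weight
  vector changes the support and the two summands need a common index set.\<close>

lemma finsum_wproj:
  assumes "x \<in> wspan M (\<lambda>_. True)"
  shows "finite {q. wproj M q x \<noteq> \<zero>} \<and>
    (\<forall>G. finite G \<longrightarrow> {q. wproj M q x \<noteq> \<zero>} \<subseteq> G \<longrightarrow> finsum M (\<lambda>q. wproj M q x) G = x)"
  using assms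
proof (induction rule: wspan.induct)
  case zero
  then show ?case by simp
next
  case (add x w r)
  let ?S = "{q. wproj M q x \<noteq> \<zero>}"
  note w = wspan_weight[OF add.hyps(2) TrueI]
  have c: "wproj M q x \<in> carrier M" "wproj M q w \<in> carrier M" "w \<in> carrier M" "x \<in> carrier M" for q
    using wproj_weight[OF add.hyps(1)] wproj_weight[OF w] add by (auto intro: wspan_carrier)
  have sub: "{q. wproj M q (x \<oplus> w) \<noteq> \<zero>} \<subseteq> insert r ?S"
    using wproj_add[OF add.hyps(1) w] wproj_other[OF add.hyps(2)] by auto
  then have "finite {q. wproj M q (x \<oplus> w) \<noteq> \<zero>}"
    using add.IH finite_subset by blast
  moreover have "finsum M (\<lambda>q. wproj M q (x \<oplus> w)) G = x \<oplus> w"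
    if "finite G" "{q. wproj M q (x \<oplus> w) \<noteq> \<zero>} \<subseteq> G" for G
  proof -
    let ?G = "G \<union> insert r ?S"
    have fin: "finite ?G" using that add.IH by simp
    have pw: "(\<lambda>q. wproj M q (x \<oplus> w)) = (\<lambda>q. wproj M q x \<oplus> wproj M q w)"
      using wproj_add[OF add.hyps(1) w] by auto
    have "finsum M (\<lambda>q. wproj M q (x \<oplus> w)) G = finsum M (\<lambda>q. wproj M q (x \<oplus> w)) ?G"
      using that fin c by (intro M.add.finprod_mono_neutral_cong_left) (auto simp: pw)
    also have "\<dots> = finsum M (\<lambda>q. wproj M q x) ?G \<oplus> finsum M (\<lambda>q. wproj M q w) ?G"
      unfolding pw using c by (intro M.finsum_addf) auto
    also have "finsum M (\<lambda>q. wproj M q x) ?G = x"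
      using add.IH fin by blast
    also have "finsum M (\<lambda>q. wproj M q w) ?G = finsum M (\<lambda>q. if r = q then w else \<zero>) ?G"
      using wproj_other[OF add.hyps(2)] wproj_same[OF add.hyps(2)] c by (intro M.finsum_cong') auto
    also have "\<dots> = w"
      using M.finsum_singleton[of r ?G "\<lambda>_. w"] fin c by simp
    finally show ?thesis .
  qed
  ultimately show ?case by blast
qed

lemma wproj_eq_zeroD:
  assumes "x \<in> wspan M (\<lambda>_. True)" "\<And>q. wproj M q x = \<zero>"
  shows "x = \<zero>"
  using finsum_wproj[OF assms(1)] assms(2) by (metis (mono_tags, lifting) M.finsum_empty empty_Collect_eq finite.emptyI subset_refl)

lemma finsum_wspan:
  assumes "finite F" "\<And>p. v p \<in> W p"
  shows "finsum M v F \<in> wspan M (\<lambda>q. q \<in> F)"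
  using assms(1)
proof (induction F rule: finite_induct)
  case empty
  then show ?case by (simp add: wspan.zero)
next
  case (insert q F)
  have "finsum M v F \<in> wspan M (\<lambda>p. p \<in> insert q F)"
    using insert.IH by (rule wspan_mono) simp
  moreover have "v q \<in> wspan M (\<lambda>p. p \<in> insert q F)"
    using assms(2)[of q] by (intro wspan_weight) auto
  ultimately have "v q \<oplus> finsum M v F \<in> wspan M (\<lambda>p. p \<in> insert q F)"
    by (rule wspan_add[rotated])
  moreover have "finsum M v (insert q F) = v q \<oplus> finsum M v F"
    using insert.hyps assms(2) by (intro M.finsum_insert) (auto intro: W_carrier)
  ultimately show ?case by simp
qed

lemma wproj_finsum:
  assumes fin: "finite F" and v: "\<And>p. v p \<in> W p"
  shows "wproj M q (finsum M v F) = (if q \<in> F then v q else \<zero>)"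
proof (rule wproj_eqI)
  have c: "v p \<in> carrier M" for p using v by auto
  show "finsum M v F \<in> carrier M" using c by (intro M.finsum_closed) auto
  show "(if q \<in> F then v q else \<zero>) \<in> W q" using v by simp
  have "finsum M v (F - {q}) \<in> wspan M (\<lambda>r. r \<noteq> q)"
    using finsum_wspan[of "F - {q}" v] fin v by (auto intro: wspan_mono)
  moreover have "finsum M v F \<ominus> (if q \<in> F then v q else \<zero>) = finsum M v (F - {q})"
  proof (cases "q \<in> F")
    case True
    have "finsum M v F = v q \<oplus> finsum M v (F - {q})"
      using M.finsum_insert[of "F - {q}" q v] fin c True by (simp add: insert_absorb)
    moreover have "finsum M v (F - {q}) \<in> carrier M"
      using c by (intro M.finsum_closed) auto
    ultimately show ?thesis
      using True c[of q] by (simp add: M.minus_eq M.a_ac M.r_neg2 M.r_neg1)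
  next
    case False
    moreover have "finsum M v F \<in> carrier M"
      using c by (intro M.finsum_closed) auto
    ultimately show ?thesis by (simp add: M.minus_eq)
  qed
  ultimately show "finsum M v F \<ominus> (if q \<in> F then v q else \<zero>) \<in> wspan M (\<lambda>r. r \<noteq> q)" by simp
qed

text \<open>Separation of weights provides the uniqueness of a decomposition, spanning provides its
  existence. The right-hand side is the form that admits induction over vectors.\<close>

lemma weight_module_iff: "weight_module M \<longleftrightarrow> carrier M \<subseteq> wspan M (\<lambda>_. True)"
proof
  assume w: "weight_module M"
  show "carrier M \<subseteq> wspan M (\<lambda>_. True)"
  proof
    fix x assume "x \<in> carrier M"
    then obtain v where v: "\<And>p. v p \<in> W p" "finite {p. v p \<noteq> \<zero>}" "x = finsum M v {p. v p \<noteq> \<zero>}"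
      using w unfolding weight_module_def by blast
    then show "x \<in> wspan M (\<lambda>_. True)"
      using finsum_wspan[of "{p. v p \<noteq> \<zero>}" v] by (auto intro: wspan_all)
  qed
next
  assume sub: "carrier M \<subseteq> wspan M (\<lambda>_. True)"
  have "\<exists>!v. (\<forall>p. v p \<in> W p) \<and> finite {p. v p \<noteq> \<zero>} \<and> x = finsum M v {p. v p \<noteq> \<zero>}"
    if "x \<in> carrier M" for x
  proof (rule ex1I[of _ "\<lambda>q. wproj M q x"])
    have x: "x \<in> wspan M (\<lambda>_. True)" using that sub by auto
    show "(\<forall>p. wproj M p x \<in> W p) \<and> finite {p. wproj M p x \<noteq> \<zero>} \<and>
        x = finsum M (\<lambda>q. wproj M q x) {p. wproj M p x \<noteq> \<zero>}"
      using finsum_wproj[OF x] wproj_weight[OF x] by auto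
    fix v assume v: "(\<forall>p. v p \<in> W p) \<and> finite {p. v p \<noteq> \<zero>} \<and> x = finsum M v {p. v p \<noteq> \<zero>}"
    then show "v = (\<lambda>q. wproj M q x)"
      using wproj_finsum[of "{p. v p \<noteq> \<zero>}" v] by (intro ext) auto
  qed
  then show "weight_module M"
    unfolding weight_module_def using left_module_axioms by blast
qed

end

locale weight_mod = weyl_mod M
  for M :: "('i, 'k::field_char_0, 'm) weyl_module" (structure) +
  assumes wspan_UNIV: "x \<in> carrier M \<Longrightarrow> x \<in> wspan M (\<lambda>_. True)"
begin

lemma weight_module: "weight_module M"
  using weight_module_iff wspan_UNIV by blast

lemma weight_induct [consumes 1, case_names zero add]:
  assumes "x \<in> carrier M" "Q \<zero>"
    and "\<And>x w q. x \<in> carrier M \<Longrightarrow> Q x \<Longrightarrow> w \<in> W q \<Longrightarrow> Q (x \<oplus> w)"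
  shows "Q x"
  using wspan_UNIV[OF assms(1)]
proof (induction rule: wspan.induct)
  case (add x w q)
  then show ?case using assms(3)[of x w q] wspan_carrier by blast
qed (rule assms(2))

end

lemma weight_modI: "weight_module M \<Longrightarrow> weight_mod (M :: ('i, 'k::field_char_0, 'm) weyl_module)"
proof -
  assume M: "weight_module M"
  then interpret weyl_mod M unfolding weight_module_def weyl_mod_def by blast
  show "weight_mod M"
    using M weight_module_iff by unfold_locales auto
qed

section \<open>Homomorphisms between weight modules\<close>

lemma mod_hom_weight:
  assumes "weyl_mod M" "weyl_mod N" "f \<in> mod_hom weyl M N" "x \<in> weight_space M q"
  shows "f x \<in> weight_space N q"
  using assms(4) mod_hom_closed[OF assms(3)] mod_hom_smult[OF assms(3)]
  by (auto simp: weight_space_def) (metis t_op_weyl weyl_intros(1))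

text \<open>Reduces a question about a homomorphism to one weight space; the lifting and extension
  arguments in both criteria rest on it.\<close>

lemma mod_hom_wproj:
  assumes M: "weight_mod M" and N: "weight_mod N" and f: "f \<in> mod_hom weyl M N" and x: "x \<in> carrier M"
  shows "f (wproj M q x) = wproj N q (f x)"
proof -
  interpret M: weight_mod M by (rule M)
  interpret N: weight_mod N by (rule N)
  note fW = mod_hom_weight[OF M.weyl_mod_axioms N.weyl_mod_axioms f]
  note f0 = mod_hom_zero[OF M.left_module_axioms N.left_module_axioms f]
  show ?thesis
    using x
  proof (induction rule: M.weight_induct)
    case zero
    then show ?case by (simp add: f0)
  next
    case (add x w r)
    have w: "f (wproj M q w) = wproj N q (f w)"
    proof (cases "r = q")
      case True
      then show ?thesis using add.hyps(2) fW by (simp add: M.wproj_same N.wproj_same)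
    next
      case False
      then show ?thesis
        using M.wproj_other[OF add.hyps(2)] N.wproj_other[OF fW[OF add.hyps(2)]] by (simp add: f0)
    qed
    have c: "w \<in> carrier M" using add.hyps by auto
    have "wproj M q x \<in> carrier M" "wproj M q w \<in> carrier M"
      using M.wproj_weight[OF M.wspan_UNIV] add.hyps c by blast+
    then show ?case
      using add.IH w add.hyps(1) c
      by (simp add: M.wproj_add N.wproj_add M.wspan_UNIV N.wspan_UNIV mod_hom_add[OF f] mod_hom_closed[OF f])
  qed
qed

lemma weight_mod_image:
  assumes M: "weight_mod M" and N: "weyl_mod N" and f: "f \<in> mod_hom weyl M N"
    and surj: "f ` carrier M = carrier N"
  shows "weight_mod N"
proof -
  interpret M: weight_mod M by (rule M)
  interpret N: weyl_mod N by (rule N)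
  have "f x \<in> wspan N (\<lambda>_. True)" if "x \<in> carrier M" for x
    using that
  proof (induction rule: M.weight_induct)
    case zero
    then show ?case by (simp add: mod_hom_zero[OF M.left_module_axioms N.left_module_axioms f] wspan.zero)
  next
    case (add x w q)
    then have "f x \<oplus>\<^bsub>N\<^esub> f w \<in> wspan N (\<lambda>_. True)"
      using mod_hom_weight[OF M.weyl_mod_axioms N f] by (intro wspan.add) auto
    then show ?case using add.hyps M.W_carrier by (simp add: mod_hom_add[OF f])
  qed
  then have "y \<in> wspan N (\<lambda>_. True)" if "y \<in> carrier N" for y
    using that surj by (metis imageE)
  then show ?thesis by unfold_locales
qed

section \<open>The modules \<open>P(p)\<close> and \<open>L(p)\<close>\<close>

lemma weyl0_sel [simp]:
  "S \<otimes>\<^bsub>weyl0\<^esub> T = S \<circ> T" "\<one>\<^bsub>weyl0\<^esub> = id" "\<zero>\<^bsub>weyl0\<^esub> = (\<lambda>_. 0)"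
  "S \<oplus>\<^bsub>weyl0\<^esub> T = (\<lambda>f. S f + T f)"
  by (simp_all add: weyl0_def)

lemma weyl0_carrier: "carrier weyl0 = generate_ring End_ring (range scal \<union> range t_op)"
  by (simp add: weyl0_def)

lemma weyl0_gens: "range scal \<union> range t_op \<subseteq> carrier End_ring"
  by (auto simp: linear_scal t_op_def intro!: linear_comp linear_X_op linear_Y_op)

lemma ring_weyl0: "ring weyl0"
  unfolding weyl0_def by (rule ring.generate_ring_is_ring[OF ring_End_ring weyl0_gens])

lemma weyl0_intros: "scal c \<in> carrier weyl0" "t_op i \<in> carrier weyl0"
  by (auto simp: weyl0_carrier intro: generate_ring.incl)

lemma weyl0_induct [consumes 1, case_names scal t add mult]:
  assumes "a \<in> carrier weyl0"
    and "\<And>c. Q (scal c)" "\<And>i. Q (t_op i)"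
    and add: "\<And>a b. a \<in> carrier weyl0 \<Longrightarrow> b \<in> carrier weyl0 \<Longrightarrow> Q a \<Longrightarrow> Q b \<Longrightarrow> Q (\<lambda>f. a f + b f)"
    and mult: "\<And>a b. a \<in> carrier weyl0 \<Longrightarrow> b \<in> carrier weyl0 \<Longrightarrow> Q a \<Longrightarrow> Q b \<Longrightarrow> Q (a \<circ> b)"
  shows "Q a"
  using assms(1) unfolding weyl0_carrier
proof (induction rule: generate_ring.induct)
  case one
  then show ?case using assms(2)[of 1] by (metis End_ring_sel(3) scal_simps(4))
next
  case (a_inv h)
  then have h: "h \<in> carrier weyl0" by (simp add: weyl0_carrier)
  have "Vector_Spaces.linear scal scal h"
    using ring.generate_ring_in_carrier[OF ring_End_ring weyl0_gens a_inv.hyps] by simp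
  then show ?case
    using End_ring_uminus mult[OF weyl0_intros(1) h assms(2) a_inv.IH] by metis
next
  case (eng_add h1 h2)
  then show ?case using add[of h1 h2] by (simp only: End_ring_sel weyl0_carrier)
next
  case (eng_mult h1 h2)
  then show ?case using mult[of h1 h2] by (simp only: End_ring_sel weyl0_carrier)
qed (use assms(2,3) in auto)

lemma weyl0_subset: "a \<in> carrier weyl0 \<Longrightarrow> a \<in> carrier weyl"
  by (induction rule: weyl0_induct) (simp_all only: weyl_intros t_op_weyl weyl_add weyl_comp)

lemma (in ring) minus_eqI: "c \<in> carrier R \<Longrightarrow> a \<in> carrier R \<Longrightarrow> c \<oplus> a = \<zero> \<Longrightarrow> b \<ominus> a = b \<oplus> c"
  by (simp add: minus_eq minus_equality)

lemma weyl0_t_minus: "t_op i \<ominus>\<^bsub>weyl0\<^esub> scal c = (\<lambda>f. t_op i f + scal (- c) f)"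
proof -
  have "(\<lambda>f. scal (- c) f + scal c f) = (\<lambda>_. 0)"
    by (simp add: fun_eq_iff flip: scal_add_left)
  then show ?thesis
    using ring.minus_eqI[OF ring_weyl0 weyl0_intros(1,1), of "- c" c "t_op i"]
    by (simp only: weyl0_sel)
qed

context weyl_mod
begin

text \<open>Meant for the right-hand ideal law: \<open>b\<close> acts on \<open>x\<close> by a
  scalar, so an annihilator of \<open>x\<close> stays one after multiplication by \<open>b\<close>
  on the right.\<close>

lemma weyl0_acts_by_scalar:
  assumes "a \<in> carrier weyl0" "x \<in> W q"
  shows "\<exists>c. a \<odot> x = scal c \<odot> x"
  using assms(1)
proof (induction rule: weyl0_induct)
  case (scal c)
  then show ?case by blast
next
  case (t i)
  then show ?case using W_t[OF assms(2)] by blast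
next
  case (add a b)
  then obtain c d where "a \<odot> x = scal c \<odot> x" "b \<odot> x = scal d \<odot> x" by blast
  then have "(\<lambda>f. a f + b f) \<odot> x = scal (c + d) \<odot> x"
    using act_add[OF add.hyps[THEN weyl0_subset] W_carrier[OF assms(2)]]
    by (simp only: scal_plus[OF W_carrier[OF assms(2)]])
  then show ?case by blast
next
  case (mult a b)
  then obtain c d where "a \<odot> x = scal c \<odot> x" "b \<odot> x = scal d \<odot> x" by blast
  then have "(a \<circ> b) \<odot> x = scal (d * c) \<odot> x"
    using act_comp[OF mult.hyps[THEN weyl0_subset] W_carrier[OF assms(2)]]
      scal_comm[OF weyl0_subset[OF mult.hyps(1)] W_carrier[OF assms(2)]]
    by (simp only: scal_scal[OF W_carrier[OF assms(2)]])
  then show ?case by blast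
qed

text \<open>The annihilator of \<open>x\<close> in \<open>weyl0\<close> is an ideal containing the
  generators of \<open>max_ideal p\<close>, and the generated ideal is the smallest such.\<close>

lemma max_ideal_annihilates:
  assumes x: "x \<in> W p" and a: "a \<in> max_ideal p"
  shows "a \<in> carrier weyl" "a \<odot> x = \<zero>"
proof -
  let ?I = "{a \<in> carrier weyl0. a \<odot> x = \<zero>}"
  have xc: "x \<in> carrier M" using x by auto
  interpret R0: ring weyl0 by (rule ring_weyl0)
  have "ideal ?I weyl0"
  proof (rule idealI[OF ring_weyl0])
    show "subgroup ?I (add_monoid weyl0)"
    proof (rule R0.add.subgroupI)
      have "\<zero>\<^bsub>weyl0\<^esub> \<in> ?I"
        using R0.zero_closed smult_zero_left[OF xc] by (simp only: weyl0_sel weyl_sel mem_Collect_eq)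
      then show "?I \<noteq> {}" by blast
      show "a \<oplus>\<^bsub>weyl0\<^esub> b \<in> ?I" if a: "a \<in> ?I" and b: "b \<in> ?I" for a b
      proof -
        have "(\<lambda>f. a f + b f) \<odot> x = \<zero>"
          using act_add[OF weyl0_subset weyl0_subset xc, of a b] a b by simp
        then show ?thesis using R0.a_closed[of a b] a b by (simp only: weyl0_sel mem_Collect_eq)
      qed
      show "\<ominus>\<^bsub>weyl0\<^esub> a \<in> ?I" if a: "a \<in> ?I" for a
      proof -
        have eq: "\<ominus>\<^bsub>weyl0\<^esub> a = scal (-1) \<circ> a"
        proof (rule R0.minus_equality)
          show "scal (-1) \<circ> a \<in> carrier weyl0"
            using R0.m_closed[OF weyl0_intros(1), of a "-1"] a by (simp only: weyl0_sel mem_Collect_eq)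
          show "(scal (-1) \<circ> a) \<oplus>\<^bsub>weyl0\<^esub> a = \<zero>\<^bsub>weyl0\<^esub>"
            by (simp add: scal_minus_one)
        qed (use a in auto)
        moreover have "(scal (-1) \<circ> a) \<odot> x = \<zero>"
          using act_comp[OF weyl_intros(1) weyl0_subset xc, of a "-1"] a by simp
        moreover have "\<ominus>\<^bsub>weyl0\<^esub> a \<in> carrier weyl0" using a by simp
        ultimately show ?thesis by (simp only: mem_Collect_eq)
      qed
    qed auto
    show "b \<otimes>\<^bsub>weyl0\<^esub> a \<in> ?I" if a: "a \<in> ?I" and b: "b \<in> carrier weyl0" for a b
    proof -
      have "(b \<circ> a) \<odot> x = \<zero>"
        using act_comp[OF weyl0_subset weyl0_subset xc, of b a] a b weyl0_subset[OF b] by simp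
      then show ?thesis using R0.m_closed[of b a] a b by (simp only: weyl0_sel mem_Collect_eq)
    qed
    show "a \<otimes>\<^bsub>weyl0\<^esub> b \<in> ?I" if a: "a \<in> ?I" and b: "b \<in> carrier weyl0" for a b
    proof -
      obtain c where c: "b \<odot> x = scal c \<odot> x" using weyl0_acts_by_scalar[OF b x] by blast
      have "(a \<circ> b) \<odot> x = scal c \<odot> (a \<odot> x)"
        using act_comp[OF weyl0_subset weyl0_subset xc, of a b] a b c
          scal_comm[OF weyl0_subset xc, of a c] by simp
      then have "(a \<circ> b) \<odot> x = \<zero>" using a by simp
      then show ?thesis using R0.m_closed[of a b] a b by (simp only: weyl0_sel mem_Collect_eq)
    qed
  qed
  moreover have "range (\<lambda>i. t_op i \<ominus>\<^bsub>weyl0\<^esub> scal (p i)) \<subseteq> ?I"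
  proof clarify
    fix i
    have "t_op i \<ominus>\<^bsub>weyl0\<^esub> scal (p i) \<in> carrier weyl0"
      by (intro R0.minus_closed weyl0_intros)
    moreover have "(t_op i \<ominus>\<^bsub>weyl0\<^esub> scal (p i)) \<odot> x = \<zero>"
      unfolding weyl0_t_minus act_add[OF t_op_weyl weyl_intros(1) xc] W_t[OF x]
      using scal_plus[OF xc, of "p i" "- p i"] xc by simp
    ultimately show "t_op i \<ominus>\<^bsub>weyl0\<^esub> scal (p i) \<in> carrier weyl0 \<and> (t_op i \<ominus>\<^bsub>weyl0\<^esub> scal (p i)) \<odot> x = \<zero>"
      by blast
  qed
  ultimately have "max_ideal p \<subseteq> ?I"
    unfolding max_ideal_def by (rule R0.genideal_minimal)
  then show "a \<in> carrier weyl" "a \<odot> x = \<zero>" using a weyl0_subset by auto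
qed

end

text \<open>The left ideal by which \<open>P_module p\<close> is the quotient. The set product
  contains single products only, so the additive group generated by it is taken.\<close>

definition weight_ideal :: "('i \<Rightarrow> 'k::field) \<Rightarrow> ('i, 'k) opr set" where
  "weight_ideal p = generate (add_monoid weyl) (carrier weyl <#>\<^bsub>weyl\<^esub> max_ideal p)"

lemma max_ideal_subset: "max_ideal p \<subseteq> carrier weyl"
proof -
  interpret R0: ring weyl0 by (rule ring_weyl0)
  have "range (\<lambda>i. t_op i \<ominus>\<^bsub>weyl0\<^esub> scal (p i)) \<subseteq> carrier weyl0"
    by (auto intro!: R0.minus_closed weyl0_intros)
  then have "ideal (max_ideal p) weyl0" unfolding max_ideal_def by (rule R0.genideal_ideal)
  then show ?thesis
    using weyl0_subset additive_subgroup.a_subset[OF ideal.axioms(1)] by blast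
qed

lemma weight_ideal_gens_subset: "carrier weyl <#>\<^bsub>weyl\<^esub> max_ideal p \<subseteq> carrier weyl"
proof -
  interpret ring weyl by (rule ring_weyl)
  show ?thesis
    using m_closed max_ideal_subset unfolding set_mult_def by blast
qed

lemma submodule_weight_ideal: "submodule (weight_ideal p) weyl (regular_module weyl)"
proof -
  interpret W: ring weyl by (rule ring_weyl)
  interpret R: left_module weyl "regular_module weyl" by (rule left_module_regular[OF ring_weyl])
  have sub: "subgroup (weight_ideal p) (add_monoid weyl)"
    unfolding weight_ideal_def
    by (rule W.add.generate_is_subgroup) (simp add: weight_ideal_gens_subset)
  show ?thesis
  proof (rule R.submoduleI)
    show "weight_ideal p \<subseteq> carrier (regular_module weyl)"
      using subgroup.subset[OF sub] by simp
    show "\<zero>\<^bsub>regular_module weyl\<^esub> \<in> weight_ideal p"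
      using subgroup.one_closed[OF sub] by simp
    show "x \<oplus>\<^bsub>regular_module weyl\<^esub> y \<in> weight_ideal p" if "x \<in> weight_ideal p" "y \<in> weight_ideal p" for x y
      using subgroup.m_closed[OF sub that] by simp
    have c: "x \<in> carrier weyl" if "x \<in> weight_ideal p" for x
      using subgroup.subset[OF sub] that by auto
    \<comment> \<open>Left multiplication maps a generating product to another one; from there it
      follows the group operations by distributivity.\<close>
    have gen: "a \<otimes>\<^bsub>weyl\<^esub> h \<in> carrier weyl <#>\<^bsub>weyl\<^esub> max_ideal p"
      if a: "a \<in> carrier weyl" and h: "h \<in> carrier weyl <#>\<^bsub>weyl\<^esub> max_ideal p" for a h
    proof -
      obtain b m where "b \<in> carrier weyl" "m \<in> max_ideal p" "h = b \<otimes>\<^bsub>weyl\<^esub> m"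
        using h unfolding set_mult_def by blast
      moreover from this have "a \<otimes>\<^bsub>weyl\<^esub> h = (a \<otimes>\<^bsub>weyl\<^esub> b) \<otimes>\<^bsub>weyl\<^esub> m"
        using a W.m_assoc[of a b m] max_ideal_subset[of p] by (auto simp del: weyl_sel)
      ultimately show ?thesis
        using a W.m_closed[of a b] unfolding set_mult_def by blast
    qed
    have "a \<otimes>\<^bsub>weyl\<^esub> x \<in> weight_ideal p" if "x \<in> weight_ideal p" and a: "a \<in> carrier weyl" for a x
      using that(1) unfolding weight_ideal_def
    proof (induction rule: generate.induct)
      case one
      have "a \<otimes>\<^bsub>weyl\<^esub> \<zero>\<^bsub>weyl\<^esub> = \<zero>\<^bsub>weyl\<^esub>" using a by (rule W.r_null)
      then show ?case
        using generate.one[of "add_monoid weyl"] by (simp only: monoid.simps)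
    next
      case (incl h)
      then show ?case using gen[OF a] by (intro generate.incl)
    next
      case (inv h)
      then have "h \<in> carrier weyl" using weight_ideal_gens_subset by auto
      then have "a \<otimes>\<^bsub>weyl\<^esub> (\<ominus>\<^bsub>weyl\<^esub> h) = \<ominus>\<^bsub>weyl\<^esub> (a \<otimes>\<^bsub>weyl\<^esub> h)"
        using a by (intro W.r_minus)
      then show ?case
        using generate.inv[OF gen[OF a inv], of "add_monoid weyl"] unfolding a_inv_def[symmetric] by (simp only:)
    next
      case (eng h1 h2)
      have "h1 \<in> carrier weyl" "h2 \<in> carrier weyl"
        using eng.hyps c unfolding weight_ideal_def by blast+
      then have "a \<otimes>\<^bsub>weyl\<^esub> (h1 \<oplus>\<^bsub>weyl\<^esub> h2) = a \<otimes>\<^bsub>weyl\<^esub> h1 \<oplus>\<^bsub>weyl\<^esub> a \<otimes>\<^bsub>weyl\<^esub> h2"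
        using a by (intro W.r_distr)
      then show ?case
        using generate.eng[OF eng.IH] by (simp only: monoid.simps)
    qed
    then show "a \<odot>\<^bsub>regular_module weyl\<^esub> x \<in> weight_ideal p"
      if "a \<in> carrier weyl" "x \<in> weight_ideal p" for a x
      using that by (simp only: regular_module_sel)
  qed
qed

lemma (in weyl_mod) weight_ideal_annihilates:
  assumes x: "x \<in> W p" and a: "a \<in> weight_ideal p"
  shows "a \<odot> x = \<zero>"
proof -
  have xc: "x \<in> carrier M" using x by auto
  interpret R: left_module weyl "regular_module weyl" by (rule left_module_regular[OF ring_weyl])
  have c: "a \<in> carrier weyl" if "a \<in> weight_ideal p" for a
    using R.submodule_subset[OF submodule_weight_ideal] that by auto
  have gen: "h \<in> carrier weyl \<and> h \<odot> x = \<zero>" if h: "h \<in> carrier weyl <#>\<^bsub>weyl\<^esub> max_ideal p" for h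
  proof -
    obtain b m where "b \<in> carrier weyl" "m \<in> max_ideal p" "h = b \<otimes>\<^bsub>weyl\<^esub> m"
      using h unfolding set_mult_def by blast
    then show ?thesis
      using max_ideal_annihilates[OF x, of m] xc smult_assoc1[of b m x] R.R.m_closed[of b m] by simp
  qed
  show ?thesis
    using a unfolding weight_ideal_def
  proof (induction rule: generate.induct)
    case one
    then show ?case using smult_zero_left[OF xc] by (simp only: monoid.simps)
  next
    case (incl h)
    then show ?case using gen by blast
  next
    case (inv h)
    then show ?case
      using gen[OF inv] smult_minus_left[of h x] xc unfolding a_inv_def by simp
  next
    case (eng h1 h2)
    then have "h1 \<in> carrier weyl" "h2 \<in> carrier weyl"
      using c unfolding weight_ideal_def by blast+
    then show ?case using eng.IH smult_l_distr[of h1 h2 x] xc by simp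
  qed
qed

lemma t_minus_in_weight_ideal: "(\<lambda>f. t_op i f + scal (- p i) f) \<in> weight_ideal p"
proof -
  interpret R0: ring weyl0 by (rule ring_weyl0)
  have "range (\<lambda>i. t_op i \<ominus>\<^bsub>weyl0\<^esub> scal (p i)) \<subseteq> carrier weyl0"
    by (auto intro!: R0.minus_closed weyl0_intros)
  then have "t_op i \<ominus>\<^bsub>weyl0\<^esub> scal (p i) \<in> max_ideal p"
    unfolding max_ideal_def using R0.genideal_self by blast
  then have "id \<otimes>\<^bsub>weyl\<^esub> (t_op i \<ominus>\<^bsub>weyl0\<^esub> scal (p i)) \<in> carrier weyl <#>\<^bsub>weyl\<^esub> max_ideal p"
    unfolding set_mult_def using weyl_intros(4) by blast
  then have "t_op i \<ominus>\<^bsub>weyl0\<^esub> scal (p i) \<in> carrier weyl <#>\<^bsub>weyl\<^esub> max_ideal p"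
    by (simp only: weyl_sel id_comp)
  then show ?thesis
    unfolding weight_ideal_def weyl0_t_minus by (rule generate.incl)
qed

section \<open>The generator of \<open>P(p)\<close> and its universal property\<close>

definition P_gen :: "('i \<Rightarrow> 'k::field) \<Rightarrow> ('i, 'k) opr set" where
  "P_gen p = weight_ideal p +>\<^bsub>regular_module weyl\<^esub> id"

lemma P_module_eq: "P_module p = quotient_module (regular_module weyl) (weight_ideal p)"
  by (simp add: P_module_def weight_ideal_def)

lemma weyl_mod_P: "weyl_mod (P_module (p :: 'i \<Rightarrow> 'k::field_char_0))"
  unfolding P_module_eq weyl_mod_def
  by (rule left_module_quotient[OF left_module_regular[OF ring_weyl] submodule_weight_ideal])

lemma P_gen_smult:
  assumes "a \<in> carrier weyl"
  shows "a \<odot>\<^bsub>P_module p\<^esub> P_gen p = weight_ideal p +>\<^bsub>regular_module weyl\<^esub> a"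
  using quotient_module_smult[OF left_module_regular[OF ring_weyl] submodule_weight_ideal assms, of id p]
  unfolding P_gen_def P_module_eq
  by (simp only: regular_module_sel weyl_sel comp_id weyl_intros)

lemma P_carrier: "carrier (P_module p) = (\<lambda>a. a \<odot>\<^bsub>P_module p\<^esub> P_gen p) ` carrier weyl"
  unfolding P_module_eq quotient_module_sel regular_module_sel
  by (intro image_cong refl) (simp add: P_gen_smult flip: P_module_eq)

lemma P_gen_weight:
  fixes p :: "'i \<Rightarrow> 'k::field_char_0"
  shows "P_gen (p :: 'i \<Rightarrow> 'k::field_char_0) \<in> weight_space (P_module p) p"
proof -
  interpret R: left_module weyl "regular_module weyl" by (rule left_module_regular[OF ring_weyl])
  interpret P: weyl_mod "P_module p" by (rule weyl_mod_P)
  have "t_op i \<odot>\<^bsub>P_module p\<^esub> P_gen p = scal (p i) \<odot>\<^bsub>P_module p\<^esub> P_gen p" for i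
  proof -
    have "\<ominus>\<^bsub>regular_module weyl\<^esub> scal (p i) = (scal (- p i) :: ('i, 'k) opr)"
    proof (rule R.M.minus_equality)
      show "(scal (- p i) :: ('i, 'k) opr) \<oplus>\<^bsub>regular_module weyl\<^esub> scal (p i) = \<zero>\<^bsub>regular_module weyl\<^esub>"
        by (simp add: fun_eq_iff flip: scal_add_left)
    qed simp_all
    then have "t_op i \<ominus>\<^bsub>regular_module weyl\<^esub> scal (p i) = (\<lambda>f. t_op i f + scal (- p i) f)"
      by (simp add: R.M.minus_eq)
    then have "t_op i \<ominus>\<^bsub>regular_module weyl\<^esub> scal (p i) \<in> weight_ideal p"
      by (simp only: t_minus_in_weight_ideal)
    then show ?thesis
      by (simp only: P_gen_smult t_op_weyl weyl_intros R.coset_eq_iff[OF submodule_weight_ideal] regular_module_sel)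
  qed
  moreover have "P_gen p \<in> carrier (P_module p)"
    unfolding P_gen_def P_module_eq by (simp del: id_apply)
  ultimately show ?thesis by (simp add: weight_space_def)
qed

text \<open>Evaluation at \<open>x\<close> kills the left ideal and so passes to the quotient. The
  homomorphism is described on all multiples of the generator, which exhaust
  \<open>P_module p\<close>.\<close>

lemma P_universal:
  fixes M :: "('i, 'k::field_char_0, 'm) weyl_module"
  assumes M: "weyl_mod M" and x: "x \<in> weight_space M p"
  shows "\<exists>f\<in>mod_hom weyl (P_module p) M. \<forall>a\<in>carrier weyl. f (a \<odot>\<^bsub>P_module p\<^esub> P_gen p) = a \<odot>\<^bsub>M\<^esub> x"
proof -
  interpret M: weyl_mod M by (rule M)
  have "\<exists>g\<in>mod_hom weyl (quotient_module (regular_module weyl) (weight_ideal p)) M.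
    \<forall>a\<in>carrier (regular_module weyl). g (weight_ideal p +>\<^bsub>regular_module weyl\<^esub> a) = a \<odot>\<^bsub>M\<^esub> x"
    by (rule mod_hom_factor[OF left_module_regular[OF ring_weyl] submodule_weight_ideal M.left_module_axioms
      orbit_mod_hom[OF M.left_module_axioms M.W_carrier[OF x]] M.weight_ideal_annihilates[OF x]])
  then show ?thesis
    unfolding P_module_eq[symmetric] regular_module_sel by (simp add: P_gen_smult)
qed

lemma weight_mod_P: "weight_mod (P_module (p :: 'i \<Rightarrow> 'k::field_char_0))"
proof -
  interpret P: weyl_mod "P_module p" by (rule weyl_mod_P)
  have "a \<odot>\<^bsub>P_module p\<^esub> P_gen p \<in> wspan (P_module p) (\<lambda>_. True)" if "a \<in> carrier weyl" for a
    using P.wspan_closed[OF P.wspan_weight[OF P_gen_weight TrueI] that] .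
  then show ?thesis
    by unfold_locales (auto simp: P_carrier)
qed

context weight_mod
begin

text \<open>A weight vector generates a module with at most one-dimensional weight spaces.\<close>

definition line :: "('i \<Rightarrow> 'k) \<Rightarrow> 'm \<Rightarrow> ('i \<Rightarrow> 'k) \<Rightarrow> 'm set" where
  "line q v r = insert \<zero> {scal c \<odot> (b \<odot> v) | c b z. outgoing z b \<and> r = (\<lambda>i. q i + of_int (z i))}"

lemma line_carrier: "v \<in> carrier M \<Longrightarrow> x \<in> line q v r \<Longrightarrow> x \<in> carrier M"
  by (auto simp: line_def outgoing_carrier)

lemma line_unique:
  assumes "outgoing z b" "outgoing z' b'" "(\<lambda>i. q i + of_int (z i)) = (\<lambda>i. (q i :: 'k) + of_int (z' i))"
  shows "b = b'"
proof -
  have "z = z'" using assms(3) by (auto simp: fun_eq_iff)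
  then show ?thesis using outgoing_unique assms(1,2) by blast
qed

lemma line_add:
  assumes v: "v \<in> carrier M" and x: "x \<in> line q v r" and y: "y \<in> line q v r"
  shows "x \<oplus> y \<in> line q v r"
proof (cases "x = \<zero> \<or> y = \<zero>")
  case True
  then show ?thesis using assms line_carrier[OF v] by auto
next
  case False
  then obtain c b z d b' z' where *: "outgoing z b" "r = (\<lambda>i. q i + of_int (z i))" "x = scal c \<odot> (b \<odot> v)"
    "outgoing z' b'" "r = (\<lambda>i. q i + of_int (z' i))" "y = scal d \<odot> (b' \<odot> v)"
    using x y by (auto simp: line_def)
  then have "b' = b" using line_unique by metis
  then have "x \<oplus> y = scal (c + d) \<odot> (b \<odot> v)"
    using * scal_plus[OF smult_closed[OF outgoing_carrier[OF *(1)] v]] by simp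
  then show ?thesis using * by (auto simp: line_def)
qed

lemma line_scal: "v \<in> carrier M \<Longrightarrow> x \<in> line q v r \<Longrightarrow> scal c \<odot> x \<in> line q v r"
  unfolding line_def using outgoing_carrier scal_scal by (auto; blast)

text \<open>Away from the start the word is prolonged. Towards the start the exchange lemma exposes
  a \<open>Y_op i\<close> in front, and the resulting product \<open>X_op i \<circ> Y_op i\<close>
  acts on a weight vector by a scalar.\<close>

lemma line_X:
  assumes v: "v \<in> W q" and x: "x \<in> line q v r"
  shows "X_op i \<odot> x \<in> line q v (r(i := r i + 1))"
proof (cases "x = \<zero>")
  case True
  then show ?thesis by (simp add: line_def)
next
  case False
  then obtain c b z where *: "outgoing z b" "r = (\<lambda>i. q i + of_int (z i))" "x = scal c \<odot> (b \<odot> v)"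
    using x by (auto simp: line_def)
  have vc: "v \<in> carrier M" and bc: "b \<in> carrier weyl" using v * outgoing_carrier by auto
  have r: "r(i := r i + 1) = (\<lambda>j. q j + of_int ((z(i := z i + 1)) j))"
    using *(2) by auto
  show ?thesis
  proof (cases "z i \<ge> 0")
    case True
    have "X_op i \<odot> x = scal c \<odot> ((X_op i \<circ> b) \<odot> v)"
      using *(3) vc bc by (simp add: scal_comm[of "X_op i"] act_comp del: comp_apply)
    then show ?thesis
      using outgoing.X[OF *(1) True] r unfolding line_def by blast
  next
    case False
    then obtain b' where b': "outgoing (z(i := z i + 1)) b'" "b = Y_op i \<circ> b'"
      using outgoing_exchange_Y[OF *(1), of i] by auto
    have b'c: "b' \<in> carrier weyl" using b' outgoing_carrier by blast
    have "X_op i \<odot> (b \<odot> v) = X_op i \<odot> (Y_op i \<odot> (b' \<odot> v))"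
      unfolding b'(2) by (simp only: act_comp[OF weyl_intros(3) b'c vc])
    also have "\<dots> = scal (q i + of_int (z i + 1)) \<odot> (b' \<odot> v)"
      using X_Y_weight[OF outgoing_weight[OF b'(1) v], of i] by simp
    finally have "X_op i \<odot> x = scal (c * (q i + of_int (z i + 1))) \<odot> (b' \<odot> v)"
      using *(3) vc bc b'c by (simp add: scal_comm[of "X_op i"] scal_scal)
    then show ?thesis
      using b'(1) r unfolding line_def by blast
  qed
qed

lemma line_Y:
  assumes v: "v \<in> W q" and x: "x \<in> line q v r"
  shows "Y_op i \<odot> x \<in> line q v (r(i := r i - 1))"
proof (cases "x = \<zero>")
  case True
  then show ?thesis by (simp add: line_def)
next
  case False
  then obtain c b z where *: "outgoing z b" "r = (\<lambda>i. q i + of_int (z i))" "x = scal c \<odot> (b \<odot> v)"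
    using x by (auto simp: line_def)
  have vc: "v \<in> carrier M" and bc: "b \<in> carrier weyl" using v * outgoing_carrier by auto
  have r: "r(i := r i - 1) = (\<lambda>j. q j + of_int ((z(i := z i - 1)) j))"
    using *(2) by auto
  show ?thesis
  proof (cases "z i \<le> 0")
    case True
    have "Y_op i \<odot> x = scal c \<odot> ((Y_op i \<circ> b) \<odot> v)"
      using *(3) vc bc by (simp add: scal_comm[of "Y_op i"] act_comp del: comp_apply)
    then show ?thesis
      using outgoing.Y[OF *(1) True] r unfolding line_def by blast
  next
    case False
    then obtain b' where b': "outgoing (z(i := z i - 1)) b'" "b = X_op i \<circ> b'"
      using outgoing_exchange_X[OF *(1), of i] by auto
    have b'c: "b' \<in> carrier weyl" using b' outgoing_carrier by blast
    have "Y_op i \<odot> (b \<odot> v) = Y_op i \<odot> (X_op i \<odot> (b' \<odot> v))"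
      unfolding b'(2) by (simp only: act_comp[OF weyl_intros(2) b'c vc])
    also have "\<dots> = scal (q i + of_int (z i)) \<odot> (b' \<odot> v)"
      using Y_X_weight[OF outgoing_weight[OF b'(1) v], of i] by simp
    finally have "Y_op i \<odot> x = scal (c * (q i + of_int (z i))) \<odot> (b' \<odot> v)"
      using *(3) vc bc b'c by (simp add: scal_comm[of "Y_op i"] scal_scal)
    then show ?thesis
      using b'(1) r unfolding line_def by blast
  qed
qed

lemma wproj_line:
  assumes a: "a \<in> carrier weyl" and v: "v \<in> W q"
  shows "wproj M r (a \<odot> v) \<in> line q v r"
proof -
  have vc: "v \<in> carrier M" using v by auto
  \<comment> \<open>Generalised from \<open>v\<close> to any vector with all components in the
    lines, so that composites yield to induction on \<open>a\<close>.\<close>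
  have "x \<in> carrier M \<Longrightarrow> (\<And>r. wproj M r x \<in> line q v r) \<Longrightarrow> wproj M r (a \<odot> x) \<in> line q v r" for x r
    using a
  proof (induction arbitrary: x r rule: weyl_induct)
    case (scal c)
    then show ?case by (simp add: wproj_scal wspan_UNIV line_scal[OF vc])
  next
    case (X i)
    have r: "(r(i := r i - 1))(i := (r(i := r i - 1)) i + 1) = r" by simp
    show ?case
      using line_X[OF v X(2)[of "r(i := r i - 1)"], of i]
        wproj_X[OF wspan_UNIV[OF X(1)], of "r(i := r i - 1)" i]
      unfolding r by (simp only:)
  next
    case (Y i)
    have r: "(r(i := r i + 1))(i := (r(i := r i + 1)) i - 1) = r" by simp
    show ?case
      using line_Y[OF v Y(2)[of "r(i := r i + 1)"], of i]
        wproj_Y[OF wspan_UNIV[OF Y(1)], of "r(i := r i + 1)" i]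
      unfolding r by (simp only:)
  next
    case (add a b)
    show ?case
      unfolding act_add[OF add.hyps add.prems(1)]
        wproj_add[OF wspan_UNIV[OF smult_closed[OF add.hyps(1) add.prems(1)]]
          wspan_UNIV[OF smult_closed[OF add.hyps(2) add.prems(1)]]]
      by (rule line_add[OF vc add.IH(1)[OF add.prems] add.IH(2)[OF add.prems]])
  next
    case (mult a b)
    show ?case
      unfolding act_comp[OF mult.hyps mult.prems(1)]
      by (rule mult.IH(1)[OF smult_closed[OF mult.hyps(2) mult.prems(1)] mult.IH(2)[OF mult.prems]])
  qed
  moreover have "wproj M r v \<in> line q v r" for r
  proof (cases "r = q")
    case True
    have "scal 1 \<odot> (id \<odot> v) \<in> line q v q"
      unfolding line_def using outgoing.id by fastforce
    then show ?thesis using True v vc by (simp only: wproj_same act_id scal_one)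
  next
    case False
    then show ?thesis using v by (simp add: wproj_other line_def)
  qed
  ultimately show ?thesis using vc by blast
qed

lemma line_outgoing:
  assumes "outgoing z b" "x \<in> line q v (\<lambda>i. q i + of_int (z i))" "v \<in> carrier M"
  shows "\<exists>c. x = scal c \<odot> (b \<odot> v)"
proof (cases "x = \<zero>")
  case True
  then have "x = scal 0 \<odot> (b \<odot> v)" using assms(3) outgoing_carrier[OF assms(1)] by simp
  then show ?thesis by blast
next
  case False
  then obtain c b' z' where "outgoing z' b'" "(\<lambda>i. q i + of_int (z i)) = (\<lambda>i. q i + of_int (z' i))"
    "x = scal c \<odot> (b' \<odot> v)"
    using assms(2) by (auto simp: line_def)
  then show ?thesis using line_unique[OF assms(1)] by blast
qed

end

section \<open>The unique maximal submodule and \<open>L(p)\<close>\<close>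

definition weight_radical :: "('i, 'k::field, 'm) weyl_module \<Rightarrow> ('i \<Rightarrow> 'k) \<Rightarrow> 'm set" where
  "weight_radical M p = {x \<in> carrier M. \<forall>a\<in>carrier weyl. wproj M p (a \<odot>\<^bsub>M\<^esub> x) = \<zero>\<^bsub>M\<^esub>}"

context weight_mod
begin

lemma wproj_carrier: "x \<in> carrier M \<Longrightarrow> wproj M q x \<in> carrier M"
  using wproj_weight[OF wspan_UNIV] by auto

lemma wproj_idem: "x \<in> carrier M \<Longrightarrow> wproj M q (wproj M q x) = wproj M q x"
  by (rule wproj_same) (rule wproj_weight[OF wspan_UNIV])

lemma submodule_radical: "submodule (weight_radical M p) weyl M"
proof (rule submoduleI)
  show "\<zero> \<in> weight_radical M p" by (simp add: weight_radical_def)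
  show "x \<oplus> y \<in> weight_radical M p" if "x \<in> weight_radical M p" "y \<in> weight_radical M p" for x y
    using that by (simp add: weight_radical_def smult_r_distr wproj_add wspan_UNIV)
  show "a \<odot> x \<in> weight_radical M p" if a: "a \<in> carrier weyl" and x: "x \<in> weight_radical M p" for a x
  proof -
    have "wproj M p (b \<odot> (a \<odot> x)) = \<zero>" if b: "b \<in> carrier weyl" for b
      using x weyl_comp[OF b a] act_comp[OF b a, of x] unfolding weight_radical_def by auto
    then show ?thesis using a x by (simp add: weight_radical_def)
  qed
qed (auto simp: weight_radical_def)

text \<open>A submodule with a vector whose orbit has a component at \<open>p\<close> contains that
  component, hence by one-dimensionality the generator \<open>v\<close>, hence everything. So every
  proper submodule lies in the radical, which is itself proper.\<close>

lemma maximal_submodule_iff_radical: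
  assumes v: "v \<in> W p" "v \<noteq> \<zero>" and cyc: "carrier M \<subseteq> (\<lambda>a. a \<odot> v) ` carrier weyl"
    and one_dim: "\<And>x. x \<in> W p \<Longrightarrow> \<exists>c. x = scal c \<odot> v"
  shows "maximal_submodule N weyl M \<longleftrightarrow> N = weight_radical M p"
proof -
  let ?R = "weight_radical M p"
  have sub: "N \<subseteq> ?R" if N: "submodule N weyl M" "N \<noteq> carrier M" for N
  proof (rule ccontr)
    assume "\<not> N \<subseteq> ?R"
    then obtain x a where x: "x \<in> N" and a: "a \<in> carrier weyl" "wproj M p (a \<odot> x) \<noteq> \<zero>"
      using submodule_subset[OF N(1)] unfolding weight_radical_def by blast
    have ax: "a \<odot> x \<in> N" "a \<odot> x \<in> carrier M"
      using submodule_smult[OF N(1) a(1) x] submodule_memD[OF N(1)] by auto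
    have in_N: "wproj M p (a \<odot> x) \<in> N"
      by (rule wproj_in_submodule[OF N(1) ax(1) wspan_UNIV[OF ax(2)]])
    obtain c where c: "wproj M p (a \<odot> x) = scal c \<odot> v"
      using one_dim wproj_weight[OF wspan_UNIV[OF ax(2)]] by blast
    then have "c \<noteq> 0" using a(2) v by (auto simp: W_carrier)
    then have "v = scal (inverse c) \<odot> wproj M p (a \<odot> x)"
      using c v by (simp add: scal_scal W_carrier)
    then have "v \<in> N" using submodule_smult[OF N(1) weyl_intros(1) in_N] by simp
    then have "carrier M \<subseteq> N" using cyc submodule_smult[OF N(1)] by blast
    then show False using N submodule_subset[OF N(1)] by blast
  qed
  have "wproj M p (id \<odot> v) \<noteq> \<zero>" using v by (simp add: wproj_same W_carrier del: id_apply)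
  then have "v \<notin> ?R" unfolding weight_radical_def using weyl_intros(4) by blast
  then have proper: "?R \<noteq> carrier M" using v by auto
  show ?thesis
    using sub submodule_radical proper unfolding maximal_submodule_def by blast
qed

end

text \<open>The only outgoing word of shift 0 is the identity, so the line at weight
  \<open>p\<close> is spanned by the generator.\<close>

lemma P_one_dim:
  assumes "x \<in> weight_space (P_module (p :: 'i \<Rightarrow> 'k::field_char_0)) p"
  shows "\<exists>c. x = scal c \<odot>\<^bsub>P_module p\<^esub> P_gen p"
proof -
  interpret P: weight_mod "P_module p" by (rule weight_mod_P)
  have g: "P_gen p \<in> carrier (P_module p)" using P_gen_weight by (rule P.W_carrier)
  obtain a where "a \<in> carrier weyl" "x = a \<odot>\<^bsub>P_module p\<^esub> P_gen p"
    using P.W_carrier[OF assms] unfolding P_carrier by blast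
  then have "wproj (P_module p) p x \<in> P.line p (P_gen p) p"
    using P.wproj_line[OF _ P_gen_weight] by blast
  then have "x \<in> P.line p (P_gen p) (\<lambda>i. p i + of_int 0)"
    by (simp add: P.wproj_same[OF assms])
  from P.line_outgoing[OF outgoing.id this g] show ?thesis
    by (simp only: P.act_id[OF g])
qed

text \<open>The hypothesis is discharged in the two criteria by a homomorphism that sends the
  generator to a nonzero vector.\<close>

lemma maximal_submodule_P:
  fixes p :: "'i \<Rightarrow> 'k::field_char_0"
  assumes "P_gen p \<noteq> \<zero>\<^bsub>P_module p\<^esub>"
  shows "maximal_submodule N weyl (P_module p) \<longleftrightarrow> N = weight_radical (P_module p) p"
proof -
  interpret P: weight_mod "P_module p" by (rule weight_mod_P)
  show ?thesis
    by (rule P.maximal_submodule_iff_radical[OF P_gen_weight assms]) (auto simp: P_carrier P_one_dim)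
qed

lemma L_module_eq:
  fixes p :: "'i \<Rightarrow> 'k::field_char_0"
  assumes "P_gen p \<noteq> \<zero>\<^bsub>P_module p\<^esub>"
  shows "L_module p = quotient_module (P_module p) (weight_radical (P_module p) p)"
  unfolding L_module_def by (simp add: maximal_submodule_P[OF assms])

lemma weight_mod_L:
  fixes p :: "'i \<Rightarrow> 'k::field_char_0"
  assumes "P_gen p \<noteq> \<zero>\<^bsub>P_module p\<^esub>"
  shows "weight_mod (L_module p)"
proof -
  interpret P: weight_mod "P_module p" by (rule weight_mod_P)
  note R = P.submodule_radical[of p]
  have "weyl_mod (quotient_module (P_module p) (weight_radical (P_module p) p))"
    unfolding weyl_mod_def by (rule left_module_quotient[OF P.left_module_axioms R])
  then show ?thesis
    unfolding L_module_eq[OF assms]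
    by (rule weight_mod_image[OF weight_mod_P _ coset_mod_hom[OF P.left_module_axioms R]]) simp
qed

section \<open>Criteria for projective covers and injective envelopes\<close>

text \<open>The map from \<open>P_module p\<close> given by \<open>e\<close> is bijective: onto
  because \<open>e\<close> generates, one-to-one because every weight component is a multiple of an
  outgoing word applied to the generator. Its inverse makes the universal property of
  \<open>P_module p\<close> available for \<open>E\<close>.\<close>

lemma projective_cover_criterion:
  fixes E :: "('i, 'k::field_char_0, 'e) weyl_module"
  assumes E: "weight_mod E" and e: "e \<in> weight_space E p"
    and cyc: "carrier E \<subseteq> (\<lambda>a. a \<odot>\<^bsub>E\<^esub> e) ` carrier weyl"
    and nonzero: "\<And>z a. outgoing z a \<Longrightarrow> a \<odot>\<^bsub>E\<^esub> e \<noteq> \<zero>\<^bsub>E\<^esub>"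
  shows "projective_cover TYPE('m) TYPE('n) E (L_module p)"
proof -
  interpret E: weight_mod E by (rule E)
  interpret P: weight_mod "P_module p" by (rule weight_mod_P)
  note g = P_gen_weight[of p]
  note gc = P.W_carrier[OF g]
  obtain \<phi> where \<phi>: "\<phi> \<in> mod_hom weyl (P_module p) E"
    and \<phi>_act: "\<And>a. a \<in> carrier weyl \<Longrightarrow> \<phi> (a \<odot>\<^bsub>P_module p\<^esub> P_gen p) = a \<odot>\<^bsub>E\<^esub> e"
    using P_universal[OF E.weyl_mod_axioms e] by blast
  note \<phi>0 = mod_hom_zero[OF P.left_module_axioms E.left_module_axioms \<phi>]
  have ker: "x = \<zero>\<^bsub>P_module p\<^esub>" if x: "x \<in> carrier (P_module p)" "\<phi> x = \<zero>\<^bsub>E\<^esub>" for x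
  proof (rule P.wproj_eq_zeroD[OF P.wspan_UNIV[OF x(1)]])
    fix r
    have \<phi>r: "\<phi> (wproj (P_module p) r x) = \<zero>\<^bsub>E\<^esub>"
      using mod_hom_wproj[OF P.weight_mod_axioms E \<phi> x(1), of r] x(2) by simp
    obtain a where "a \<in> carrier weyl" "x = a \<odot>\<^bsub>P_module p\<^esub> P_gen p"
      using x(1) unfolding P_carrier by blast
    then have "wproj (P_module p) r x \<in> P.line p (P_gen p) r"
      using P.wproj_line[OF _ g] by blast
    then consider "wproj (P_module p) r x = \<zero>\<^bsub>P_module p\<^esub>" | c b z where "outgoing z b"
      "wproj (P_module p) r x = scal c \<odot>\<^bsub>P_module p\<^esub> (b \<odot>\<^bsub>P_module p\<^esub> P_gen p)"
      unfolding P.line_def by blast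
    then show "wproj (P_module p) r x = \<zero>\<^bsub>P_module p\<^esub>"
    proof cases
      case (2 c b z)
      have b: "b \<in> carrier weyl" using 2(1) by (rule outgoing_carrier)
      have "scal c \<odot>\<^bsub>E\<^esub> (b \<odot>\<^bsub>E\<^esub> e) = \<zero>\<^bsub>E\<^esub>"
        using \<phi>r mod_hom_smult[OF \<phi> weyl_intros(1) P.smult_closed[OF b gc]] \<phi>_act[OF b] 2(2) by simp
      then have "c = 0"
        using nonzero[OF 2(1)] E.scal_cancel[OF E.smult_closed[OF b E.W_carrier[OF e]]] by blast
      then show ?thesis using 2(2) b gc by simp
    qed
  qed
  have bij: "bij_betw \<phi> (carrier (P_module p)) (carrier E)"
  proof (rule bij_betw_imageI)
    show "inj_on \<phi> (carrier (P_module p))"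
    proof (rule inj_onI)
      fix x y assume *: "x \<in> carrier (P_module p)" "y \<in> carrier (P_module p)" "\<phi> x = \<phi> y"
      then have "\<phi> (x \<ominus>\<^bsub>P_module p\<^esub> y) = \<zero>\<^bsub>E\<^esub>"
        using mod_hom_diff[OF P.left_module_axioms E.left_module_axioms \<phi>] mod_hom_closed[OF \<phi>]
        by (simp add: E.diff_eq_zero_iff)
      then show "x = y" using ker[of "x \<ominus>\<^bsub>P_module p\<^esub> y"] * by (simp add: P.diff_eq_zero_iff)
    qed
    show "\<phi> ` carrier (P_module p) = carrier E"
    proof
      show "\<phi> ` carrier (P_module p) \<subseteq> carrier E" using mod_hom_closed[OF \<phi>] by blast
      show "carrier E \<subseteq> \<phi> ` carrier (P_module p)"
        using cyc \<phi>_act unfolding P_carrier image_image by auto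
    qed
  qed
  define \<psi> where "\<psi> = inv_into (carrier (P_module p)) \<phi>"
  have \<psi>: "\<psi> \<in> mod_hom weyl E (P_module p)"
    unfolding \<psi>_def by (rule mod_hom_inv_into[OF P.left_module_axioms \<phi> bij])
  have \<psi>_act: "\<psi> (a \<odot>\<^bsub>E\<^esub> e) = a \<odot>\<^bsub>P_module p\<^esub> P_gen p" if "a \<in> carrier weyl" for a
    unfolding \<psi>_def \<phi>_act[OF that, symmetric]
    by (rule bij_betw_inv_into_left[OF bij P.smult_closed[OF that gc]])
  have \<phi>\<psi>: "\<phi> (\<psi> y) = y" if "y \<in> carrier E" for y
    unfolding \<psi>_def by (rule bij_betw_inv_into_right[OF bij that])
  have \<psi>_img: "\<psi> ` carrier E = carrier (P_module p)"
    unfolding \<psi>_def by (rule bij_betw_imp_surj_on[OF bij_betw_inv_into[OF bij]])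
  have "id \<odot>\<^bsub>E\<^esub> e \<noteq> \<zero>\<^bsub>E\<^esub>" using nonzero[OF outgoing.id] .
  then have g0: "P_gen p \<noteq> \<zero>\<^bsub>P_module p\<^esub>"
    using \<phi>_act[OF weyl_intros(4)] P.act_id[OF gc] \<phi>0 by metis
  interpret L: weight_mod "L_module p" by (rule weight_mod_L[OF g0])
  let ?R = "weight_radical (P_module p) p"
  note R = P.submodule_radical[of p]
  define \<pi> where "\<pi> = (\<lambda>x. ?R +>\<^bsub>P_module p\<^esub> x)"
  have \<pi>: "\<pi> \<in> mod_hom weyl (P_module p) (L_module p)"
    unfolding \<pi>_def L_module_eq[OF g0] by (rule coset_mod_hom[OF P.left_module_axioms R])
  have \<pi>0: "x \<in> ?R" if "\<pi> x = \<zero>\<^bsub>L_module p\<^esub>" "x \<in> carrier (P_module p)" for x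
    using that P.coset_mem_iff[OF R that(2), of x] unfolding \<pi>_def L_module_eq[OF g0] by simp
  have proj: "projective_object TYPE('m) TYPE('n) E"
    unfolding projective_object_def
  proof (intro conjI allI impI)
    show "weight_module E" by (rule E.weight_module)
    fix M :: "('i, 'k, 'm) weyl_module" and N :: "('i, 'k, 'n) weyl_module" and f h
    assume *: "weight_module M \<and> weight_module N \<and> f \<in> mod_hom weyl M N \<and> f ` carrier M = carrier N \<and>
      h \<in> mod_hom weyl E N"
    interpret M: weight_mod M using * by (intro weight_modI) blast
    interpret N: weight_mod N using * by (intro weight_modI) blast
    have f: "f \<in> mod_hom weyl M N" and h: "h \<in> mod_hom weyl E N" using * by auto
    have he: "h e \<in> weight_space N p"
      by (rule mod_hom_weight[OF E.weyl_mod_axioms N.weyl_mod_axioms h e])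
    then obtain x where x: "x \<in> carrier M" "f x = h e" using * by (metis N.W_carrier imageE)
    \<comment> \<open>Surjectivity of \<open>f\<close> passes to weight spaces: an arbitrary
      preimage of \<open>h e\<close> is replaced by its component of weight
      \<open>p\<close>.\<close>
    define y where "y = wproj M p x"
    have y: "y \<in> weight_space M p" unfolding y_def by (rule M.wproj_weight[OF M.wspan_UNIV[OF x(1)]])
    have fy: "f y = h e"
      unfolding y_def mod_hom_wproj[OF M.weight_mod_axioms N.weight_mod_axioms f x(1)] x(2)
      by (rule N.wproj_same[OF he])
    obtain \<chi> where \<chi>: "\<chi> \<in> mod_hom weyl (P_module p) M"
      "\<And>a. a \<in> carrier weyl \<Longrightarrow> \<chi> (a \<odot>\<^bsub>P_module p\<^esub> P_gen p) = a \<odot>\<^bsub>M\<^esub> y"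
      using P_universal[OF M.weyl_mod_axioms y] by blast
    show "\<exists>k\<in>mod_hom weyl E M. \<forall>x\<in>carrier E. f (k x) = h x"
    proof (intro bexI[of _ "\<chi> \<circ> \<psi>"] ballI)
      show "\<chi> \<circ> \<psi> \<in> mod_hom weyl E M" by (rule mod_hom_comp[OF \<psi> \<chi>(1)])
      fix w assume "w \<in> carrier E"
      then obtain a where a: "a \<in> carrier weyl" "w = a \<odot>\<^bsub>E\<^esub> e" using cyc by blast
      have "f ((\<chi> \<circ> \<psi>) w) = f (a \<odot>\<^bsub>M\<^esub> y)" using a \<chi>(2) \<psi>_act by simp
      also have "\<dots> = h w"
        using a fy mod_hom_smult[OF f a(1) M.W_carrier[OF y]] mod_hom_smult[OF h a(1) E.W_carrier[OF e]] by simp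
      finally show "f ((\<chi> \<circ> \<psi>) w) = h w" .
    qed
  qed
  have "N = carrier E" if N: "submodule N weyl E"
    and sum: "N <+>\<^bsub>E\<^esub> a_kernel E (L_module p) (\<pi> \<circ> \<psi>) = carrier E" for N
  proof -
    \<comment> \<open>In a decomposition of the generator into \<open>n\<close> from
      \<open>N\<close> and \<open>k\<close> from the kernel, the component of \<open>k\<close> at
      \<open>p\<close> vanishes. So the component of \<open>n\<close>, which stays in
      \<open>N\<close>, is \<open>e\<close> itself.\<close>
    have "e \<in> N <+>\<^bsub>E\<^esub> a_kernel E (L_module p) (\<pi> \<circ> \<psi>)" unfolding sum using e by (rule E.W_carrier)
    then obtain n k where nk: "n \<in> N" "k \<in> carrier E" "\<pi> (\<psi> k) = \<zero>\<^bsub>L_module p\<^esub>" "e = n \<oplus>\<^bsub>E\<^esub> k"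
      unfolding set_add_def' a_kernel_def' by auto
    have nc: "n \<in> carrier E" using E.submodule_memD[OF N nk(1)] .
    have \<psi>k: "\<psi> k \<in> carrier (P_module p)" using mod_hom_closed[OF \<psi> nk(2)] .
    have "wproj (P_module p) p (id \<odot>\<^bsub>P_module p\<^esub> \<psi> k) = \<zero>\<^bsub>P_module p\<^esub>"
      using \<pi>0[OF nk(3) \<psi>k] weyl_intros(4) unfolding weight_radical_def by blast
    then have "\<phi> (wproj (P_module p) p (\<psi> k)) = \<zero>\<^bsub>E\<^esub>" using \<phi>0 P.act_id[OF \<psi>k] by metis
    then have "wproj E p k = \<zero>\<^bsub>E\<^esub>"
      using mod_hom_wproj[OF P.weight_mod_axioms E \<phi> \<psi>k, of p] \<phi>\<psi>[OF nk(2)] by simp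
    then have "wproj E p e = wproj E p n"
      using nk nc E.wproj_add[OF E.wspan_UNIV E.wspan_UNIV, of n k p] E.wproj_carrier[OF nc] by simp
    then have "e \<in> N"
      using E.wproj_same[OF e] E.wproj_in_submodule[OF N nk(1) E.wspan_UNIV[OF nc], of p] by simp
    then show ?thesis using cyc E.submodule_smult[OF N] E.submodule_subset[OF N] by blast
  qed
  moreover have "(\<pi> \<circ> \<psi>) ` carrier E = carrier (L_module p)"
    unfolding image_comp[symmetric] \<psi>_img \<pi>_def L_module_eq[OF g0] by simp
  ultimately show ?thesis
    unfolding projective_cover_def
    using L.weight_module proj mod_hom_comp[OF \<psi> \<pi>] by blast
qed

text \<open>A linear functional extends along an injective homomorphism: lift everything to the free
  vector space on the underlying set of \<open>N\<close>, where the library provides complements.\<close>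

lemma extend_functional:
  fixes M :: "('i, 'k::field_char_0, 'm) weyl_module" and N :: "('i, 'k, 'n) weyl_module"
  assumes M: "weyl_mod M" and N: "weyl_mod N" and f: "f \<in> mod_hom weyl M N" and inj: "inj_on f (carrier M)"
    and \<gamma>_add: "\<And>x y. x \<in> carrier M \<Longrightarrow> y \<in> carrier M \<Longrightarrow> \<gamma> (x \<oplus>\<^bsub>M\<^esub> y) = \<gamma> x + \<gamma> y"
    and \<gamma>_scal: "\<And>c x. x \<in> carrier M \<Longrightarrow> \<gamma> (scal c \<odot>\<^bsub>M\<^esub> x) = c * \<gamma> x"
  shows "\<exists>\<mu> :: 'n \<Rightarrow> 'k. (\<forall>x\<in>carrier N. \<forall>y\<in>carrier N. \<mu> (x \<oplus>\<^bsub>N\<^esub> y) = \<mu> x + \<mu> y) \<and>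
    (\<forall>c. \<forall>x\<in>carrier N. \<mu> (scal c \<odot>\<^bsub>N\<^esub> x) = c * \<mu> x) \<and> (\<forall>x\<in>carrier M. \<mu> (f x) = \<gamma> x)"
proof -
  interpret M: weyl_mod M by (rule M)
  interpret N: weyl_mod N by (rule N)
  interpret V: vector_space "scal :: 'k \<Rightarrow> ('n \<Rightarrow>\<^sub>0 'k) \<Rightarrow> _" by (rule vector_space_scal)
  interpret VV: vector_space_pair "scal :: 'k \<Rightarrow> ('n \<Rightarrow>\<^sub>0 'k) \<Rightarrow> _" "scal :: 'k \<Rightarrow> ('n \<Rightarrow>\<^sub>0 'k) \<Rightarrow> _" ..
  \<comment> \<open>Evaluation of formal linear combinations of elements of \<open>N\<close>; its
    kernel consists of the linear relations that hold in \<open>N\<close>.\<close>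
  define ev where "ev = (\<lambda>u :: 'n \<Rightarrow>\<^sub>0 'k. finsum N (\<lambda>x. scal (lookup u x) \<odot>\<^bsub>N\<^esub> x) (keys u))"
  have ev: "ev u = finsum N (\<lambda>x. scal (lookup u x) \<odot>\<^bsub>N\<^esub> x) A"
    if "finite A" "keys u \<subseteq> A" "A \<subseteq> carrier N" for A u
    unfolding ev_def using that
    by (intro N.M.add.finprod_mono_neutral_cong_left) (auto dest!: lookup_notin_keys)
  have ev_closed: "ev u \<in> carrier N" if "keys u \<subseteq> carrier N" for u
    unfolding ev_def using that by (intro N.M.finsum_closed) auto
  have ev_add: "ev (u + v) = ev u \<oplus>\<^bsub>N\<^esub> ev v"
    if "keys u \<subseteq> carrier N" "keys v \<subseteq> carrier N" for u v
  proof -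
    let ?A = "keys u \<union> keys v"
    have "ev (u + v) = finsum N (\<lambda>x. scal (lookup u x) \<odot>\<^bsub>N\<^esub> x \<oplus>\<^bsub>N\<^esub>
        scal (lookup v x) \<odot>\<^bsub>N\<^esub> x) ?A"
      using that keys_add[of u v] by (subst ev[of ?A]) (auto simp: lookup_add N.scal_plus intro!: N.M.finsum_cong')
    also have "\<dots> = ev u \<oplus>\<^bsub>N\<^esub> ev v"
      using that by (subst N.M.finsum_addf) (auto simp: ev[of ?A])
    finally show ?thesis .
  qed
  have ev_single: "ev (single x c) = scal c \<odot>\<^bsub>N\<^esub> x" if "x \<in> carrier N" for x c
    using that by (subst ev[of "{x}"]) (auto simp: N.M.finsum_insert)
  have keys_scal: "keys (scal c u) \<subseteq> keys u" for c and u :: "'n \<Rightarrow>\<^sub>0 'k"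
    by (metis in_keys_iff lookup_scal mult_zero_right subsetI)
  have ev_scal: "ev (scal c u) = scal c \<odot>\<^bsub>N\<^esub> ev u" if "keys u \<subseteq> carrier N" for c u
  proof -
    have "scal c \<odot>\<^bsub>N\<^esub> finsum N (\<lambda>x. scal (lookup u x) \<odot>\<^bsub>N\<^esub> x) A =
        finsum N (\<lambda>x. scal (c * lookup u x) \<odot>\<^bsub>N\<^esub> x) A" if "finite A" "A \<subseteq> carrier N" for A
      using that
    proof (induction A rule: finite_induct)
      case (insert x A)
      then show ?case
        by (simp add: N.M.finsum_insert N.smult_r_distr N.scal_scal N.M.finsum_closed Pi_iff subset_iff)
    qed simp
    then show ?thesis
      using that keys_scal[of c u] by (simp add: ev[of "keys u"])
  qed
  \<comment> \<open>\<open>U\<close> is the preimage of the image of \<open>M\<close>, and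
    \<open>\<nu>\<close> is \<open>\<gamma>\<close> pulled back to it. In particular
    \<open>U\<close> contains the kernel of evaluation, on which \<open>\<nu>\<close> is 0.\<close>
  define U where "U = {u :: 'n \<Rightarrow>\<^sub>0 'k. keys u \<subseteq> carrier N \<and> ev u \<in> f ` carrier M}"
  define \<nu> where "\<nu> = (\<lambda>u. \<gamma> (inv_into (carrier M) f (ev u)))"
  have \<nu>: "\<nu> u = \<gamma> x" if "x \<in> carrier M" "ev u = f x" for u x
    unfolding \<nu>_def that(2) by (simp only: inv_into_f_f[OF inj that(1)])
  have U_add: "u + v \<in> U \<and> \<nu> (u + v) = \<nu> u + \<nu> v" if uv: "u \<in> U" "v \<in> U" for u v
  proof -
    obtain x y where xy: "x \<in> carrier M" "ev u = f x" "y \<in> carrier M" "ev v = f y"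
      using uv unfolding U_def by blast
    have "ev (u + v) = f (x \<oplus>\<^bsub>M\<^esub> y)"
      using uv xy ev_add[of u v] mod_hom_add[OF f] unfolding U_def by simp
    moreover have "keys (u + v) \<subseteq> carrier N"
      using uv keys_add[of u v] unfolding U_def by blast
    ultimately show ?thesis
      using xy \<nu>[of "x \<oplus>\<^bsub>M\<^esub> y" "u + v"] \<nu>[OF xy(1,2)] \<nu>[OF xy(3,4)] \<gamma>_add unfolding U_def by auto
  qed
  have U_scal: "scal c u \<in> U \<and> \<nu> (scal c u) = c * \<nu> u" if u: "u \<in> U" for c u
  proof -
    obtain x where x: "x \<in> carrier M" "ev u = f x" using u unfolding U_def by blast
    have "ev (scal c u) = f (scal c \<odot>\<^bsub>M\<^esub> x)"
      using u x ev_scal[of u c] mod_hom_smult[OF f] unfolding U_def by simp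
    moreover have "keys (scal c u) \<subseteq> carrier N"
      using u keys_scal[of c u] unfolding U_def by blast
    ultimately show ?thesis
      using x \<nu>[of "scal c \<odot>\<^bsub>M\<^esub> x" "scal c u"] \<nu>[OF x] \<gamma>_scal unfolding U_def by auto
  qed
  have f0: "f \<zero>\<^bsub>M\<^esub> = \<zero>\<^bsub>N\<^esub>" by (rule mod_hom_zero[OF M.left_module_axioms N.left_module_axioms f])
  have null: "u \<in> U \<and> \<nu> u = 0" if "keys u \<subseteq> carrier N" "ev u = \<zero>\<^bsub>N\<^esub>" for u
  proof -
    have "\<gamma> \<zero>\<^bsub>M\<^esub> = 0" using \<gamma>_add[of "\<zero>\<^bsub>M\<^esub>" "\<zero>\<^bsub>M\<^esub>"] by simp
    then show ?thesis
      using that f0 \<nu>[of "\<zero>\<^bsub>M\<^esub>" u] unfolding U_def by (auto intro!: image_eqI[of _ f "\<zero>\<^bsub>M\<^esub>"])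
  qed
  have "V.subspace U"
    unfolding V.subspace_def using U_add U_scal null[of 0] by (auto simp: ev_def)
  \<comment> \<open>\<open>g\<close> is a linear projection of the free space onto \<open>U\<close>,
    so composing \<open>\<nu>\<close> with \<open>g\<close> extends \<open>\<nu>\<close> to
    everything.\<close>
  then obtain g where g: "range g \<subseteq> U" "Vector_Spaces.linear scal scal g" "\<And>u. u \<in> U \<Longrightarrow> g u = u"
    using VV.linear_exists_left_inverse_on[of "\<lambda>u. u" U] linear_scal[of 1] by (auto simp: id_def)
  have g_add: "g (u + v) = g u + g v" and g_scal: "g (scal c u) = scal c (g u)" for u v c
    using g(2) by (auto simp: linear_scal_iff)
  define \<mu> where "\<mu> = (\<lambda>x. \<nu> (g (single x 1)))"
  have gU: "g u \<in> U" for u using g(1) by blast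
  have \<mu>_lin: "\<nu> (g (u + v)) = \<nu> (g u) + \<nu> (g v)" "\<nu> (g (scal c u)) = c * \<nu> (g u)" for u v c
    unfolding g_add g_scal using U_add U_scal gU by auto
  have \<mu>_null: "\<nu> (g u) = 0" if "keys u \<subseteq> carrier N" "ev u = \<zero>\<^bsub>N\<^esub>" for u
    using null[OF that] g(3) by simp
  have "\<mu> (x \<oplus>\<^bsub>N\<^esub> y) = \<mu> x + \<mu> y" if xy: "x \<in> carrier N" "y \<in> carrier N" for x y
  proof -
    let ?s = "\<lambda>x. single x (1::'k)"
    \<comment> \<open>The formal relation that expresses additivity; it evaluates to 0, so the
      extended functional vanishes on it.\<close>
    define u where "u = ?s (x \<oplus>\<^bsub>N\<^esub> y) + scal (-1) (?s x + ?s y)"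
    have k: "keys (?s x + ?s y) \<subseteq> carrier N"
      using xy keys_add[of "?s x" "?s y"] by auto
    have k2: "keys (scal (-1) (?s x + ?s y)) \<subseteq> carrier N"
      using k keys_scal by blast
    have ku: "keys u \<subseteq> carrier N"
      using xy k2 keys_add[of "?s (x \<oplus>\<^bsub>N\<^esub> y)" "scal (-1) (?s x + ?s y)"] unfolding u_def by auto
    have ks: "keys (?s (x \<oplus>\<^bsub>N\<^esub> y)) \<subseteq> carrier N" using xy by simp
    have "ev u = ev (?s (x \<oplus>\<^bsub>N\<^esub> y)) \<oplus>\<^bsub>N\<^esub> scal (-1) \<odot>\<^bsub>N\<^esub> ev (?s x + ?s y)"
      unfolding u_def ev_add[OF ks k2] ev_scal[OF k] ..
    also have "ev (?s x + ?s y) = x \<oplus>\<^bsub>N\<^esub> y" using xy by (subst ev_add) (auto simp: ev_single)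
    finally have "ev u = (x \<oplus>\<^bsub>N\<^esub> y) \<oplus>\<^bsub>N\<^esub> scal (-1) \<odot>\<^bsub>N\<^esub> (x \<oplus>\<^bsub>N\<^esub> y)"
      using xy by (simp add: ev_single)
    then have "ev u = \<zero>\<^bsub>N\<^esub>" using xy by (simp add: N.scal_uminus N.M.r_neg)
    with ku have "\<nu> (g u) = 0" by (rule \<mu>_null)
    then show ?thesis unfolding u_def \<mu>_lin \<mu>_def by (simp add: algebra_simps)
  qed
  moreover have "\<mu> (scal c \<odot>\<^bsub>N\<^esub> x) = c * \<mu> x" if x: "x \<in> carrier N" for c x
  proof -
    let ?s = "\<lambda>x. single x (1::'k)"
    define u where "u = ?s (scal c \<odot>\<^bsub>N\<^esub> x) + single x (- c)"
    have "keys u \<subseteq> carrier N"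
      using x keys_add[of "?s (scal c \<odot>\<^bsub>N\<^esub> x)" "single x (- c)"] unfolding u_def
      by (auto split: if_splits)
    moreover have "ev u = \<zero>\<^bsub>N\<^esub>"
      unfolding u_def using x by (subst ev_add) (auto simp: ev_single N.scal_uminus N.M.r_neg)
    ultimately have "\<nu> (g u) = 0" by (rule \<mu>_null)
    moreover have "single x (- c) = scal (- c) (?s x)" by simp
    ultimately show ?thesis unfolding u_def \<mu>_def by (simp only: \<mu>_lin) (simp add: algebra_simps)
  qed
  moreover have "\<mu> (f x) = \<gamma> x" if x: "x \<in> carrier M" for x
  proof -
    have fx: "f x \<in> carrier N" using mod_hom_closed[OF f x] .
    have ev': "ev (single (f x) 1) = f x" using ev_single[OF fx, of 1] fx by simp
    then have "single (f x) 1 \<in> U" using fx x unfolding U_def by auto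
    then show ?thesis unfolding \<mu>_def using g(3) \<nu>[OF x ev'] by simp
  qed
  ultimately show ?thesis by blast
qed


text \<open>\<open>E\<close> is coinduced: a homomorphism to \<open>E\<close> amounts to a linear functional on the weight space
  for the weight \<open>p\<close>.\<close>

lemma coinduced_hom_exists:
  fixes E :: "('i, 'k::field_char_0, 'e) weyl_module" and N :: "('i, 'k, 'n) weyl_module"
  assumes E: "weight_mod E" and N: "weight_mod N" and e: "e \<in> weight_space E p"
    and faithful: "\<And>w. w \<in> carrier E \<Longrightarrow> \<forall>a\<in>carrier weyl. wproj E p (a \<odot>\<^bsub>E\<^esub> w) = \<zero>\<^bsub>E\<^esub> \<Longrightarrow> w = \<zero>\<^bsub>E\<^esub>"
    and reach: "\<And>r z b. outgoing z b \<Longrightarrow> (\<lambda>i. r i + of_int (z i)) = p \<Longrightarrow> \<exists>w\<in>weight_space E r. b \<odot>\<^bsub>E\<^esub> w = e"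
    and \<mu>_add: "\<And>x y. x \<in> carrier N \<Longrightarrow> y \<in> carrier N \<Longrightarrow> \<mu> (x \<oplus>\<^bsub>N\<^esub> y) = \<mu> x + \<mu> y"
    and \<mu>_scal: "\<And>c x. x \<in> carrier N \<Longrightarrow> \<mu> (scal c \<odot>\<^bsub>N\<^esub> x) = c * \<mu> x"
  shows "\<exists>h\<in>mod_hom weyl N E. \<forall>x\<in>carrier N. \<forall>w\<in>carrier E.
    (\<forall>a\<in>carrier weyl. wproj E p (a \<odot>\<^bsub>E\<^esub> w) = scal (\<mu> (wproj N p (a \<odot>\<^bsub>N\<^esub> x))) \<odot>\<^bsub>E\<^esub> e) \<longrightarrow> h x = w"
proof -
  interpret E: weight_mod E by (rule E)
  interpret N: weight_mod N by (rule N)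
  have ec: "e \<in> carrier E" using e by auto
  \<comment> \<open>\<open>R x w\<close> prescribes the image \<open>w\<close> of \<open>x\<close>
    through the components at \<open>p\<close> of its whole orbit; \<open>faithful\<close> makes
    \<open>w\<close> unique.\<close>
  define R where "R = (\<lambda>x w. w \<in> carrier E \<and>
    (\<forall>a\<in>carrier weyl. wproj E p (a \<odot>\<^bsub>E\<^esub> w) = scal (\<mu> (wproj N p (a \<odot>\<^bsub>N\<^esub> x))) \<odot>\<^bsub>E\<^esub> e))"
  have \<mu>0: "\<mu> \<zero>\<^bsub>N\<^esub> = 0" using \<mu>_add[of "\<zero>\<^bsub>N\<^esub>" "\<zero>\<^bsub>N\<^esub>"] by simp
  have unique: "w = w'" if "R x w" "R x w'" for x w w'
  proof -
    have c: "w \<in> carrier E" "w' \<in> carrier E" using that by (auto simp: R_def)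
    have "wproj E p (a \<odot>\<^bsub>E\<^esub> (w \<ominus>\<^bsub>E\<^esub> w')) = \<zero>\<^bsub>E\<^esub>" if a: "a \<in> carrier weyl" for a
    proof -
      have "a \<odot>\<^bsub>E\<^esub> w = a \<odot>\<^bsub>E\<^esub> (w \<ominus>\<^bsub>E\<^esub> w') \<oplus>\<^bsub>E\<^esub> a \<odot>\<^bsub>E\<^esub> w'"
      proof -
        have "(w \<ominus>\<^bsub>E\<^esub> w') \<oplus>\<^bsub>E\<^esub> w' = w"
          using c by (simp add: E.M.minus_eq E.M.a_assoc E.M.l_neg)
        then show ?thesis using E.smult_r_distr[of a "w \<ominus>\<^bsub>E\<^esub> w'" w'] a c by simp
      qed
      then have "wproj E p (a \<odot>\<^bsub>E\<^esub> w) = wproj E p (a \<odot>\<^bsub>E\<^esub> (w \<ominus>\<^bsub>E\<^esub> w')) \<oplus>\<^bsub>E\<^esub> wproj E p (a \<odot>\<^bsub>E\<^esub> w')"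
        using a c by (simp add: E.wproj_add E.wspan_UNIV)
      moreover have "wproj E p (a \<odot>\<^bsub>E\<^esub> w) = wproj E p (a \<odot>\<^bsub>E\<^esub> w')"
        using \<open>R x w\<close> \<open>R x w'\<close> a by (simp add: R_def)
      ultimately show ?thesis
        using a c E.wproj_carrier[of "a \<odot>\<^bsub>E\<^esub> w'" p] E.wproj_carrier[of "a \<odot>\<^bsub>E\<^esub> (w \<ominus>\<^bsub>E\<^esub> w')" p]
        by simp
    qed
    then have "w \<ominus>\<^bsub>E\<^esub> w' = \<zero>\<^bsub>E\<^esub>" using c by (intro faithful) auto
    then show ?thesis using c E.diff_eq_zero_iff by blast
  qed
  have R_add: "R (x \<oplus>\<^bsub>N\<^esub> y) (w \<oplus>\<^bsub>E\<^esub> w')"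
    if x: "x \<in> carrier N" and y: "y \<in> carrier N" and "R x w" "R y w'" for x y w w'
    using that ec
    by (simp add: R_def E.smult_r_distr N.smult_r_distr E.wproj_add N.wproj_add E.wspan_UNIV
        N.wspan_UNIV N.wproj_carrier \<mu>_add E.scal_plus)
  have exists: "\<exists>w. R x w" if x: "x \<in> carrier N" for x
    using x
  proof (induction rule: N.weight_induct)
    case zero
    then show ?case by (intro exI[of _ "\<zero>\<^bsub>E\<^esub>"]) (simp add: R_def \<mu>0 ec)
  next
    case (add x n r)
    \<comment> \<open>\<open>P_module r\<close> maps to \<open>N\<close> by the vector
      \<open>n\<close> and later to \<open>E\<close> by \<open>w\<close>. The scalar that links
      \<open>a\<close> to the outgoing word \<open>b\<close> is found here and is therefore the same
      in both modules.\<close>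
    interpret P: weight_mod "P_module r" by (rule weight_mod_P)
    note g = P_gen_weight[of r]
    note gc = P.W_carrier[OF g]
    have nc: "n \<in> carrier N" using add.hyps(2) by auto
    obtain \<chi> where \<chi>: "\<chi> \<in> mod_hom weyl (P_module r) N"
      "\<And>a. a \<in> carrier weyl \<Longrightarrow> \<chi> (a \<odot>\<^bsub>P_module r\<^esub> P_gen r) = a \<odot>\<^bsub>N\<^esub> n"
      using P_universal[OF N.weyl_mod_axioms add.hyps(2)] by blast
    have N_proj: "wproj N p (a \<odot>\<^bsub>N\<^esub> n) = \<chi> (wproj (P_module r) p (a \<odot>\<^bsub>P_module r\<^esub> P_gen r))"
      if "a \<in> carrier weyl" for a
      using mod_hom_wproj[OF P.weight_mod_axioms N \<chi>(1) P.smult_closed[OF that gc]] \<chi>(2)[OF that] by simp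
    have "\<exists>w. R n w"
    proof (cases "\<exists>z (b :: ('i, 'k) opr). outgoing z b \<and> (\<lambda>i. r i + of_int (z i)) = p")
      case True
      then obtain z and b :: "('i, 'k) opr" where z: "outgoing z b" "(\<lambda>i. r i + of_int (z i)) = p" by blast
      have b: "b \<in> carrier weyl" using z(1) by (rule outgoing_carrier)
      obtain w where w: "w \<in> weight_space E r" "b \<odot>\<^bsub>E\<^esub> w = e" using reach[OF z] by blast
      obtain \<omega> where \<omega>: "\<omega> \<in> mod_hom weyl (P_module r) E"
        "\<And>a. a \<in> carrier weyl \<Longrightarrow> \<omega> (a \<odot>\<^bsub>P_module r\<^esub> P_gen r) = a \<odot>\<^bsub>E\<^esub> w"
        using P_universal[OF E.weyl_mod_axioms w(1)] by blast
      \<comment> \<open>The image of \<open>n\<close> is sought as a multiple of \<open>w\<close>.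
        Since \<open>b\<close> sends \<open>w\<close> to \<open>e\<close>, testing with
        \<open>b\<close> forces this factor.\<close>
      let ?d = "\<mu> (b \<odot>\<^bsub>N\<^esub> n)"
      have "wproj E p (a \<odot>\<^bsub>E\<^esub> (scal ?d \<odot>\<^bsub>E\<^esub> w)) = scal (\<mu> (wproj N p (a \<odot>\<^bsub>N\<^esub> n))) \<odot>\<^bsub>E\<^esub> e"
        if a: "a \<in> carrier weyl" for a
      proof -
        have "wproj (P_module r) p (a \<odot>\<^bsub>P_module r\<^esub> P_gen r) \<in> P.line r (P_gen r) (\<lambda>i. r i + of_int (z i))"
          unfolding z(2) by (rule P.wproj_line[OF a g])
        then obtain c where c: "wproj (P_module r) p (a \<odot>\<^bsub>P_module r\<^esub> P_gen r) =
            scal c \<odot>\<^bsub>P_module r\<^esub> (b \<odot>\<^bsub>P_module r\<^esub> P_gen r)"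
          using P.line_outgoing[OF z(1) _ gc] by blast
        have bg: "b \<odot>\<^bsub>P_module r\<^esub> P_gen r \<in> carrier (P_module r)" using b gc by (rule P.smult_closed)
        have "wproj N p (a \<odot>\<^bsub>N\<^esub> n) = scal c \<odot>\<^bsub>N\<^esub> (b \<odot>\<^bsub>N\<^esub> n)"
          using N_proj[OF a] c mod_hom_smult[OF \<chi>(1) weyl_intros(1) bg] \<chi>(2)[OF b] by simp
        then have \<mu>: "\<mu> (wproj N p (a \<odot>\<^bsub>N\<^esub> n)) = c * ?d"
          using \<mu>_scal[OF N.smult_closed[OF b nc]] by simp
        have "wproj E p (a \<odot>\<^bsub>E\<^esub> w) = \<omega> (wproj (P_module r) p (a \<odot>\<^bsub>P_module r\<^esub> P_gen r))"
          using mod_hom_wproj[OF P.weight_mod_axioms E \<omega>(1) P.smult_closed[OF a gc]] \<omega>(2)[OF a] by simp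
        also have "\<dots> = scal c \<odot>\<^bsub>E\<^esub> e"
          using c mod_hom_smult[OF \<omega>(1) weyl_intros(1) bg] \<omega>(2)[OF b] w(2) by simp
        finally have "scal ?d \<odot>\<^bsub>E\<^esub> wproj E p (a \<odot>\<^bsub>E\<^esub> w) = scal (c * ?d) \<odot>\<^bsub>E\<^esub> e"
          using ec by (simp add: E.scal_scal mult.commute)
        then show ?thesis
          unfolding \<mu> E.scal_comm[OF a E.W_carrier[OF w(1)]]
          by (simp only: E.wproj_scal[OF E.wspan_UNIV[OF E.smult_closed[OF a E.W_carrier[OF w(1)]]]])
      qed
      then have "R n (scal ?d \<odot>\<^bsub>E\<^esub> w)"
        unfolding R_def using E.W_carrier[OF w(1)] by simp
      then show ?thesis by blast
    next
      case False
      \<comment> \<open>Without an outgoing word from \<open>r\<close> to \<open>p\<close> the orbit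
        of \<open>n\<close> has no component at \<open>p\<close>, so 0 is the right image.\<close>
      have "wproj N p (a \<odot>\<^bsub>N\<^esub> n) = \<zero>\<^bsub>N\<^esub>" if a: "a \<in> carrier weyl" for a
      proof -
        have "wproj (P_module r) p (a \<odot>\<^bsub>P_module r\<^esub> P_gen r) = \<zero>\<^bsub>P_module r\<^esub>"
          using P.wproj_line[OF a g, of p] False unfolding P.line_def by blast
        then show ?thesis
          using N_proj[OF a] mod_hom_zero[OF P.left_module_axioms N.left_module_axioms \<chi>(1)] by simp
      qed
      then show ?thesis by (intro exI[of _ "\<zero>\<^bsub>E\<^esub>"]) (simp add: R_def \<mu>0 ec)
    qed
    then show ?case using add.IH R_add[OF add.hyps(1) nc] by blast
  qed
  define h where "h = (\<lambda>x. THE w. R x w)"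
  have h: "R x (h x)" if "x \<in> carrier N" for x
    unfolding h_def using exists[OF that] unique by (metis theI)
  have h_eq: "h x = w" if "x \<in> carrier N" "R x w" for x w
    using unique[OF h[OF that(1)] that(2)] .
  have "h \<in> mod_hom weyl N E"
  proof (rule mod_homI)
    show "h x \<in> carrier E" if "x \<in> carrier N" for x
      using h[OF that] by (simp add: R_def)
    show "h (x \<oplus>\<^bsub>N\<^esub> y) = h x \<oplus>\<^bsub>E\<^esub> h y" if "x \<in> carrier N" "y \<in> carrier N" for x y
      using that h R_add by (intro h_eq) auto
    show "h (a \<odot>\<^bsub>N\<^esub> x) = a \<odot>\<^bsub>E\<^esub> h x" if a: "a \<in> carrier weyl" and x: "x \<in> carrier N" for a x
    proof (rule h_eq)
      have hx: "h x \<in> carrier E" using h[OF x] by (simp add: R_def)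
      have "wproj E p (b \<odot>\<^bsub>E\<^esub> (a \<odot>\<^bsub>E\<^esub> h x)) = scal (\<mu> (wproj N p (b \<odot>\<^bsub>N\<^esub> (a \<odot>\<^bsub>N\<^esub> x)))) \<odot>\<^bsub>E\<^esub> e"
        if b: "b \<in> carrier weyl" for b
        unfolding E.act_comp[OF b a hx, symmetric] N.act_comp[OF b a x, symmetric]
        using h[OF x] weyl_comp[OF b a] unfolding R_def by blast
      then show "R (a \<odot>\<^bsub>N\<^esub> x) (a \<odot>\<^bsub>E\<^esub> h x)" using a hx by (simp add: R_def)
    qed (use a x in simp)
  qed
  then show ?thesis using h_eq unfolding R_def by blast
qed

text \<open>By \<open>faithful\<close>, the kernel of the map from \<open>P_module p\<close> given
  by \<open>e\<close> is the radical, so \<open>L_module p\<close> embeds. A nonzero submodule has a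
  nonzero component at \<open>p\<close>, which is a multiple of \<open>e\<close> and lies in the
  image. Injectivity combines the extension of functionals with coinduction.\<close>

lemma injective_envelope_criterion:
  fixes E :: "('i, 'k::field_char_0, 'e) weyl_module"
  assumes E: "weight_mod E" and e: "e \<in> weight_space E p" "e \<noteq> \<zero>\<^bsub>E\<^esub>"
    and one_dim: "\<And>x. x \<in> weight_space E p \<Longrightarrow> \<exists>c. x = scal c \<odot>\<^bsub>E\<^esub> e"
    and faithful: "\<And>w. w \<in> carrier E \<Longrightarrow> \<forall>a\<in>carrier weyl. wproj E p (a \<odot>\<^bsub>E\<^esub> w) = \<zero>\<^bsub>E\<^esub> \<Longrightarrow> w = \<zero>\<^bsub>E\<^esub>"
    and reach: "\<And>r z b. outgoing z b \<Longrightarrow> (\<lambda>i. r i + of_int (z i)) = p \<Longrightarrow> \<exists>w\<in>weight_space E r. b \<odot>\<^bsub>E\<^esub> w = e"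
  shows "injective_envelope TYPE('m) TYPE('n) E (L_module p)"
proof -
  interpret E: weight_mod E by (rule E)
  interpret P: weight_mod "P_module p" by (rule weight_mod_P)
  note g = P_gen_weight[of p]
  note gc = P.W_carrier[OF g]
  have ec: "e \<in> carrier E" using e by auto
  obtain \<phi> where \<phi>: "\<phi> \<in> mod_hom weyl (P_module p) E"
    and \<phi>_act: "\<And>a. a \<in> carrier weyl \<Longrightarrow> \<phi> (a \<odot>\<^bsub>P_module p\<^esub> P_gen p) = a \<odot>\<^bsub>E\<^esub> e"
    using P_universal[OF E.weyl_mod_axioms e(1)] by blast
  note \<phi>0 = mod_hom_zero[OF P.left_module_axioms E.left_module_axioms \<phi>]
  have \<phi>g: "\<phi> (P_gen p) = e"
    using \<phi>_act[OF weyl_intros(4)] by (simp only: P.act_id[OF gc] E.act_id[OF ec])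
  then have g0: "P_gen p \<noteq> \<zero>\<^bsub>P_module p\<^esub>" using \<phi>0 e(2) by metis
  interpret L: weight_mod "L_module p" by (rule weight_mod_L[OF g0])
  let ?R = "weight_radical (P_module p) p"
  note R = P.submodule_radical[of p]
  have scal_cancel: "c = d" if "scal c \<odot>\<^bsub>E\<^esub> e = scal d \<odot>\<^bsub>E\<^esub> e" for c d
    using that ec e(2) E.scal_diff[OF ec, of c d] E.scal_cancel[OF ec, of "c - d"] by (auto simp: E.diff_eq_zero_iff)
  have proj_zero: "wproj (P_module p) p x = \<zero>\<^bsub>P_module p\<^esub> \<longleftrightarrow> wproj E p (\<phi> x) = \<zero>\<^bsub>E\<^esub>"
    if x: "x \<in> carrier (P_module p)" for x
  proof -
    obtain c where c: "wproj (P_module p) p x = scal c \<odot>\<^bsub>P_module p\<^esub> P_gen p"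
      using P_one_dim P.wproj_weight[OF P.wspan_UNIV[OF x]] by blast
    then have "wproj E p (\<phi> x) = scal c \<odot>\<^bsub>E\<^esub> e"
      using mod_hom_wproj[OF P.weight_mod_axioms E \<phi> x, of p] mod_hom_smult[OF \<phi> weyl_intros(1) gc] \<phi>g by simp
    then show ?thesis
      using c gc ec g0 e(2) P.scal_cancel[OF gc, of c] E.scal_cancel[OF ec, of c] by (cases "c = 0") auto
  qed
  have ker: "x \<in> ?R \<longleftrightarrow> \<phi> x = \<zero>\<^bsub>E\<^esub>" if x: "x \<in> carrier (P_module p)" for x
  proof -
    have "x \<in> ?R \<longleftrightarrow> (\<forall>a\<in>carrier weyl. wproj E p (a \<odot>\<^bsub>E\<^esub> \<phi> x) = \<zero>\<^bsub>E\<^esub>)"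
      using x proj_zero[OF P.smult_closed[OF _ x]] mod_hom_smult[OF \<phi> _ x] unfolding weight_radical_def by auto
    also have "\<dots> \<longleftrightarrow> \<phi> x = \<zero>\<^bsub>E\<^esub>"
      using faithful[OF mod_hom_closed[OF \<phi> x]] by auto
    finally show ?thesis .
  qed
  obtain f where f: "f \<in> mod_hom weyl (L_module p) E"
    and f_coset: "\<And>x. x \<in> carrier (P_module p) \<Longrightarrow> f (?R +>\<^bsub>P_module p\<^esub> x) = \<phi> x"
    using mod_hom_factor[OF P.left_module_axioms R E.left_module_axioms \<phi>] ker P.submodule_memD[OF R]
    unfolding L_module_eq[OF g0] by blast
  have L_carrier: "carrier (L_module p) = (\<lambda>x. ?R +>\<^bsub>P_module p\<^esub> x) ` carrier (P_module p)"
    unfolding L_module_eq[OF g0] by simp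
  have inj: "inj_on f (carrier (L_module p))"
  proof (rule inj_onI)
    fix X Y assume "X \<in> carrier (L_module p)" "Y \<in> carrier (L_module p)" "f X = f Y"
    then obtain x y where xy: "x \<in> carrier (P_module p)" "y \<in> carrier (P_module p)" "\<phi> x = \<phi> y"
      "X = ?R +>\<^bsub>P_module p\<^esub> x" "Y = ?R +>\<^bsub>P_module p\<^esub> y"
      unfolding L_carrier using f_coset by auto
    then have "\<phi> (x \<ominus>\<^bsub>P_module p\<^esub> y) = \<zero>\<^bsub>E\<^esub>"
      using mod_hom_diff[OF P.left_module_axioms E.left_module_axioms \<phi>] mod_hom_closed[OF \<phi>]
      by (simp add: E.diff_eq_zero_iff)
    then show "X = Y" using xy ker[of "x \<ominus>\<^bsub>P_module p\<^esub> y"] P.coset_eq_iff[OF R] by simp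
  qed
  have essential: "N = {\<zero>\<^bsub>E\<^esub>}" if N: "submodule N weyl E" "N \<inter> f ` carrier (L_module p) = {\<zero>\<^bsub>E\<^esub>}" for N
  proof (rule ccontr)
    assume "N \<noteq> {\<zero>\<^bsub>E\<^esub>}"
    then obtain w where w: "w \<in> N" "w \<noteq> \<zero>\<^bsub>E\<^esub>" using E.submodule_zero[OF N(1)] by blast
    have wc: "w \<in> carrier E" using E.submodule_memD[OF N(1) w(1)] .
    obtain a where a: "a \<in> carrier weyl" "wproj E p (a \<odot>\<^bsub>E\<^esub> w) \<noteq> \<zero>\<^bsub>E\<^esub>"
      using faithful[OF wc] w(2) by blast
    have aw: "a \<odot>\<^bsub>E\<^esub> w \<in> N" "a \<odot>\<^bsub>E\<^esub> w \<in> carrier E"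
      using E.submodule_smult[OF N(1) a(1) w(1)] a(1) wc by auto
    have in_N: "wproj E p (a \<odot>\<^bsub>E\<^esub> w) \<in> N"
      by (rule E.wproj_in_submodule[OF N(1) aw(1) E.wspan_UNIV[OF aw(2)]])
    obtain c where c: "wproj E p (a \<odot>\<^bsub>E\<^esub> w) = scal c \<odot>\<^bsub>E\<^esub> e"
      using one_dim[OF E.wproj_weight[OF E.wspan_UNIV[OF aw(2)]]] by blast
    have "f (?R +>\<^bsub>P_module p\<^esub> (scal c \<odot>\<^bsub>P_module p\<^esub> P_gen p)) = scal c \<odot>\<^bsub>E\<^esub> e"
      using f_coset[of "scal c \<odot>\<^bsub>P_module p\<^esub> P_gen p"] gc mod_hom_smult[OF \<phi> weyl_intros(1) gc] \<phi>g by simp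
    moreover have "?R +>\<^bsub>P_module p\<^esub> (scal c \<odot>\<^bsub>P_module p\<^esub> P_gen p) \<in> carrier (L_module p)"
      unfolding L_carrier using gc by simp
    ultimately have "wproj E p (a \<odot>\<^bsub>E\<^esub> w) \<in> f ` carrier (L_module p)"
      unfolding c by (metis imageI)
    then show False using N(2) in_N a(2) by blast
  qed
  \<comment> \<open>The coordinate of a vector of weight \<open>p\<close> relative to
    \<open>e\<close>; it turns maps to \<open>E\<close> into scalar functionals.\<close>
  define coef where "coef = (\<lambda>y. THE c. y = scal c \<odot>\<^bsub>E\<^esub> e)"
  have coef_eq: "coef (scal c \<odot>\<^bsub>E\<^esub> e) = c" for c
    unfolding coef_def using scal_cancel by (intro the_equality) auto
  have coef: "scal (coef y) \<odot>\<^bsub>E\<^esub> e = y" if "y \<in> weight_space E p" for y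
    using one_dim[OF that] coef_eq by auto
  have coef_add: "coef (y \<oplus>\<^bsub>E\<^esub> y') = coef y + coef y'" if y: "y \<in> weight_space E p" "y' \<in> weight_space E p" for y y'
  proof -
    have "y \<oplus>\<^bsub>E\<^esub> y' = scal (coef y + coef y') \<odot>\<^bsub>E\<^esub> e"
      unfolding E.scal_plus[OF ec] coef[OF y(1)] coef[OF y(2)] ..
    then show ?thesis by (simp only: coef_eq)
  qed
  have coef_scal: "coef (scal c \<odot>\<^bsub>E\<^esub> y) = c * coef y" if y: "y \<in> weight_space E p" for c y
  proof -
    have "scal c \<odot>\<^bsub>E\<^esub> y = scal (c * coef y) \<odot>\<^bsub>E\<^esub> e"
      using E.scal_scal[OF ec, of c "coef y"] by (simp only: coef[OF y])
    then show ?thesis by (simp only: coef_eq)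
  qed
  have injective: "injective_object TYPE('m) TYPE('n) E"
    unfolding injective_object_def
  proof (intro conjI allI impI)
    show "weight_module E" by (rule E.weight_module)
    fix M :: "('i, 'k, 'm) weyl_module" and N :: "('i, 'k, 'n) weyl_module" and u k
    assume *: "weight_module M \<and> weight_module N \<and> u \<in> mod_hom weyl M N \<and> inj_on u (carrier M) \<and>
      k \<in> mod_hom weyl M E"
    interpret M: weight_mod M using * by (intro weight_modI) blast
    interpret N: weight_mod N using * by (intro weight_modI) blast
    have u: "u \<in> mod_hom weyl M N" "inj_on u (carrier M)" and k: "k \<in> mod_hom weyl M E" using * by auto
    note kW = E.wproj_weight[OF E.wspan_UNIV[OF mod_hom_closed[OF k]]]
    \<comment> \<open>The functional belonging to \<open>k\<close>. It determines \<open>k\<close>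
      because, by \<open>faithful\<close>, a vector of \<open>E\<close> is known from the components
      at \<open>p\<close> of its orbit.\<close>
    define \<gamma> where "\<gamma> = (\<lambda>x. coef (wproj E p (k x)))"
    have "\<exists>\<mu> :: 'n \<Rightarrow> 'k. (\<forall>x\<in>carrier N. \<forall>y\<in>carrier N. \<mu> (x \<oplus>\<^bsub>N\<^esub> y) = \<mu> x + \<mu> y) \<and>
      (\<forall>c. \<forall>x\<in>carrier N. \<mu> (scal c \<odot>\<^bsub>N\<^esub> x) = c * \<mu> x) \<and> (\<forall>x\<in>carrier M. \<mu> (u x) = \<gamma> x)"
    proof (rule extend_functional[OF M.weyl_mod_axioms N.weyl_mod_axioms u])
      show "\<gamma> (x \<oplus>\<^bsub>M\<^esub> y) = \<gamma> x + \<gamma> y" if "x \<in> carrier M" "y \<in> carrier M" for x y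
        using that kW unfolding \<gamma>_def
        by (simp add: mod_hom_add[OF k] mod_hom_closed[OF k] E.wproj_add E.wspan_UNIV coef_add)
      show "\<gamma> (scal c \<odot>\<^bsub>M\<^esub> x) = c * \<gamma> x" if "x \<in> carrier M" for c x
        using that kW unfolding \<gamma>_def
        by (simp add: mod_hom_smult[OF k] mod_hom_closed[OF k] E.wproj_scal E.wspan_UNIV coef_scal)
    qed
    then obtain \<mu> :: "'n \<Rightarrow> 'k" where \<mu>: "\<And>x y. x \<in> carrier N \<Longrightarrow> y \<in> carrier N \<Longrightarrow> \<mu> (x \<oplus>\<^bsub>N\<^esub> y) = \<mu> x + \<mu> y"
      "\<And>c x. x \<in> carrier N \<Longrightarrow> \<mu> (scal c \<odot>\<^bsub>N\<^esub> x) = c * \<mu> x"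
      "\<And>x. x \<in> carrier M \<Longrightarrow> \<mu> (u x) = \<gamma> x"
      by blast
    have "\<exists>h\<in>mod_hom weyl N E. \<forall>x\<in>carrier N. \<forall>w\<in>carrier E.
      (\<forall>a\<in>carrier weyl. wproj E p (a \<odot>\<^bsub>E\<^esub> w) = scal (\<mu> (wproj N p (a \<odot>\<^bsub>N\<^esub> x))) \<odot>\<^bsub>E\<^esub> e) \<longrightarrow> h x = w"
      by (rule coinduced_hom_exists[OF E N.weight_mod_axioms e(1) faithful reach \<mu>(1,2)])
    then obtain h where h: "h \<in> mod_hom weyl N E" "\<And>x w. x \<in> carrier N \<Longrightarrow> w \<in> carrier E \<Longrightarrow>
      (\<forall>a\<in>carrier weyl. wproj E p (a \<odot>\<^bsub>E\<^esub> w) = scal (\<mu> (wproj N p (a \<odot>\<^bsub>N\<^esub> x))) \<odot>\<^bsub>E\<^esub> e) \<Longrightarrow> h x = w"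
      by blast
    have "h (u x) = k x" if x: "x \<in> carrier M" for x
    proof (rule h(2)[OF mod_hom_closed[OF u(1) x] mod_hom_closed[OF k x]], rule ballI)
      fix a :: "('i, 'k) opr" assume a: "a \<in> carrier weyl"
      have ax: "a \<odot>\<^bsub>M\<^esub> x \<in> carrier M" using a x by simp
      have "wproj N p (a \<odot>\<^bsub>N\<^esub> u x) = u (wproj M p (a \<odot>\<^bsub>M\<^esub> x))"
        using mod_hom_wproj[OF M.weight_mod_axioms N.weight_mod_axioms u(1) ax] mod_hom_smult[OF u(1) a x] by simp
      then have "\<mu> (wproj N p (a \<odot>\<^bsub>N\<^esub> u x)) = coef (wproj E p (k (a \<odot>\<^bsub>M\<^esub> x)))"
        using \<mu>(3)[OF M.wproj_carrier[OF ax]] mod_hom_wproj[OF M.weight_mod_axioms E k ax, of p]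
          E.wproj_idem[OF mod_hom_closed[OF k ax]] unfolding \<gamma>_def by simp
      then show "wproj E p (a \<odot>\<^bsub>E\<^esub> k x) = scal (\<mu> (wproj N p (a \<odot>\<^bsub>N\<^esub> u x))) \<odot>\<^bsub>E\<^esub> e"
        using coef[OF kW[OF ax]] mod_hom_smult[OF k a x] by simp
    qed
    then show "\<exists>h\<in>mod_hom weyl N E. \<forall>x\<in>carrier M. h (u x) = k x" using h(1) by blast
  qed
  show ?thesis
    unfolding injective_envelope_def
    using L.weight_module injective f inj essential by blast
qed

section \<open>Modules with one-dimensional weight spaces on a coset of \<open>\<int>\<^sub>f\<close>\<close>

text \<open>The shifts are integer-valued, as in \<open>outgoing\<close>, and not integral elements
  of the field as in \<open>Z_fin\<close>; \<open>weight_coset_eq\<close> connects the two.\<close>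

definition weight_coset :: "('i \<Rightarrow> 'k::field) \<Rightarrow> ('i \<Rightarrow> 'k) set" where
  "weight_coset p = {\<lambda>i. p i + of_int (z i) | z. finite {i. z i \<noteq> 0}}"

lemma weight_cosetI: "finite {i. z i \<noteq> 0} \<Longrightarrow> (\<lambda>i. p i + of_int (z i)) \<in> weight_coset p"
  unfolding weight_coset_def by blast

lemma weight_coset_self: "p \<in> weight_coset p"
  using weight_cosetI[of "\<lambda>_. 0" p] by simp

lemma weight_coset_eq:
  "{\<lambda>i. p i + z i | z. z \<in> Z_fin} = weight_coset (p :: 'i \<Rightarrow> 'k::field_char_0)"
proof (intro equalityI subsetI)
  fix m assume "m \<in> {\<lambda>i. p i + z i | z. z \<in> Z_fin}"
  then obtain z where z: "range z \<subseteq> \<int>" "finite {i. z i \<noteq> 0}" "m = (\<lambda>i. p i + z i)"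
    by (auto simp: Z_fin_def)
  then obtain w where w: "\<And>i. z i = of_int (w i)"
    by (metis Ints_cases rangeI subsetD)
  then have "finite {i. w i \<noteq> 0}" using z(2) by simp
  then show "m \<in> weight_coset p" using weight_cosetI[of w p] z(3) w by simp
next
  fix m assume "m \<in> weight_coset p"
  then obtain w where "finite {i. w i \<noteq> 0}" "m = (\<lambda>i. p i + of_int (w i))"
    unfolding weight_coset_def by blast
  then show "m \<in> {\<lambda>i. p i + z i | z. z \<in> Z_fin}"
    by (intro CollectI exI[of _ "\<lambda>i. of_int (w i)"]) (auto simp: Z_fin_def)
qed

lemma weight_coset_shift:
  assumes "m \<in> weight_coset p"
  shows "m(i := m i + of_int k) \<in> weight_coset p"
proof -
  obtain z where z: "finite {i. z i \<noteq> 0}" "m = (\<lambda>i. p i + of_int (z i))"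
    using assms unfolding weight_coset_def by blast
  have "finite {j. (z(i := z i + k)) j \<noteq> 0}"
    by (rule finite_subset[of _ "insert i {j. z j \<noteq> 0}"]) (use z in auto)
  moreover have "m(i := m i + of_int k) = (\<lambda>j. p j + of_int ((z(i := z i + k)) j))"
    using z(2) by auto
  ultimately show ?thesis using weight_cosetI by metis
qed

text \<open>Covers \<open>B_module p\<close> and its dual alike. The scalars relating neighbouring
  vectors are left open: the criteria depend only on where a generator vanishes.\<close>

locale string_module = weight_mod M
  for M :: "('i, 'k::field_char_0, 'm) weyl_module" (structure) +
  fixes p :: "'i \<Rightarrow> 'k" and \<epsilon> :: "('i \<Rightarrow> 'k) \<Rightarrow> 'm"
  assumes eps_weight: "m \<in> weight_coset p \<Longrightarrow> \<epsilon> m \<in> W m"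
    and eps_nonzero: "m \<in> weight_coset p \<Longrightarrow> \<epsilon> m \<noteq> \<zero>"
    and eps_span: "m \<in> weight_coset p \<Longrightarrow> x \<in> W m \<Longrightarrow> \<exists>c. x = scal c \<odot> \<epsilon> m"
    and weights: "m \<notin> weight_coset p \<Longrightarrow> x \<in> W m \<Longrightarrow> x = \<zero>"
begin

text \<open>On a line, not killing one vector means killing no nonzero vector. This lets
  nonvanishing propagate along a word letter by letter.\<close>

lemma act_nonzero:
  assumes a: "a \<in> carrier weyl" and m: "m \<in> weight_coset p" and ne: "a \<odot> \<epsilon> m \<noteq> \<zero>"
    and x: "x \<in> W m" "x \<noteq> \<zero>"
  shows "a \<odot> x \<noteq> \<zero>"
proof
  assume 0: "a \<odot> x = \<zero>"
  have ec: "\<epsilon> m \<in> carrier M" using eps_weight[OF m] by auto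
  obtain c where c: "x = scal c \<odot> \<epsilon> m" using eps_span[OF m x(1)] by blast
  then have "scal c \<odot> (a \<odot> \<epsilon> m) = \<zero>" using 0 scal_comm[OF a ec] by simp
  then have "c = 0" using scal_cancel[OF smult_closed[OF a ec]] ne by blast
  then show False using c x(2) ec by simp
qed

lemma multiple:
  assumes m: "m \<in> weight_coset p" and x: "x \<in> W m" "x \<noteq> \<zero>" and y: "y \<in> W m"
  shows "\<exists>c. y = scal c \<odot> x"
proof -
  have ec: "\<epsilon> m \<in> carrier M" using eps_weight[OF m] by auto
  obtain c d where c: "x = scal c \<odot> \<epsilon> m" and d: "y = scal d \<odot> \<epsilon> m"
    using eps_span[OF m] x(1) y by blast
  have "c \<noteq> 0" using c x(2) ec by auto
  then have "y = scal (d / c) \<odot> x" unfolding c d by (simp add: scal_scal[OF ec])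
  then show ?thesis by blast
qed

text \<open>The assumptions list exactly the steps of outgoing words from \<open>p\<close>:
  \<open>X_op i\<close> from shift at least 0, \<open>Y_op i\<close> from shift at most 0. Hence
  such words do not vanish on the vector at \<open>p\<close> and reach every weight of the
  coset.\<close>

lemma projective_cover:
  assumes "\<And>z i. finite {i. z i \<noteq> 0} \<Longrightarrow> z i \<ge> 0 \<Longrightarrow> X_op i \<odot> \<epsilon> (\<lambda>i. p i + of_int (z i)) \<noteq> \<zero>"
    and "\<And>z i. finite {i. z i \<noteq> 0} \<Longrightarrow> z i \<le> 0 \<Longrightarrow> Y_op i \<odot> \<epsilon> (\<lambda>i. p i + of_int (z i)) \<noteq> \<zero>"
  shows "projective_cover TYPE('a) TYPE('b) M (L_module p)"
proof (rule projective_cover_criterion[OF weight_mod_axioms])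
  note p = weight_coset_self[of p]
  show e: "\<epsilon> p \<in> W p" by (rule eps_weight[OF p])
  note ec = W_carrier[OF e]
  show nonzero: "a \<odot> \<epsilon> p \<noteq> \<zero>" if "outgoing z a" for z a
    using that
  proof (induction rule: outgoing.induct)
    case id
    then show ?case using eps_nonzero[OF p] by (simp only: act_id[OF ec] not_False_eq_True)
  next
    case (X z a i)
    note fin = outgoing_finite[OF X.hyps(1)]
    show ?case
      unfolding act_comp[OF weyl_intros(2) outgoing_carrier[OF X.hyps(1)] ec]
      by (rule act_nonzero[OF weyl_intros(2) weight_cosetI[OF fin] assms(1)[OF fin X.hyps(2)]
        outgoing_weight[OF X.hyps(1) e] X.IH])
  next
    case (Y z a i)
    note fin = outgoing_finite[OF Y.hyps(1)]
    show ?case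
      unfolding act_comp[OF weyl_intros(3) outgoing_carrier[OF Y.hyps(1)] ec]
      by (rule act_nonzero[OF weyl_intros(3) weight_cosetI[OF fin] assms(2)[OF fin Y.hyps(2)]
        outgoing_weight[OF Y.hyps(1) e] Y.IH])
  qed
  have "\<exists>a\<in>carrier weyl. x = a \<odot> \<epsilon> p" if "x \<in> carrier M" for x
    using that
  proof (induction rule: weight_induct)
    case zero
    show ?case by (rule bexI[of _ "scal 0"]) (simp_all only: scal_zero[OF ec] weyl_intros)
  next
    case (add x w q)
    obtain a where a: "a \<in> carrier weyl" "x = a \<odot> \<epsilon> p" using add.IH by blast
    have "\<exists>b\<in>carrier weyl. w = b \<odot> \<epsilon> p"
    proof (cases "q \<in> weight_coset p")
      case True
      then obtain z where z: "finite {i. z i \<noteq> 0}" "q = (\<lambda>i. p i + of_int (z i))"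
        unfolding weight_coset_def by blast
      obtain b :: "('i, 'k) opr" where b: "outgoing z b" using outgoing_exists[OF z(1)] by blast
      obtain c where "w = scal c \<odot> (b \<odot> \<epsilon> p)"
        using multiple[OF True] outgoing_weight[OF b e] nonzero[OF b] add.hyps(2) z(2) by blast
      then have "w = (scal c \<circ> b) \<odot> \<epsilon> p"
        using act_comp[OF weyl_intros(1) outgoing_carrier[OF b] ec] by simp
      then show ?thesis using weyl_comp[OF weyl_intros(1) outgoing_carrier[OF b]] by blast
    next
      case False
      then show ?thesis
        using weights[OF False add.hyps(2)]
        by (intro bexI[of _ "scal 0"]) (simp_all only: scal_zero[OF ec] weyl_intros)
    qed
    then obtain b where b: "b \<in> carrier weyl" "w = b \<odot> \<epsilon> p" by blast
    have "x \<oplus> w = (\<lambda>f. a f + b f) \<odot> \<epsilon> p" using act_add[OF a(1) b(1) ec] a(2) b(2) by simp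
    then show ?case using weyl_add[OF a(1) b(1)] by blast
  qed
  then show "carrier M \<subseteq> (\<lambda>a. a \<odot> \<epsilon> p) ` carrier weyl" by blast
qed

text \<open>A step towards \<open>p\<close> by \<open>X_op i\<close> starts at a strictly negative
  shift, one by \<open>Y_op i\<close> at a strictly positive shift. Nonvanishing of these steps
  gives both hypotheses of the criterion, detection of vectors at \<open>p\<close> and surjectivity
  onto the line at \<open>p\<close>.\<close>

lemma injective_envelope:
  assumes "\<And>z i. finite {i. z i \<noteq> 0} \<Longrightarrow> z i < 0 \<Longrightarrow> X_op i \<odot> \<epsilon> (\<lambda>i. p i + of_int (z i)) \<noteq> \<zero>"
    and "\<And>z i. finite {i. z i \<noteq> 0} \<Longrightarrow> z i > 0 \<Longrightarrow> Y_op i \<odot> \<epsilon> (\<lambda>i. p i + of_int (z i)) \<noteq> \<zero>"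
  shows "injective_envelope TYPE('a) TYPE('b) M (L_module p)"
proof -
  note p = weight_coset_self[of p]
  \<comment> \<open>\<open>w\<close> is the offset of the start from \<open>p\<close>. The sign
    conditions say that the word does not step past \<open>p\<close>; they pass to the part of the
    word applied first, whereas the case of interest, \<open>w = - z\<close>, does not.\<close>
  have nonzero: "b \<odot> y \<noteq> \<zero>"
    if "outgoing z b" "\<And>i. z i > 0 \<Longrightarrow> w i + z i \<le> 0" "\<And>i. z i < 0 \<Longrightarrow> w i + z i \<ge> 0"
      "finite {i. w i \<noteq> 0}" "y \<in> W (\<lambda>i. p i + of_int (w i))" "y \<noteq> \<zero>" for z b w y
    using that
  proof (induction rule: outgoing.induct)
    case id
    then show ?case by (simp only: act_id[OF W_carrier[OF id(4)]] not_False_eq_True)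
  next
    case (X z a i)
    have "a \<odot> y \<noteq> \<zero>"
    proof (rule X.IH)
      show "w j + z j \<le> 0" if "z j > 0" for j
        using that X.prems(1)[of j] by (cases "j = i") auto
      show "w j + z j \<ge> 0" if "z j < 0" for j
        using that X.prems(2)[of j] X.hyps(2) by (cases "j = i") auto
    qed (use X.prems in auto)
    let ?u = "\<lambda>i. w i + z i"
    have fin: "finite {i. ?u i \<noteq> 0}"
      by (rule finite_subset[of _ "{i. w i \<noteq> 0} \<union> {i. z i \<noteq> 0}"])
        (use X.prems(3) outgoing_finite[OF X.hyps(1)] in auto)
    have "a \<odot> y \<in> W (\<lambda>i. p i + of_int (w i) + of_int (z i))"
      by (rule outgoing_weight[OF X.hyps(1) X.prems(4)])
    then have ay: "a \<odot> y \<in> W (\<lambda>i. p i + of_int (?u i))" by (simp add: add.assoc)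
    have "?u i < 0" using X.prems(1)[of i] X.hyps(2) by simp
    then show ?case
      unfolding act_comp[OF weyl_intros(2) outgoing_carrier[OF X.hyps(1)] W_carrier[OF X.prems(4)]]
      using act_nonzero[OF weyl_intros(2) weight_cosetI[OF fin] assms(1)[OF fin] ay \<open>a \<odot> y \<noteq> \<zero>\<close>] by blast
  next
    case (Y z a i)
    have "a \<odot> y \<noteq> \<zero>"
    proof (rule Y.IH)
      show "w j + z j \<le> 0" if "z j > 0" for j
        using that Y.prems(1)[of j] Y.hyps(2) by (cases "j = i") auto
      show "w j + z j \<ge> 0" if "z j < 0" for j
        using that Y.prems(2)[of j] by (cases "j = i") auto
    qed (use Y.prems in auto)
    let ?u = "\<lambda>i. w i + z i"
    have fin: "finite {i. ?u i \<noteq> 0}"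
      by (rule finite_subset[of _ "{i. w i \<noteq> 0} \<union> {i. z i \<noteq> 0}"])
        (use Y.prems(3) outgoing_finite[OF Y.hyps(1)] in auto)
    have "a \<odot> y \<in> W (\<lambda>i. p i + of_int (w i) + of_int (z i))"
      by (rule outgoing_weight[OF Y.hyps(1) Y.prems(4)])
    then have ay: "a \<odot> y \<in> W (\<lambda>i. p i + of_int (?u i))" by (simp add: add.assoc)
    have "?u i > 0" using Y.prems(2)[of i] Y.hyps(2) by simp
    then show ?case
      unfolding act_comp[OF weyl_intros(3) outgoing_carrier[OF Y.hyps(1)] W_carrier[OF Y.prems(4)]]
      using act_nonzero[OF weyl_intros(3) weight_cosetI[OF fin] assms(2)[OF fin] ay \<open>a \<odot> y \<noteq> \<zero>\<close>] by blast
  qed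
  have to_p: "b \<odot> y \<noteq> \<zero>"
    if b: "outgoing z b" and r: "(\<lambda>i. r i + of_int (z i)) = p" and y: "y \<in> W r" "y \<noteq> \<zero>" for r z b y
  proof (rule nonzero[OF b, of "\<lambda>i. - z i"])
    have "r = (\<lambda>i. p i + of_int (- z i))" using r by (auto simp: fun_eq_iff eq_diff_eq)
    then show "y \<in> W (\<lambda>i. p i + of_int (- z i))" using y(1) by simp
  qed (use y outgoing_finite[OF b] in auto)
  show ?thesis
  proof (rule injective_envelope_criterion[OF weight_mod_axioms eps_weight[OF p] eps_nonzero[OF p] eps_span[OF p]])
    fix w assume w: "w \<in> carrier M" "\<forall>a\<in>carrier weyl. wproj M p (a \<odot> w) = \<zero>"
    show "w = \<zero>"
    proof (rule wproj_eq_zeroD[OF wspan_UNIV[OF w(1)]], rule ccontr)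
      fix q assume q: "wproj M q w \<noteq> \<zero>"
      have qW: "wproj M q w \<in> W q" by (rule wproj_weight[OF wspan_UNIV[OF w(1)]])
      then have "q \<in> weight_coset p" using weights q by blast
      then obtain u where u: "finite {i. u i \<noteq> 0}" "q = (\<lambda>i. p i + of_int (u i))"
        unfolding weight_coset_def by blast
      \<comment> \<open>The component at \<open>q\<close> is moved to \<open>p\<close>: there it
        vanishes by assumption, although steps towards \<open>p\<close> keep it nonzero.\<close>
      then obtain b :: "('i, 'k) opr" where b: "outgoing (\<lambda>i. - u i) b"
        using outgoing_exists[of "\<lambda>i. - u i"] by auto
      have qp: "(\<lambda>i. q i + of_int (- u i)) = p" using u(2) by simp
      have "b \<odot> wproj M q w = \<zero>"
        using wproj_outgoing[OF b wspan_UNIV[OF w(1)], of q] w(2) outgoing_carrier[OF b] unfolding qp by simp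
      then show False using to_p[OF b qp qW q] by blast
    qed
  next
    fix r z and b :: "('i, 'k) opr" assume b: "outgoing z b" and r: "(\<lambda>i. r i + of_int (z i)) = p"
    have fin: "finite {i. - z i \<noteq> 0}" using outgoing_finite[OF b] by simp
    have "r = (\<lambda>i. p i + of_int (- z i))" using r by (auto simp: fun_eq_iff eq_diff_eq)
    then have rc: "r \<in> weight_coset p" using weight_cosetI[OF fin, of p] by simp
    have "b \<odot> \<epsilon> r \<in> W p" using outgoing_weight[OF b eps_weight[OF rc]] unfolding r .
    \<comment> \<open>The image of the basis vector at \<open>r\<close> is a nonzero vector on the
      line at \<open>p\<close>; rescaling turns it into the basis vector there.\<close>
    then obtain c where c: "\<epsilon> p = scal c \<odot> (b \<odot> \<epsilon> r)"
      using multiple[OF p _ to_p[OF b r eps_weight[OF rc] eps_nonzero[OF rc]] eps_weight[OF p]] by blast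
    then have "b \<odot> (scal c \<odot> \<epsilon> r) = \<epsilon> p"
      using scal_comm[OF outgoing_carrier[OF b] W_carrier[OF eps_weight[OF rc]]] by simp
    then show "\<exists>w\<in>W r. b \<odot> w = \<epsilon> p" using W_scal[OF eps_weight[OF rc]] by blast
  qed
qed

end

section \<open>The module \<open>B(p)\<close>\<close>

lemma B_module_sel [simp]:
  "\<zero>\<^bsub>B_module p\<^esub> = 0" "f \<oplus>\<^bsub>B_module p\<^esub> g = f + g" "a \<odot>\<^bsub>B_module p\<^esub> f = weyl_action a f"
  by (simp_all add: B_module_def)

lemma B_carrier: "f \<in> carrier (B_module (p :: 'i \<Rightarrow> 'k::field_char_0)) \<longleftrightarrow> keys f \<subseteq> weight_coset p"
  by (simp add: B_module_def weight_coset_eq)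

lemma keys_lin_ext:
  fixes g :: "'b \<Rightarrow> ('c \<Rightarrow>\<^sub>0 'k::field)"
  shows "keys (lin_ext g f) \<subseteq> (\<Union>m\<in>keys f. keys (g m))"
proof -
  have "keys (lin_ext g f) \<subseteq>
      (\<Union>m\<in>keys f. keys (scal (lookup f m) (g m)))"
    unfolding lin_ext_def by (rule keys_sum)
  moreover have "keys (scal c u) \<subseteq> keys u" for c and u :: "'c \<Rightarrow>\<^sub>0 'k"
    by (metis in_keys_iff lookup_scal mult_zero_right subsetI)
  ultimately show ?thesis by blast
qed

lemma weyl_action_linear:
  fixes a :: "('i, 'k::field_char_0) opr"
  shows "a \<in> carrier weyl \<Longrightarrow> Vector_Spaces.linear scal scal (weyl_action a)"
  using ring_hom_closed[OF weyl_action_props(2), of a] by simp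

lemma weyl_action_add:
  fixes a b :: "('i, 'k::field_char_0) opr"
  assumes "a \<in> carrier weyl" "b \<in> carrier weyl"
  shows "weyl_action (\<lambda>f. a f + b f) = (\<lambda>f. weyl_action a f + weyl_action b f)"
  using ring_hom_add[OF weyl_action_props(2) assms] by (simp only: weyl_sel End_ring_sel)

lemma weyl_action_comp:
  fixes a b :: "('i, 'k::field_char_0) opr"
  assumes "a \<in> carrier weyl" "b \<in> carrier weyl"
  shows "weyl_action (a \<circ> b) = weyl_action a \<circ> weyl_action b"
  using ring_hom_mult[OF weyl_action_props(2) assms] by (simp only: weyl_sel End_ring_sel)

lemma weyl_action_id: "weyl_action (id :: ('i, 'k::field_char_0) opr) = id"
  using ring_hom_one[OF weyl_action_props(2)] by (simp only: weyl_sel End_ring_sel)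

lemma B_closed:
  fixes p :: "'i \<Rightarrow> 'k::field_char_0"
  assumes "a \<in> carrier weyl" "f \<in> carrier (B_module p)"
  shows "weyl_action a f \<in> carrier (B_module p)"
  using assms
proof (induction arbitrary: f rule: weyl_induct)
  case (scal c)
  then show ?case
    unfolding weyl_action_props(3) B_carrier by (metis in_keys_iff lookup_scal mult_zero_right subset_eq)
next
  case (X i)
  then show ?case
    unfolding weyl_action_props(4) B_carrier X_gen_def
    using weight_coset_shift[of _ p i 1] by (intro order_trans[OF keys_lin_ext]) auto
next
  case (Y i)
  then show ?case
    unfolding weyl_action_props(5) B_carrier Y_gen_def
    using weight_coset_shift[of _ p i "-1"] by (intro order_trans[OF keys_lin_ext]) (auto split: if_splits)
next
  case (add a b)
  show ?case
    unfolding weyl_action_add[OF add.hyps]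
    using add.IH[OF add.prems] keys_add[of "weyl_action a f" "weyl_action b f"] unfolding B_carrier by blast
next
  case (mult a b)
  then show ?case unfolding weyl_action_comp[OF mult.hyps] by simp
qed

lemma weyl_mod_B: "weyl_mod (B_module (p :: 'i \<Rightarrow> 'k::field_char_0))"
  unfolding weyl_mod_def
proof (rule left_module.intro[OF ring_weyl])
  show "abelian_group (B_module p)"
  proof (rule abelian_groupI)
    show "f \<oplus>\<^bsub>B_module p\<^esub> g \<in> carrier (B_module p)" if "f \<in> carrier (B_module p)" "g \<in> carrier (B_module p)" for f g
      using that keys_add[of f g] unfolding B_carrier B_module_sel by blast
    show "\<exists>g\<in>carrier (B_module p). g \<oplus>\<^bsub>B_module p\<^esub> f = \<zero>\<^bsub>B_module p\<^esub>" if "f \<in> carrier (B_module p)" for f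
      using that by (intro bexI[of _ "- f"]) (auto simp: B_carrier)
  qed (auto simp: B_carrier algebra_simps)
  show "left_module_axioms weyl (B_module p)"
  proof (rule left_module_axioms.intro)
    fix a b :: "('i, 'k) opr" and f g
    assume a: "a \<in> carrier weyl" and f: "f \<in> carrier (B_module p)"
    show "a \<odot>\<^bsub>B_module p\<^esub> f \<in> carrier (B_module p)" using B_closed[OF a f] by simp
    show "a \<odot>\<^bsub>B_module p\<^esub> (f \<oplus>\<^bsub>B_module p\<^esub> g) = a \<odot>\<^bsub>B_module p\<^esub> f \<oplus>\<^bsub>B_module p\<^esub> a \<odot>\<^bsub>B_module p\<^esub> g"
      using weyl_action_linear[OF a] by (simp add: linear_scal_iff)
    assume b: "b \<in> carrier weyl"
    show "(a \<oplus>\<^bsub>weyl\<^esub> b) \<odot>\<^bsub>B_module p\<^esub> f = a \<odot>\<^bsub>B_module p\<^esub> f \<oplus>\<^bsub>B_module p\<^esub> b \<odot>\<^bsub>B_module p\<^esub> f"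
      by (simp only: weyl_sel B_module_sel weyl_action_add[OF a b])
    show "(a \<otimes>\<^bsub>weyl\<^esub> b) \<odot>\<^bsub>B_module p\<^esub> f = a \<odot>\<^bsub>B_module p\<^esub> (b \<odot>\<^bsub>B_module p\<^esub> f)"
      by (simp only: weyl_sel B_module_sel weyl_action_comp[OF a b] comp_apply)
  next
    fix f assume "f \<in> carrier (B_module p)"
    show "\<one>\<^bsub>weyl\<^esub> \<odot>\<^bsub>B_module p\<^esub> f = f"
      by (simp only: weyl_sel B_module_sel weyl_action_id id_apply)
  qed
qed

text \<open>\<open>t_op i\<close> is diagonal on monomials, so weights are exponents; comparing
  coefficients then isolates a single monomial in each weight space.\<close>

lemma lookup_t_action:
  "lookup (weyl_action (t_op i) f) m = m i * lookup f (m :: 'i \<Rightarrow> 'k::field_char_0)"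
proof -
  have "weyl_action (t_op i) = lin_ext (\<lambda>m. single m (m i :: 'k))"
    unfolding t_op_def weyl_action_comp[OF weyl_intros(2,3)] weyl_action_props
    by (rule linear_eqI[OF linear_comp[OF linear_X_gen linear_Y_gen] linear_lin_ext]) simp
  then show ?thesis
    by (auto simp: lin_ext_def lookup_sum lookup_single when_def if_distrib cong: if_cong dest!: lookup_notin_keys)
qed

lemma B_weight_keys:
  fixes p :: "'i \<Rightarrow> 'k::field_char_0"
  assumes "f \<in> weight_space (B_module p) q"
  shows "f = single q (lookup f q)"
proof (rule poly_mapping_eqI)
  fix m
  show "lookup f m = lookup (single q (lookup f q)) m"
  proof (cases "m = q")
    case False
    then obtain i where i: "m i \<noteq> q i" by (meson ext)
    have "weyl_action (t_op i) f = scal (q i) f"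
      using assms by (simp add: weight_space_def weyl_action_props)
    from arg_cong[OF this, of "\<lambda>u. lookup u m"] show ?thesis
      using i False by (simp add: lookup_t_action lookup_single)
  qed simp
qed

lemma B_single_carrier: "m \<in> weight_coset p \<Longrightarrow> single m c \<in> carrier (B_module (p :: 'i \<Rightarrow> 'k::field_char_0))"
  by (auto simp: B_carrier)

lemma B_single_weight:
  fixes p :: "'i \<Rightarrow> 'k::field_char_0"
  assumes "m \<in> weight_coset p"
  shows "single m c \<in> weight_space (B_module p) m"
proof -
  have "weyl_action (t_op i) (single m c) = scal (m i) (single m c)" for i
    by (rule poly_mapping_eqI) (auto simp: lookup_t_action lookup_single when_def)
  then show ?thesis
    using B_single_carrier[OF assms] by (simp add: weight_space_def weyl_action_props)
qed

lemma string_module_B: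
  "string_module (B_module p) (p :: 'i \<Rightarrow> 'k::field_char_0) (\<lambda>m. single m 1)"
proof -
  interpret B: weyl_mod "B_module p" by (rule weyl_mod_B)
  have sum: "(\<Sum>m\<in>A. single m (c m)) \<in> wspan (B_module p) (\<lambda>_. True)"
    if "finite A" "A \<subseteq> weight_coset p" for A c
    using that
  proof (induction A rule: finite_induct)
    case empty
    then show ?case using wspan.zero[of "B_module p"] by simp
  next
    case (insert m A)
    then show ?case
      using wspan.add[of _ "B_module p" "\<lambda>_. True" "single m (c m)" m]
      by (simp add: B_single_weight add.commute[of "single m (c m)"])
  qed
  have "f \<in> wspan (B_module p) (\<lambda>_. True)" if "f \<in> carrier (B_module p)" for f
    using sum[of "keys f" "lookup f"] that
    unfolding B_carrier poly_mapping_eq_sum_single[symmetric] by simp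
  then interpret B: weight_mod "B_module p" by unfold_locales
  show ?thesis
  proof unfold_locales
    fix m f assume m: "m \<in> weight_coset p"
    show "single m 1 \<in> B.W m" by (rule B_single_weight[OF m])
    show "single m 1 \<noteq> \<zero>\<^bsub>B_module p\<^esub>"
      by simp (metis lookup_single_eq lookup_zero zero_neq_one)
    assume "f \<in> B.W m"
    from B_weight_keys[OF this] show "\<exists>c. f = scal c \<odot>\<^bsub>B_module p\<^esub> single m 1"
      by (intro exI[of _ "lookup f m"]) (simp add: weyl_action_props)
  next
    fix m f assume m: "m \<notin> weight_coset p" and f: "f \<in> B.W m"
    then have "m \<notin> keys f" using B.W_carrier[OF f] by (auto simp: B_carrier)
    then show "f = \<zero>\<^bsub>B_module p\<^esub>"
      using B_weight_keys[OF f] by (simp add: lookup_notin_keys)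
  qed
qed

section \<open>The dual module\<close>

lemma star_module_sel [simp]:
  "\<zero>\<^bsub>star_module M\<^esub> = (\<lambda>x\<in>carrier M. 0)"
  "f \<oplus>\<^bsub>star_module M\<^esub> g = (\<lambda>x\<in>carrier M. f x + g x)"
  "a \<odot>\<^bsub>star_module M\<^esub> f = (\<lambda>x\<in>carrier M. f (diamond a \<odot>\<^bsub>M\<^esub> x))"
  by (simp_all add: star_module_def)

lemma star_carrier:
  "f \<in> carrier (star_module M) \<longleftrightarrow> f \<in> extensional (carrier M) \<and>
    (\<forall>x\<in>carrier M. \<forall>y\<in>carrier M. f (x \<oplus>\<^bsub>M\<^esub> y) = f x + f y) \<and>
    (\<forall>c. \<forall>x\<in>carrier M. f (scal c \<odot>\<^bsub>M\<^esub> x) = c * f x) \<and>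
    finite {p. \<exists>x\<in>weight_space M p. f x \<noteq> 0}"
  by (simp add: star_module_def)

lemma diamond_closed:
  fixes a :: "('i, 'k::field_char_0) opr"
  shows "a \<in> carrier weyl \<Longrightarrow> diamond a \<in> carrier weyl"
  using ring_hom_closed[OF diamond_props(1), of a] by simp

lemma diamond_add:
  fixes a b :: "('i, 'k::field_char_0) opr"
  assumes "a \<in> carrier weyl" "b \<in> carrier weyl"
  shows "diamond (\<lambda>f. a f + b f) = (\<lambda>f. diamond a f + diamond b f)"
  using ring_hom_add[OF diamond_props(1) assms] by (simp only: weyl_sel opposite_ring_sel)

lemma diamond_comp:
  fixes a b :: "('i, 'k::field_char_0) opr"
  assumes "a \<in> carrier weyl" "b \<in> carrier weyl"
  shows "diamond (a \<circ> b) = diamond b \<circ> diamond a"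
  using ring_hom_mult[OF diamond_props(1) assms] by (simp only: weyl_sel opposite_ring_sel)

lemma diamond_id: "diamond (id :: ('i, 'k::field_char_0) opr) = id"
  using ring_hom_one[OF diamond_props(1)] by (simp only: weyl_sel opposite_ring_sel)

context weyl_mod
begin

lemma star_add: "f \<in> carrier (star_module M) \<Longrightarrow> x \<in> carrier M \<Longrightarrow> y \<in> carrier M \<Longrightarrow> f (x \<oplus> y) = f x + f y"
  and star_scal: "f \<in> carrier (star_module M) \<Longrightarrow> x \<in> carrier M \<Longrightarrow> f (scal c \<odot> x) = c * f x"
  and star_extensional: "f \<in> carrier (star_module M) \<Longrightarrow> f \<in> extensional (carrier M)"
  and star_finite: "f \<in> carrier (star_module M) \<Longrightarrow> finite {p. \<exists>x\<in>W p. f x \<noteq> 0}"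
  by (auto simp: star_carrier)

lemma star_restrictI:
  assumes "\<And>x y. x \<in> carrier M \<Longrightarrow> y \<in> carrier M \<Longrightarrow> h (x \<oplus> y) = h x + h y"
    and "\<And>c x. x \<in> carrier M \<Longrightarrow> h (scal c \<odot> x) = c * h x"
    and "finite {p. \<exists>x\<in>W p. h x \<noteq> 0}"
  shows "restrict h (carrier M) \<in> carrier (star_module M)"
proof -
  have "{p. \<exists>x\<in>W p. restrict h (carrier M) x \<noteq> 0} = {p. \<exists>x\<in>W p. h x \<noteq> 0}"
    by (auto simp: W_carrier)
  then show ?thesis
    using assms unfolding star_carrier by (intro conjI restrict_extensional) auto
qed

lemma star_closed_add:
  assumes f: "f \<in> carrier (star_module M)" and g: "g \<in> carrier (star_module M)"
  shows "(\<lambda>x\<in>carrier M. f x + g x) \<in> carrier (star_module M)"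
proof (rule star_restrictI)
  have "f x \<noteq> 0 \<or> g x \<noteq> 0" if "f x + g x \<noteq> 0" for x
    using that by auto
  then have "{p. \<exists>x\<in>W p. f x + g x \<noteq> 0} \<subseteq> {p. \<exists>x\<in>W p. f x \<noteq> 0} \<union> {p. \<exists>x\<in>W p. g x \<noteq> 0}"
    by blast
  then show "finite {p. \<exists>x\<in>W p. f x + g x \<noteq> 0}"
    by (rule finite_subset) (use star_finite f g in blast)
qed (simp_all add: star_add[OF f] star_add[OF g] star_scal[OF f] star_scal[OF g] algebra_simps)

text \<open>Finiteness of the support is the issue. A general algebra element does not translate
  weights by one vector, so the proof goes by generators, each of which moves weights injectively
  and pulls finite sets back to finite sets.\<close>

lemma star_closed_act:
  assumes "a \<in> carrier weyl" "f \<in> carrier (star_module M)"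
  shows "(\<lambda>x\<in>carrier M. f (a \<odot> x)) \<in> carrier (star_module M)"
  using assms
proof (induction arbitrary: f rule: weyl_induct)
  case (scal c)
  have "finite {p. \<exists>x\<in>W p. f (scal c \<odot> x) \<noteq> 0}"
    by (rule finite_subset[OF _ star_finite[OF scal]]) (auto simp: W_carrier star_scal[OF scal])
  then show ?case
    by (intro star_restrictI) (simp_all add: star_add[OF scal] star_scal[OF scal] smult_r_distr algebra_simps)
next
  case (X i)
  have "finite ((\<lambda>q. q(i := q i + 1)) -` {p. \<exists>x\<in>W p. f x \<noteq> 0})"
    by (rule finite_vimageI[OF star_finite[OF X] shift_inj])
  then have "finite {p. \<exists>x\<in>W p. f (X_op i \<odot> x) \<noteq> 0}"
    by (rule rev_finite_subset) (use X_weight in blast)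
  then show ?case
    by (intro star_restrictI)
      (simp_all add: star_add[OF X] star_scal[OF X] smult_r_distr scal_comm[of "X_op i"])
next
  case (Y i)
  have "inj (\<lambda>q :: 'i \<Rightarrow> 'k. q(i := q i - 1))" using shift_inj[of i "-1"] by simp
  then have "finite ((\<lambda>q. q(i := q i - 1)) -` {p. \<exists>x\<in>W p. f x \<noteq> 0})"
    by (rule finite_vimageI[OF star_finite[OF Y]])
  then have "finite {p. \<exists>x\<in>W p. f (Y_op i \<odot> x) \<noteq> 0}"
    by (rule rev_finite_subset) (use Y_weight in blast)
  then show ?case
    by (intro star_restrictI)
      (simp_all add: star_add[OF Y] star_scal[OF Y] smult_r_distr scal_comm[of "Y_op i"])
next
  case (add a b)
  have "(\<lambda>x\<in>carrier M. f ((\<lambda>f. a f + b f) \<odot> x)) =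
      (\<lambda>x\<in>carrier M. (\<lambda>x\<in>carrier M. f (a \<odot> x)) x + (\<lambda>x\<in>carrier M. f (b \<odot> x)) x)"
    by (rule restrict_ext)
      (simp only: act_add[OF add.hyps] star_add[OF add.prems smult_closed[OF add.hyps(1)] smult_closed[OF add.hyps(2)]]
        restrict_apply')
  then show ?case using star_closed_add[OF add.IH[OF add.prems]] by (simp only:)
next
  case (mult a b)
  have "(\<lambda>x\<in>carrier M. f ((a \<circ> b) \<odot> x)) = (\<lambda>x\<in>carrier M. (\<lambda>x\<in>carrier M. f (a \<odot> x)) (b \<odot> x))"
    by (rule restrict_ext) (simp only: act_comp[OF mult.hyps] restrict_apply' smult_closed[OF mult.hyps(2)])
  then show ?case using mult.IH(2)[OF mult.IH(1)[OF mult.prems]] by (simp only:)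
qed

lemma weyl_mod_star: "weyl_mod (star_module M)"
  unfolding weyl_mod_def
proof (rule left_module.intro[OF ring_weyl])
  have ext: "f = g" if "f \<in> carrier (star_module M)" "g \<in> extensional (carrier M)"
    "\<And>x. x \<in> carrier M \<Longrightarrow> f x = g x" for f g
    using extensionalityI[OF star_extensional[OF that(1)] that(2,3)] .
  have zero: "(\<lambda>x\<in>carrier M. 0) \<in> carrier (star_module M)"
  proof -
    have "{p. \<exists>x\<in>W p. (\<lambda>x\<in>carrier M. 0 :: 'k) x \<noteq> 0} = {}" by (auto simp: W_carrier)
    then show ?thesis by (simp add: star_carrier)
  qed
  show "abelian_group (star_module M)"
  proof (rule abelian_groupI)
    fix f assume f: "f \<in> carrier (star_module M)"
    show "\<exists>g\<in>carrier (star_module M). g \<oplus>\<^bsub>star_module M\<^esub> f = \<zero>\<^bsub>star_module M\<^esub>"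
      using star_closed_act[OF weyl_intros(1) f, of "-1"]
      by (rule rev_bexI) (auto simp: star_scal[OF f])
    show "\<zero>\<^bsub>star_module M\<^esub> \<oplus>\<^bsub>star_module M\<^esub> f = f"
      by (rule ext[symmetric, OF f]) auto
    fix g assume g: "g \<in> carrier (star_module M)"
    show "f \<oplus>\<^bsub>star_module M\<^esub> g \<in> carrier (star_module M)"
      using star_closed_add[OF f g] by simp
    show "f \<oplus>\<^bsub>star_module M\<^esub> g = g \<oplus>\<^bsub>star_module M\<^esub> f" by (auto simp: add.commute)
  qed (auto simp: zero add.assoc)
  show "left_module_axioms weyl (star_module M)"
  proof (rule left_module_axioms.intro)
    fix a b :: "('i, 'k) opr" and f g
    assume a: "a \<in> carrier weyl" and f: "f \<in> carrier (star_module M)"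
    note da = diamond_closed[OF a]
    show "a \<odot>\<^bsub>star_module M\<^esub> f \<in> carrier (star_module M)"
      using star_closed_act[OF da f] by simp
    show "a \<odot>\<^bsub>star_module M\<^esub> (f \<oplus>\<^bsub>star_module M\<^esub> g) = a \<odot>\<^bsub>star_module M\<^esub> f \<oplus>\<^bsub>star_module M\<^esub> a \<odot>\<^bsub>star_module M\<^esub> g"
      using da by auto
    assume b: "b \<in> carrier weyl"
    note db = diamond_closed[OF b]
    show "(a \<oplus>\<^bsub>weyl\<^esub> b) \<odot>\<^bsub>star_module M\<^esub> f = a \<odot>\<^bsub>star_module M\<^esub> f \<oplus>\<^bsub>star_module M\<^esub> b \<odot>\<^bsub>star_module M\<^esub> f"
      unfolding weyl_sel star_module_sel diamond_add[OF a b]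
      by (rule restrict_ext) (simp only: act_add[OF da db] star_add[OF f smult_closed[OF da] smult_closed[OF db]] restrict_apply')
    show "(a \<otimes>\<^bsub>weyl\<^esub> b) \<odot>\<^bsub>star_module M\<^esub> f = a \<odot>\<^bsub>star_module M\<^esub> (b \<odot>\<^bsub>star_module M\<^esub> f)"
      unfolding weyl_sel star_module_sel diamond_comp[OF a b]
      by (rule restrict_ext) (simp only: act_comp[OF db da] restrict_apply' smult_closed[OF da])
  next
    fix f assume f: "f \<in> carrier (star_module M)"
    show "\<one>\<^bsub>weyl\<^esub> \<odot>\<^bsub>star_module M\<^esub> f = f"
      unfolding weyl_sel star_module_sel diamond_id
      by (rule ext[symmetric, OF f]) (simp_all only: act_id restrict_apply' restrict_extensional)
  qed
qed

text \<open>\<open>diamond\<close> reverses \<open>X_op i \<circ> Y_op i\<close> and exchanges its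
  factors, so it fixes \<open>t_op i\<close>. This is why dualising preserves weights.\<close>

lemma star_t_act:
  assumes "x \<in> carrier M"
  shows "(t_op i \<odot>\<^bsub>star_module M\<^esub> f) x = f (t_op i \<odot> x)"
proof -
  have "diamond (t_op i) = (t_op i :: ('i, 'k) opr)"
    unfolding t_op_def diamond_comp[OF weyl_intros(2,3)] diamond_props ..
  then show ?thesis using assms by simp
qed

end

abbreviation "B_star p \<equiv> star_module (B_module p)"

text \<open>The dual basis to the monomials, restricted to the carrier because elements of
  \<open>star_module\<close> are extensional.\<close>

definition B_dual :: "('i \<Rightarrow> 'k::field) \<Rightarrow> ('i \<Rightarrow> 'k) \<Rightarrow> ('i, 'k) gpolys \<Rightarrow> 'k" where
  "B_dual p m = (\<lambda>f\<in>carrier (B_module p). lookup f m)"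

lemma B_functional_eqI:
  fixes p :: "'i \<Rightarrow> 'k::field_char_0"
  assumes F: "F \<in> carrier (B_star p)" and G: "G \<in> carrier (B_star p)"
    and eq: "\<And>m. m \<in> weight_coset p \<Longrightarrow> F (single m 1) = G (single m 1)"
  shows "F = G"
proof -
  interpret B: string_module "B_module p" p "\<lambda>m. single m 1" by (rule string_module_B)
  have at_zero: "H \<zero>\<^bsub>B_module p\<^esub> = 0" if "H \<in> carrier (B_star p)" for H
    using B.star_add[OF that B.M.zero_closed B.M.zero_closed] by simp
  show ?thesis
  proof (rule extensionalityI[OF B.star_extensional[OF F] B.star_extensional[OF G]])
    fix f assume "f \<in> carrier (B_module p)"
    then show "F f = G f"
    proof (induction rule: B.weight_induct)
      case zero
      show ?case by (simp only: at_zero[OF F] at_zero[OF G])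
    next
      case (add f w q)
      have "F w = G w"
      proof (cases "q \<in> weight_coset p")
        case True
        note sc = B.W_carrier[OF B.eps_weight[OF True]]
        obtain c where "w = scal c \<odot>\<^bsub>B_module p\<^esub> single q 1"
          using B.eps_span[OF True add.hyps(2)] by blast
        then show ?thesis
          using B.star_scal[OF F sc] B.star_scal[OF G sc] eq[OF True] by simp
      next
        case False
        show ?thesis by (simp only: B.weights[OF False add.hyps(2)] at_zero[OF F] at_zero[OF G])
      qed
      then show ?case
        using add.IH B.star_add[OF F add.hyps(1) B.W_carrier[OF add.hyps(2)]]
          B.star_add[OF G add.hyps(1) B.W_carrier[OF add.hyps(2)]] by simp
    qed
  qed
qed

lemma B_dual_carrier:
  fixes p :: "'i \<Rightarrow> 'k::field_char_0"
  shows "B_dual p m \<in> carrier (B_star p)"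
proof -
  interpret B: weyl_mod "B_module p" by (rule weyl_mod_B)
  have "{q. \<exists>x\<in>weight_space (B_module p) q. B_dual p m x \<noteq> 0} \<subseteq> {m}"
  proof
    fix q assume "q \<in> {q. \<exists>x\<in>weight_space (B_module p) q. B_dual p m x \<noteq> 0}"
    then obtain x where x: "x \<in> weight_space (B_module p) q" "B_dual p m x \<noteq> 0" by blast
    then have "lookup (single q (lookup x q)) m \<noteq> 0"
      using B.W_carrier[OF x(1)] B_weight_keys[OF x(1)] by (simp add: B_dual_def)
    then show "q \<in> {m}" by (auto simp: lookup_single when_def split: if_splits)
  qed
  then have "finite {q. \<exists>x\<in>weight_space (B_module p) q. B_dual p m x \<noteq> 0}"
    by (rule finite_subset) simp
  moreover have "B_dual p m (f + g) = B_dual p m f + B_dual p m g"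
    if "f \<in> carrier (B_module p)" "g \<in> carrier (B_module p)" for f g
    using that B.M.a_closed[OF that] by (simp add: B_dual_def lookup_add)
  moreover have "B_dual p m (weyl_action (scal c) f) = c * B_dual p m f" if "f \<in> carrier (B_module p)" for f c
    using that B_closed[OF weyl_intros(1) that] by (simp add: B_dual_def weyl_action_props)
  ultimately show ?thesis
    by (simp add: star_carrier) (simp add: B_dual_def)
qed

lemma B_dual_single:
  fixes p :: "'i \<Rightarrow> 'k::field_char_0"
  shows "n \<in> weight_coset p \<Longrightarrow> B_dual p m (single n c) = (if n = m then c else 0)"
  using B_single_carrier[of n p c] by (simp add: B_dual_def lookup_single when_def)

lemma string_module_star_B:
  "string_module (B_star p) (p :: 'i \<Rightarrow> 'k::field_char_0) (B_dual p)"
proof -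
  interpret B: string_module "B_module p" p "\<lambda>m. single m 1" by (rule string_module_B)
  interpret S: weyl_mod "B_star p" by (rule B.weyl_mod_star)
  note scar = B_single_carrier[of _ p]
  have act_scal: "(scal c \<odot>\<^bsub>B_star p\<^esub> F) f = c * F f"
    if "F \<in> carrier (B_star p)" "f \<in> carrier (B_module p)" for c F f
    using that B.star_scal[OF that] by (simp add: diamond_props)
  have t_single: "F (t_op i \<odot>\<^bsub>B_module p\<^esub> single m 1) = m i * F (single m 1)"
    if "F \<in> carrier (B_star p)" "m \<in> weight_coset p" for F m i
    using B.W_t[OF B.eps_weight[OF that(2)], of i] B.star_scal[OF that(1) scar[OF that(2)]] by simp
  have weight: "B_dual p m \<in> S.W m" if m: "m \<in> weight_coset p" for m
  proof -
    have "t_op i \<odot>\<^bsub>B_star p\<^esub> B_dual p m = scal (m i) \<odot>\<^bsub>B_star p\<^esub> B_dual p m" for i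
    proof (rule B_functional_eqI)
      fix n assume n: "n \<in> weight_coset p"
      show "(t_op i \<odot>\<^bsub>B_star p\<^esub> B_dual p m) (single n 1) =
          (scal (m i) \<odot>\<^bsub>B_star p\<^esub> B_dual p m) (single n 1)"
        unfolding B.star_t_act[OF scar[OF n]] t_single[OF B_dual_carrier n] act_scal[OF B_dual_carrier scar[OF n]]
        by (simp add: B_dual_single[OF n])
    qed (intro S.smult_closed t_op_weyl weyl_intros B_dual_carrier)+
    then show ?thesis using B_dual_carrier unfolding weight_space_def by blast
  qed
  \<comment> \<open>Induction on a finite set containing the monomials on which \<open>F\<close>
    does not vanish: one multiple of a coordinate functional is subtracted at a time.\<close>
  have "F \<in> wspan (B_star p) (\<lambda>_. True)"
    if "finite A" "F \<in> carrier (B_star p)"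
      "{m \<in> weight_coset p. F (single m 1) \<noteq> 0} \<subseteq> A" for A F
    using that
  proof (induction A arbitrary: F rule: finite_induct)
    case empty
    have "F = \<zero>\<^bsub>B_star p\<^esub>"
      using empty scar by (intro B_functional_eqI[OF empty(1) S.M.zero_closed]) auto
    then show ?case using wspan.zero by metis
  next
    case (insert m A)
    show ?case
    proof (cases "m \<in> weight_coset p")
      case False
      then have "{m \<in> weight_coset p. F (single m 1) \<noteq> 0} \<subseteq> A" using insert.prems(2) by auto
      then show ?thesis using insert.IH insert.prems(1) by blast
    next
      case True
      define c where "c = F (single m 1)"
      define G where "G = F \<oplus>\<^bsub>B_star p\<^esub> (scal (- c) \<odot>\<^bsub>B_star p\<^esub> B_dual p m)"
      have G: "G \<in> carrier (B_star p)"
        unfolding G_def by (intro S.M.a_closed S.smult_closed insert.prems weyl_intros B_dual_carrier)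
      have "G (single n 1) = F (single n 1) - (if n = m then c else 0)"
        if n: "n \<in> weight_coset p" for n
        using scar[OF n, of 1] act_scal[OF B_dual_carrier scar[OF n], of "- c" m 1] n
        by (simp add: G_def B_dual_single del: star_module_sel(3))
      then have "{n \<in> weight_coset p. G (single n 1) \<noteq> 0} \<subseteq> A"
        using insert.prems(2) by (auto simp: c_def split: if_splits)
      then have "G \<in> wspan (B_star p) (\<lambda>_. True)" using insert.IH[OF G] by blast
      moreover have "scal c \<odot>\<^bsub>B_star p\<^esub> B_dual p m \<in> wspan (B_star p) (\<lambda>_. True)"
        by (rule S.wspan_weight[OF S.W_scal[OF weight[OF True]] TrueI])
      moreover have "G \<oplus>\<^bsub>B_star p\<^esub> (scal c \<odot>\<^bsub>B_star p\<^esub> B_dual p m) = F"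
        unfolding G_def S.scal_uminus[OF B_dual_carrier]
        using insert.prems(1) S.smult_closed[OF weyl_intros(1) B_dual_carrier, of c m]
        by (simp add: S.M.a_assoc S.M.l_neg del: star_module_sel)
      ultimately show ?thesis using S.wspan_add by metis
    qed
  qed
  \<comment> \<open>The support condition in \<open>star_module\<close> provides this finiteness,
    since each monomial is a weight vector for its own exponent.\<close>
  moreover have "finite {m \<in> weight_coset p. F (single m 1) \<noteq> 0}"
    if "F \<in> carrier (B_star p)" for F
    by (rule finite_subset[OF _ B.star_finite[OF that]]) (use B.eps_weight in auto)
  ultimately have wspan: "F \<in> wspan (B_star p) (\<lambda>_. True)"
    if "F \<in> carrier (B_star p)" for F
    using that by blast
  have vanish: "F (single n 1) = 0" if F: "F \<in> S.W m" and n: "n \<in> weight_coset p" "n \<noteq> m" for F m n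
  proof -
    note Fc = S.W_carrier[OF F]
    obtain i where i: "n i \<noteq> m i" using n(2) by (meson ext)
    \<comment> \<open>One number computed twice, through the eigenvalue of the monomial and through
      that of \<open>F\<close>.\<close>
    have "n i * F (single n 1) = m i * F (single n 1)"
      using fun_cong[OF S.W_t[OF F, of i], of "single n 1"]
      unfolding B.star_t_act[OF scar[OF n(1)]] t_single[OF Fc n(1)] act_scal[OF Fc scar[OF n(1)]] .
    then show ?thesis using i by simp
  qed
  show ?thesis
  proof unfold_locales
    show "F \<in> wspan (B_star p) (\<lambda>_. True)" if "F \<in> carrier (B_star p)" for F
      by (rule wspan[OF that])
  next
    fix m assume m: "m \<in> weight_coset p"
    show "B_dual p m \<in> S.W m" by (rule weight[OF m])
    show "B_dual p m \<noteq> \<zero>\<^bsub>B_star p\<^esub>"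
    proof
      assume "B_dual p m = \<zero>\<^bsub>B_star p\<^esub>"
      from fun_cong[OF this, of "single m 1"] show False
        using scar[OF m, of 1] m by (simp add: B_dual_single)
    qed
    fix F assume F: "F \<in> S.W m"
    have "F = scal (F (single m 1)) \<odot>\<^bsub>B_star p\<^esub> B_dual p m"
    proof (rule B_functional_eqI[OF S.W_carrier[OF F] S.smult_closed[OF weyl_intros(1) B_dual_carrier]])
      fix n assume n: "n \<in> weight_coset p"
      show "F (single n 1) =
        (scal (F (single m 1)) \<odot>\<^bsub>B_star p\<^esub> B_dual p m) (single n 1)"
        unfolding act_scal[OF B_dual_carrier scar[OF n]]
        using vanish[OF F n] by (simp add: B_dual_single[OF n])
    qed
    then show "\<exists>c. F = scal c \<odot>\<^bsub>B_star p\<^esub> B_dual p m" by blast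
  next
    fix m F assume m: "m \<notin> weight_coset p" and F: "F \<in> S.W m"
    show "F = \<zero>\<^bsub>B_star p\<^esub>"
    proof (rule B_functional_eqI[OF S.W_carrier[OF F] S.M.zero_closed])
      fix n assume n: "n \<in> weight_coset p"
      then have "n \<noteq> m" using m by blast
      then show "F (single n 1) = \<zero>\<^bsub>B_star p\<^esub> (single n 1)"
        using vanish[OF F n] scar[OF n, of 1] by simp
    qed
  qed
qed

section \<open>Where the generators vanish, and the conclusion\<close>

lemma single_nonzero: "single m (c :: 'k::zero) = 0 \<longleftrightarrow> c = 0"
  by (metis lookup_single_eq lookup_zero single_zero)

lemma X_B_nonzero: "X_op i \<odot>\<^bsub>B_module p\<^esub> single m (1 :: 'k::field_char_0) \<noteq> \<zero>\<^bsub>B_module p\<^esub>"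
  by (simp add: weyl_action_props single_nonzero)

lemma Y_B_nonzero:
  "m i \<noteq> 0 \<Longrightarrow> Y_op i \<odot>\<^bsub>B_module p\<^esub> single m (1 :: 'k::field_char_0) \<noteq> \<zero>\<^bsub>B_module p\<^esub>"
  by (simp add: weyl_action_props single_nonzero)

text \<open>\<open>X_op i\<close> acts on the dual as the transpose of \<open>Y_op i\<close>.
  Testing on the monomial one step up yields the coefficient \<open>m i + 1\<close>, so the critical
  exponent is -1 rather than 0.\<close>

lemma X_B_dual_nonzero:
  fixes p :: "'i \<Rightarrow> 'k::field_char_0"
  assumes m: "m \<in> weight_coset p" and "m i + 1 \<noteq> 0"
  shows "X_op i \<odot>\<^bsub>B_star p\<^esub> B_dual p m \<noteq> \<zero>\<^bsub>B_star p\<^esub>"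
proof
  assume 0: "X_op i \<odot>\<^bsub>B_star p\<^esub> B_dual p m = \<zero>\<^bsub>B_star p\<^esub>"
  let ?n = "m(i := m i + 1)"
  have n: "?n \<in> weight_coset p" using weight_coset_shift[OF m, of i 1] by simp
  show False
    using fun_cong[OF 0, of "single ?n 1"] B_single_carrier[OF n, of 1] assms
    by (simp add: diamond_props weyl_action_props B_dual_single)
qed

text \<open>\<open>Y_op i\<close> acts on the dual as the transpose of multiplication by the
  variable, so testing on the monomial one step down yields 1.\<close>

lemma Y_B_dual_nonzero:
  fixes p :: "'i \<Rightarrow> 'k::field_char_0"
  assumes m: "m \<in> weight_coset p"
  shows "Y_op i \<odot>\<^bsub>B_star p\<^esub> B_dual p m \<noteq> \<zero>\<^bsub>B_star p\<^esub>"
proof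
  assume 0: "Y_op i \<odot>\<^bsub>B_star p\<^esub> B_dual p m = \<zero>\<^bsub>B_star p\<^esub>"
  let ?n = "m(i := m i - 1)"
  have n: "?n \<in> weight_coset p" using weight_coset_shift[OF m, of i "-1"] by simp
  show False
    using fun_cong[OF 0, of "single ?n 1"] B_single_carrier[OF n, of 1] assms
    by (simp add: diamond_props weyl_action_props B_dual_single)
qed

theorem proposition3:
  fixes p :: "'i \<Rightarrow> 'k::{alg_closed_field, field_char_0}"
  assumes "infinite (UNIV :: 'i set)"
    and "(UNIV :: 'i set) \<prec> (UNIV :: 'k set)"
  shows "((\<forall>i. p i \<in> \<int> \<longrightarrow> (\<exists>n::nat. p i = of_nat n)) \<longrightarrow>
      injective_envelope TYPE('m) TYPE('n) (B_module p) (L_module p) \<and>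
      projective_cover TYPE('m) TYPE('n) (star_module (B_module p)) (L_module p)) \<and>
    ((\<forall>i. p i \<in> \<int> \<longrightarrow> (\<exists>n::nat. n \<ge> 1 \<and> p i = - of_nat n)) \<longrightarrow>
      projective_cover TYPE('m) TYPE('n) (B_module p) (L_module p) \<and>
      injective_envelope TYPE('m) TYPE('n) (star_module (B_module p)) (L_module p))"
proof -
  interpret B: string_module "B_module p" p "\<lambda>m. single m 1" by (rule string_module_B)
  interpret D: string_module "star_module (B_module p)" p "B_dual p" by (rule string_module_star_B)
  have int: "p i = of_int (- k)" if "p i + of_int k = 0" for i k
    using that by (simp add: eq_neg_iff_add_eq_0)
  show ?thesis
  proof (intro conjI impI)
    assume p: "\<forall>i. p i \<in> \<int> \<longrightarrow> (\<exists>n::nat. p i = of_nat n)"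
    \<comment> \<open>Exponent 0 occurs only at \<open>p\<close> or below it, so differentiation
      does not vanish on the way back to \<open>p\<close> from above. Taken at
      \<open>k = z i + 1\<close>, the bound treats exponent -1 on the dual.\<close>
    have nonneg: "k \<le> 0" if "p i + of_int k = 0" for i k
    proof -
      have "p i \<in> \<int>" using int[OF that] by simp
      then obtain n :: nat where "p i = of_nat n" using p by blast
      then have "of_int (int n) = (of_int (- k) :: 'k)" using int[OF that] by simp
      then have "int n = - k" by (simp only: of_int_eq_iff)
      then show ?thesis by simp
    qed
    show "injective_envelope TYPE('m) TYPE('n) (B_module p) (L_module p)"
      by (rule B.injective_envelope[OF X_B_nonzero Y_B_nonzero]) (use nonneg in force)
    show "projective_cover TYPE('m) TYPE('n) (star_module (B_module p)) (L_module p)"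
    proof (rule D.projective_cover[OF X_B_dual_nonzero Y_B_dual_nonzero])
      fix z :: "'i \<Rightarrow> int" and i
      assume "z i \<ge> 0"
      then show "p i + of_int (z i) + 1 \<noteq> 0"
        using nonneg[of i "z i + 1"] by (auto simp: add.assoc)
    qed (auto intro: weight_cosetI)
  next
    assume p: "\<forall>i. p i \<in> \<int> \<longrightarrow> (\<exists>n::nat. n \<ge> 1 \<and> p i = - of_nat n)"
    \<comment> \<open>Now exponent 0 lies strictly above \<open>p\<close>, where differentiation
      leads back to \<open>p\<close> and not away from it.\<close>
    have pos: "k \<ge> 1" if "p i + of_int k = 0" for i k
    proof -
      have "p i \<in> \<int>" using int[OF that] by simp
      then obtain n :: nat where n: "n \<ge> 1" "p i = - of_nat n" using p by blast
      then have "of_int (- int n) = (of_int (- k) :: 'k)" using int[OF that] by simp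
      then have "- int n = - k" by (simp only: of_int_eq_iff)
      then show ?thesis using n(1) by simp
    qed
    show "projective_cover TYPE('m) TYPE('n) (B_module p) (L_module p)"
      by (rule B.projective_cover[OF X_B_nonzero Y_B_nonzero]) (use pos in force)
    show "injective_envelope TYPE('m) TYPE('n) (star_module (B_module p)) (L_module p)"
    proof (rule D.injective_envelope[OF X_B_dual_nonzero Y_B_dual_nonzero])
      fix z :: "'i \<Rightarrow> int" and i
      assume "z i < 0"
      \<comment> \<open>The strict inequality matters: it gives \<open>z i + 1 \<le> 0\<close>,
        which the bound \<open>pos\<close> excludes for a zero.\<close>
      then show "p i + of_int (z i) + 1 \<noteq> 0"
        using pos[of i "z i + 1"] by (auto simp: add.assoc)
    qed (auto intro: weight_cosetI)
  qed
qed

end
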